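(* Let $m=1$, let $(A,B)$ be controllable with $A\in\mathbb{R}^{n\times n}$, $B\in\mathbb{R}^{n\times 1}$, $B\neq 0$, let $T>0$, and let $K(t)$, $t\in[0,T]$, be a feedback matrix with associated $P_0(t)$ and $G(t)$ as in the context. Consider the inverse problem: find $Q\in\mathbb{S}_+^n$ for which there exists a symmetric-matrix-valued continuous function $Y(t)$ on $[0,T]$ such that $$\dot Y(t)=-A^TY(t)-Y(t)A-Q-G(t),\qquad B^TY(t)=0\quad\forall t\in[0,T],\qquad Y(T)+P_0(T)\succeq 0 .$$ With $H,N,f,A_Q,B_Q,D$ as in the context, put $$A_s=\begin{bmatrix}A_QD&0\\ ND&HD\end{bmatrix},\qquad b_s=\begin{bmatrix}B_Q\\ -f(\mathrm{vec}(G))(T)\end{bmatrix}.$$ Then the inverse problem is feasible (i.e. such a $Q$ exists) if and only if the following three conditions all hold: (i) $B_Q=B_Q(t)$ is constant over $[0,T]$; (ii) $A_sA_s^\dagger b_s=b_s$; (iii) there exists $v=(v_1,\dots,v_r)^T\in\mathbb{R}^r$ such that $$Q_0+\sum_{i=1}^r v_iQ_i\succeq 0,\qquad P_0(T)+Y_{T0}+\sum_{i=1}^r v_iY_{Ti}\succeq 0,$$ where $\begin{bmatrix}q^0\\ y_T^0\end{bmatrix}:=A_s^\dagger b_s$, the vectors $\begin{bmatrix}q^1\\ y_T^1\end{bmatrix},\dots,\begin{bmatrix}q^r\\ y_T^r\end{bmatrix}$ span the null space of $A_s$, and $Q_i=\mathrm{mat}(Dq^i)$, $Y_{Ti}=\mathrm{mat}(Dy_T^i)$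 for $i=0,1,\dots,r$ (all in $\mathbb{S}^n$).
   Context: $\mathbb{S}^n$ is the space of real symmetric $n\times n$ matrices, $\mathbb{S}_+^n$ the cone of positive semidefinite ones; $X\succeq 0$ means positive semidefinite. $X^\dagger$ is the Moore-Penrose inverse, $\otimes$ the Kronecker product. $\mathrm{vec}$ stacks columns, $\mathrm{mat}:\mathbb{R}^{n^2}\to\mathbb{R}^{n\times n}$ is its inverse, $\mathrm{vech}$ is half-vectorization of symmetric matrices, and $D$ is the duplication matrix, i.e. $\mathrm{vec}(X)=D\,\mathrm{vech}(X)$ for all $X\in\mathbb{S}^n$. Data: $K(t)\in\mathbb{R}^{m\times n}$, $t\in[0,T]$, is such that $K(t)B$ is symmetric and $\mathrm{rank}(K(t)B)=\mathrm{rank}(K(t))$ for all $t$. Put $P_0(t)=-K^T(t)(K(t)B)^\dagger K(t)$ and $G(t)=\dot P_0+A^TP_0+P_0A-P_0BB^TP_0$. It is assumed that $P_0$ is $n$ times continuously differentiable on $[0,T]$, so that $G$ is $n-1$ times continuously differentiable. Notation: $\tilde A=-I_n\otimes A-A\otimes I_n$, $\tilde B=I_n\otimes B$; $$H=\begin{bmatrix}\tilde B^T\\ \tilde B^T\tilde A^T\\ \vdots\\ \tilde B^T(\tilde A^T)^{n-1}\end{bmatrix},\qquad N=\begin{bmatrix}0\\ -\tilde B^T\\ -\tilde B^T\tilde A^T\\ \vdots\\ -\tilde B^T(\tilde A^T)^{n-2}\end{bmatrix},$$ and $f(\mathrm{vec}(G))=f(\mathrm{vec}(G))(t)$ is the vector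 with $n$ blocks, whose block number $k$ ($k=0,\dots,n-1$) is $-\sum_{i=0}^{k-1}\tilde B^T(\tilde A^T)^{k-1-i}\mathrm{vec}(G^{(i)}(t))$ (so block $0$ is zero), $G^{(i)}$ denoting the $i$-th time derivative. For $m=1$ and $(A,B)$ controllable, $H$ is square and invertible. $\dot f(\mathrm{vec}(G))$ is the time derivative of $f(\mathrm{vec}(G))(t)$. Finally $$A_Q=H\tilde A^TH^{-1}N+H,\qquad B_Q(t)=-H\tilde A^TH^{-1}f(\mathrm{vec}(G))+\dot f(\mathrm{vec}(G))-H\,\mathrm{vec}(G).$$ *)

theory Defs
  imports
    "HOL-Analysis.Derivative"
    "Jordan_Normal_Form.DL_Rank"
    "Jordan_Normal_Form.Matrix_Kernel"
    "Jordan_Normal_Form.Gauss_Jordan_Elimination"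
begin

section \<open>Matrix notions\<close>

definition sym_mat :: "nat \<Rightarrow> real mat \<Rightarrow> bool" where
  "sym_mat n X \<longleftrightarrow> X \<in> carrier_mat n n \<and> transpose_mat X = X"

definition psd_mat :: "nat \<Rightarrow> real mat \<Rightarrow> bool" where
  "psd_mat n X \<longleftrightarrow> sym_mat n X \<and> (\<forall>x \<in> carrier_vec n. 0 \<le> scalar_prod x (X *\<^sub>v x))"

text \<open>The Moore-Penrose inverse, by the four Penrose conditions.\<close>

definition is_pinv :: "real mat \<Rightarrow> real mat \<Rightarrow> bool" where
  "is_pinv X Z \<longleftrightarrow> Z \<in> carrier_mat (dim_col X) (dim_row X) \<and>
     X * Z * X = X \<and> Z * X * Z = Z \<and>
     transpose_mat (X * Z) = X * Z \<and> transpose_mat (Z * X) = Z * X"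

definition pinv :: "real mat \<Rightarrow> real mat" where
  "pinv X = (THE Z. is_pinv X Z)"

definition kron :: "real mat \<Rightarrow> real mat \<Rightarrow> real mat" where
  "kron X Z = mat (dim_row X * dim_row Z) (dim_col X * dim_col Z)
     (\<lambda>(i, j). X $$ (i div dim_row Z, j div dim_col Z) * Z $$ (i mod dim_row Z, j mod dim_col Z))"

text \<open>Column stacking and its inverse on vectors of length \<open>n * n\<close>.\<close>

definition vec_stack :: "real mat \<Rightarrow> real vec" where
  "vec_stack X = vec (dim_row X * dim_col X) (\<lambda>k. X $$ (k mod dim_row X, k div dim_row X))"

definition mat_unstack :: "nat \<Rightarrow> real vec \<Rightarrow> real mat" where
  "mat_unstack n x = mat n n (\<lambda>(i, j). x $ (j * n + i))"

text \<open>Half-vectorization lists the lower triangle (diagonal included) column by column.\<close>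

definition vech_index :: "nat \<Rightarrow> (nat \<times> nat) list" where
  "vech_index n = concat (map (\<lambda>j. map (\<lambda>i. (i, j)) [j..<n]) [0..<n])"

definition vech :: "real mat \<Rightarrow> real vec" where
  "vech X = vec_of_list (map (\<lambda>p. X $$ p) (vech_index (dim_row X)))"

definition dup_mat :: "nat \<Rightarrow> real mat" where
  "dup_mat n = mat (n * n) (n * (n + 1) div 2)
     (\<lambda>(k, l). if vech_index n ! l = (max (k mod n) (k div n), min (k mod n) (k div n)) then 1 else 0)"

lemma length_vech_index: "length (vech_index n) = n * (n + 1) div 2"
proof -
  have "length (vech_index n) = (\<Sum>j<n. n - j)"
    by (simp add: vech_index_def length_concat comp_def sum_list_sum_nth atLeast0LessThan)
  also have "\<dots> = (\<Sum>j<n. Suc j)"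
    by (subst sum.nat_diff_reindex[symmetric], rule sum.cong) auto
  also have "\<dots> = n * (n + 1) div 2"
    by (induction n) auto
  finally show ?thesis .
qed

lemma set_vech_index: "set (vech_index n) = {(i, j). j \<le> i \<and> i < n}"
  by (auto simp: vech_index_def image_iff)

lemma distinct_vech_index: "distinct (vech_index n)"
proof -
  have "distinct (concat (map (\<lambda>j. map (\<lambda>i. (i, j)) [j..<n]) xs))" if "distinct xs" for xs
    using that by (induction xs) (auto simp: distinct_map inj_on_def)
  then show ?thesis by (simp add: vech_index_def)
qed

lemma vech_nth:
  assumes "X \<in> carrier_mat n n" "l < n * (n + 1) div 2"
  shows "vech X $ l = X $$ (vech_index n ! l)"
  using assms unfolding vech_def
  by (subst vec_of_list_index) (auto simp: length_vech_index)

lemma dim_vech: "X \<in> carrier_mat n n \<Longrightarrow> dim_vec (vech X) = n * (n + 1) div 2"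
  using length_vech_index[of n] by (auto simp: vech_def)

text \<open>\<open>dup_mat n\<close> is the unique matrix with the defining property of the duplication matrix.\<close>

lemma dup_mat_vech:
  assumes "sym_mat n X"
  shows "vec_stack X = dup_mat n *\<^sub>v vech X"
proof (rule eq_vecI)
  have X: "X \<in> carrier_mat n n" and XT: "transpose_mat X = X"
    using assms by (auto simp: sym_mat_def)
  let ?L = "vech_index n" let ?N = "n * (n + 1) div 2"
  show "dim_vec (vec_stack X) = dim_vec (dup_mat n *\<^sub>v vech X)"
    using X by (auto simp: vec_stack_def dup_mat_def)
  fix k assume "k < dim_vec (dup_mat n *\<^sub>v vech X)"
  then have k: "k < n * n" by (simp add: dup_mat_def)
  then have "0 < n" by (cases n) auto
  define i j where "i = k mod n" and "j = k div n"
  have i: "i < n" using \<open>0 < n\<close> by (simp add: i_def)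
  have j: "j < n" using k by (simp add: j_def less_mult_imp_div_less)
  let ?p = "(max i j, min i j)"
  have "?p \<in> set ?L" using i j by (auto simp: set_vech_index)
  then obtain l where l: "l < length ?L" "?L ! l = ?p" by (auto simp: in_set_conv_nth)
  have eq: "?L ! l' = ?p \<longleftrightarrow> l' = l" if "l' < ?N" for l'
    using nth_eq_iff_index_eq[OF distinct_vech_index[of n], of l' l] that l
    by (simp add: length_vech_index)
  have "(dup_mat n *\<^sub>v vech X) $ k
      = (\<Sum>l' \<in> {0..<?N}. (if ?L ! l' = ?p then 1 else 0) * X $$ (?L ! l'))"
    using k dim_vech[OF X]
    by (auto simp: dup_mat_def scalar_prod_def vech_nth[OF X] i_def j_def intro!: sum.cong)
  also have "\<dots> = (\<Sum>l' \<in> {0..<?N}. if l' = l then X $$ (?L ! l) else 0)"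
    by (rule sum.cong) (auto simp: eq)
  also have "\<dots> = X $$ ?p" using l by (simp add: length_vech_index)
  also have "\<dots> = X $$ (i, j)"
  proof -
    have "transpose_mat X $$ (i, j) = X $$ (j, i)" using X i j by simp
    then show ?thesis using XT by (auto simp: max_def min_def)
  qed
  finally show "vec_stack X $ k = (dup_mat n *\<^sub>v vech X) $ k"
    using X k by (simp add: vec_stack_def i_def j_def)
qed

lemma dup_mat_unique:
  assumes D: "D \<in> carrier_mat (n * n) (n * (n + 1) div 2)"
    and "\<And>X. sym_mat n X \<Longrightarrow> vec_stack X = D *\<^sub>v vech X"
  shows "D = dup_mat n"
proof -
  let ?N = "n * (n + 1) div 2" let ?L = "vech_index n"
  have E: "dup_mat n \<in> carrier_mat (n * n) ?N" by (simp add: dup_mat_def)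
  have "col D l = col (dup_mat n) l" if l: "l < ?N" for l
  proof -
    define X :: "real mat" where
      "X = mat n n (\<lambda>(i, j). if ?L ! l = (max i j, min i j) then 1 else 0)"
    have sym: "sym_mat n X"
      by (auto simp: sym_mat_def X_def transpose_mat_def max.commute min.commute)
    have entry: "X $$ (?L ! l') = (if l' = l then 1 else 0)" if "l' < ?N" for l'
    proof -
      have "?L ! l' \<in> set ?L" using that by (simp add: length_vech_index)
      then obtain i j where ij: "?L ! l' = (i, j)" "j \<le> i" "i < n"
        by (auto simp: set_vech_index)
      have "?L ! l = ?L ! l' \<longleftrightarrow> l' = l"
        using nth_eq_iff_index_eq[OF distinct_vech_index[of n], of l l'] that l
        by (auto simp: length_vech_index)
      then show ?thesis using ij by (auto simp: X_def max_def min_def)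
    qed
    have X: "X \<in> carrier_mat n n" using sym by (simp add: sym_mat_def)
    have "vech X = unit_vec ?N l"
      by (rule eq_vecI) (use l in \<open>auto simp: vech_nth[OF X] dim_vech[OF X] entry\<close>)
    then have "D *\<^sub>v unit_vec ?N l = dup_mat n *\<^sub>v unit_vec ?N l"
      using assms(2)[OF sym] dup_mat_vech[OF sym] by simp
    moreover have "Z *\<^sub>v unit_vec ?N l = col Z l" if "Z \<in> carrier_mat (n * n) ?N" for Z :: "real mat"
      using that l by (intro eq_vecI) auto
    ultimately show ?thesis using D E by simp
  qed
  then show ?thesis using D E by (intro mat_col_eqI) auto
qed


section \<open>Matrix-valued functions of time\<close>

text \<open>
  Everything is entrywise and relative to a time set \<open>S\<close>, always an interval \<open>{0..T}\<close>;
  derivatives at its endpoints are one-sided.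
\<close>

definition mat_continuous :: "real set \<Rightarrow> (real \<Rightarrow> real mat) \<Rightarrow> nat \<Rightarrow> nat \<Rightarrow> bool" where
  "mat_continuous S F nr nc \<longleftrightarrow>
     (\<forall>t \<in> S. F t \<in> carrier_mat nr nc) \<and>
     (\<forall>i<nr. \<forall>j<nc. continuous_on S (\<lambda>t. F t $$ (i, j)))"

definition has_mat_derivative ::
  "(real \<Rightarrow> real mat) \<Rightarrow> real mat \<Rightarrow> real \<Rightarrow> real set \<Rightarrow> bool" where
  "has_mat_derivative F F' t S \<longleftrightarrow>
     dim_row F' = dim_row (F t) \<and> dim_col F' = dim_col (F t) \<and>
     (\<forall>i<dim_row F'. \<forall>j<dim_col F'.
        ((\<lambda>s. F s $$ (i, j)) has_vector_derivative F' $$ (i, j)) (at t within S))"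

definition mat_deriv :: "real set \<Rightarrow> (real \<Rightarrow> real mat) \<Rightarrow> real \<Rightarrow> real mat" where
  "mat_deriv S F t = mat (dim_row (F t)) (dim_col (F t))
     (\<lambda>(i, j). vector_derivative (\<lambda>s. F s $$ (i, j)) (at t within S))"

definition vec_deriv :: "real set \<Rightarrow> (real \<Rightarrow> real vec) \<Rightarrow> real \<Rightarrow> real vec" where
  "vec_deriv S f t = vec (dim_vec (f t))
     (\<lambda>i. vector_derivative (\<lambda>s. f s $ i) (at t within S))"

definition mat_Ck :: "nat \<Rightarrow> real set \<Rightarrow> (real \<Rightarrow> real mat) \<Rightarrow> nat \<Rightarrow> nat \<Rightarrow> bool" where
  "mat_Ck k S F nr nc \<longleftrightarrow>
     (\<forall>i<k. \<forall>t \<in> S.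
        has_mat_derivative ((mat_deriv S ^^ i) F) ((mat_deriv S ^^ Suc i) F t) t S) \<and>
     mat_continuous S ((mat_deriv S ^^ k) F) nr nc"


section \<open>Linear systems\<close>

text \<open>
  Controllability of \<open>x' = A x + B u\<close>: any state can be steered to any other one in finite time.
  Time derivatives of vectors are again entrywise.
\<close>

definition controllable :: "nat \<Rightarrow> nat \<Rightarrow> real mat \<Rightarrow> real mat \<Rightarrow> bool" where
  "controllable n m A B \<longleftrightarrow>
     (\<forall>x0 \<in> carrier_vec n. \<forall>x1 \<in> carrier_vec n.
        \<exists>\<tau>>0. \<exists>(u :: real \<Rightarrow> real vec) (x :: real \<Rightarrow> real vec).
          (\<forall>t \<in> {0..\<tau>}. u t \<in> carrier_vec m \<and> x t \<in> carrier_vec n) \<and>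
          (\<forall>j<m. continuous_on {0..\<tau>} (\<lambda>t. u t $ j)) \<and>
          (\<forall>t \<in> {0..\<tau>}. \<forall>i<n.
             ((\<lambda>s. x s $ i) has_vector_derivative (A *\<^sub>v x t + B *\<^sub>v u t) $ i) (at t within {0..\<tau>})) \<and>
          x 0 = x0 \<and> x \<tau> = x1)"

definition P0_of :: "real mat \<Rightarrow> (real \<Rightarrow> real mat) \<Rightarrow> real \<Rightarrow> real mat" where
  "P0_of B K t = - (transpose_mat (K t) * pinv (K t * B) * K t)"

definition G_of :: "real set \<Rightarrow> real mat \<Rightarrow> real mat \<Rightarrow> (real \<Rightarrow> real mat) \<Rightarrow> real \<Rightarrow> real mat" where
  "G_of S A B P0 t =
     mat_deriv S P0 t + transpose_mat A * P0 t + P0 t * A - P0 t * B * transpose_mat B * P0 t"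

definition inverse_problem_solution ::
  "nat \<Rightarrow> real \<Rightarrow> real mat \<Rightarrow> real mat \<Rightarrow> (real \<Rightarrow> real mat) \<Rightarrow> (real \<Rightarrow> real mat) \<Rightarrow> real mat \<Rightarrow> bool" where
  "inverse_problem_solution n T A B P0 G Q \<longleftrightarrow>
     psd_mat n Q \<and>
     (\<exists>Y. (\<forall>t \<in> {0..T}. sym_mat n (Y t)) \<and>
          mat_continuous {0..T} Y n n \<and>
          (\<forall>t \<in> {0..T}.
             has_mat_derivative Y (- (transpose_mat A * Y t) - Y t * A - Q - G t) t {0..T}) \<and>
          (\<forall>t \<in> {0..T}. transpose_mat B * Y t = 0\<^sub>m (dim_col B) n) \<and>
          psd_mat n (Y T + P0 T))"


section \<open>The algebraic data of the inverse problem\<close>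

text \<open>Here \<open>n = dim_row A\<close>, and all blocks are numbered from \<open>0\<close>.\<close>

definition Atil :: "real mat \<Rightarrow> real mat" where
  "Atil A = - kron (1\<^sub>m (dim_row A)) A - kron A (1\<^sub>m (dim_row A))"

definition Btil :: "real mat \<Rightarrow> real mat \<Rightarrow> real mat" where
  "Btil A B = kron (1\<^sub>m (dim_row A)) B"

text \<open>The block \<open>Btil\<^sup>T (Atil\<^sup>T)\<^sup>k\<close>.\<close>

definition BA_block :: "real mat \<Rightarrow> real mat \<Rightarrow> nat \<Rightarrow> real mat" where
  "BA_block A B k = transpose_mat (Btil A B) * (transpose_mat (Atil A) ^\<^sub>m k)"

text \<open>Vertical stacking of \<open>n\<close> blocks \<open>F 0, \<dots>, F (n - 1)\<close>, each with \<open>h\<close> rows.\<close>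

definition stack_mat :: "nat \<Rightarrow> nat \<Rightarrow> nat \<Rightarrow> (nat \<Rightarrow> real mat) \<Rightarrow> real mat" where
  "stack_mat n h nc F = mat (n * h) nc (\<lambda>(i, j). F (i div h) $$ (i mod h, j))"

definition stack_vec :: "nat \<Rightarrow> nat \<Rightarrow> (nat \<Rightarrow> real vec) \<Rightarrow> real vec" where
  "stack_vec n h F = vec (n * h) (\<lambda>i. F (i div h) $ (i mod h))"

definition H_of :: "real mat \<Rightarrow> real mat \<Rightarrow> real mat" where
  "H_of A B = (let n = dim_row A; h = n * dim_col B in
     stack_mat n h (n * n) (BA_block A B))"

definition N_of :: "real mat \<Rightarrow> real mat \<Rightarrow> real mat" where
  "N_of A B = (let n = dim_row A; h = n * dim_col B in
     stack_mat n h (n * n) (\<lambda>k. if k = 0 then 0\<^sub>m h (n * n) else - BA_block A B (k - 1)))"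

definition f_of :: "real set \<Rightarrow> real mat \<Rightarrow> real mat \<Rightarrow> (real \<Rightarrow> real mat) \<Rightarrow> real \<Rightarrow> real vec" where
  "f_of S A B G t = (let n = dim_row A; h = n * dim_col B in
     stack_vec n h (\<lambda>k. - finsum_vec TYPE(real) h
       (\<lambda>i. BA_block A B (k - 1 - i) *\<^sub>v vec_stack ((mat_deriv S ^^ i) G t)) {..<k}))"

text \<open>
  \<open>mat_inverse\<close> is \<open>None\<close> on singular matrices; \<open>H_inv\<close> is only meaningful when \<open>H\<close>
  is square and invertible (single input, controllable pair).
\<close>

definition H_inv :: "real mat \<Rightarrow> real mat \<Rightarrow> real mat" where
  "H_inv A B = the (mat_inverse (H_of A B))"

definition AQ_of :: "real mat \<Rightarrow> real mat \<Rightarrow> real mat" where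
  "AQ_of A B = H_of A B * transpose_mat (Atil A) * H_inv A B * N_of A B + H_of A B"

definition BQ_of :: "real set \<Rightarrow> real mat \<Rightarrow> real mat \<Rightarrow> (real \<Rightarrow> real mat) \<Rightarrow> real \<Rightarrow> real vec" where
  "BQ_of S A B G t =
     - ((H_of A B * transpose_mat (Atil A) * H_inv A B) *\<^sub>v f_of S A B G t)
     + vec_deriv S (f_of S A B G) t
     - H_of A B *\<^sub>v vec_stack (G t)"

definition As_of :: "real mat \<Rightarrow> real mat \<Rightarrow> real mat" where
  "As_of A B = (let D = dup_mat (dim_row A) in
     four_block_mat (AQ_of A B * D) (0\<^sub>m (dim_row (AQ_of A B)) (dim_col D))
                    (N_of A B * D)  (H_of A B * D))"

text \<open>The argument \<open>bQ\<close> is the common value of \<open>BQ_of\<close> over \<open>{0..T}\<close>.\<close>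

definition bs_of ::
  "real \<Rightarrow> real mat \<Rightarrow> real mat \<Rightarrow> (real \<Rightarrow> real mat) \<Rightarrow> real vec \<Rightarrow> real vec" where
  "bs_of T A B G bQ = bQ @\<^sub>v (- f_of {0..T} A B G T)"

definition affine_comb :: "nat \<Rightarrow> nat \<Rightarrow> real mat \<Rightarrow> (nat \<Rightarrow> real) \<Rightarrow> (nat \<Rightarrow> real mat) \<Rightarrow> real mat" where
  "affine_comb n r M0 v M = M0 + mat n n (\<lambda>(i, j). \<Sum>k = 1..r. v k * M k $$ (i, j))"

end

theory Submission
  imports Defs
begin

text \<open>
  Vectorized, the problem reads \<open>y' = At y - q - g\<close> with \<open>At = Atil\<^sup>T\<close>, \<open>q = vec Q\<close>, \<open>g = vec G\<close>,
  under the constraint \<open>Btil\<^sup>T y = 0\<close>. Differentiating the constraint \<open>n - 1\<close> times and inserting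
  the equation each time gives \<open>H y + N q + f = 0\<close>. As \<open>H\<close> is invertible, this determines \<open>y\<close> from
  \<open>q\<close>, and one more differentiation shows that the differential equation holds if and only if
  \<open>A\<^sub>Q q = B\<^sub>Q(t)\<close> for all \<open>t\<close>; together with the constraint at \<open>t = T\<close> this is the linear system
  with matrix \<open>A\<^sub>s\<close>. Conversely, \<open>y := - H\<^sup>-\<^sup>1 (N q + f)\<close> solves everything, and the symmetry of
  \<open>Y(t)\<close> is inherited from that of \<open>Y(T)\<close> by uniqueness for linear differential equations.
\<close>

section \<open>The Moore-Penrose inverse\<close>

text \<open>Everything rests on \<open>H\<close> being injective. Its block rows contain only the
  powers 0 to n - 1 of an operator on a space of dimension n * n, where Cayley-Hamilton would ask
  for n * n powers. What saves the count is the shape of the operator, Y -> -(A^T Y + Y A): up to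
  multiplication by A from the right, which keeps vanishing blocks zero, it acts as -A^T on each
  column of Y, and for a column n powers suffice. A single input makes \<open>H\<close> square, so
  injectivity already gives the inverse. Controllability is given as steering between states, not as
  a rank condition. The observability of the columns is therefore extracted from trajectories, by
  the same uniqueness lemma for linear differential equations that later propagates symmetry
  backwards from T. Orders fit exactly: \<open>f\<close> contains derivatives of G of order at most
  n - 2, its time derivative reaches n - 1, and this is what a P0 of class C^n provides. The unknown
  of the linear system is the pair of half-vectorizations of Q and of Y(T); the value at T, not at
  0, is chosen because the semidefiniteness condition is imposed there.\<close>

text \<open>With premises on dimensions instead of carriers no inner dimension is left schematic, so
  simp can discharge the premises when the rule rewrites.\<close>

lemma mult_assoc_mat_dim:
  "dim_col A = dim_row B \<Longrightarrow> dim_col B = dim_row C \<Longrightarrow> (A * B) * C = A * (B * C)"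
  by (rule assoc_mult_mat[of _ "dim_row A" "dim_col A" _ "dim_col B" _ "dim_col C"]) auto

lemma transpose_mult_dim:
  fixes A :: "'a::comm_semiring_0 mat"
  shows "dim_col A = dim_row B \<Longrightarrow> transpose_mat (A * B) = transpose_mat B * transpose_mat A"
  by (rule transpose_mult[of _ "dim_row A" "dim_col A" _ "dim_col B"]) auto

lemma minus_vec_eq_0_iff:
  fixes u v :: "'a::group_add vec"
  assumes "u \<in> carrier_vec n" "v \<in> carrier_vec n"
  shows "u - v = 0\<^sub>v n \<longleftrightarrow> u = v"
proof
  assume eq: "u - v = 0\<^sub>v n"
  show "u = v"
  proof (rule eq_vecI)
    fix i assume "i < dim_vec v"
    then have "i < n" "(u - v) $ i = 0" using assms eq by auto
    then show "u $ i = v $ i" using assms by simp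
  qed (use assms in auto)
next
  show "u = v \<Longrightarrow> u - v = 0\<^sub>v n" using assms by simp
qed

lemma mult_mat_vec_uminus:
  fixes M :: "'a::ring mat"
  assumes "dim_vec v = dim_col M"
  shows "M *\<^sub>v (- v) = - (M *\<^sub>v v)"
  by (rule eq_vecI) (use assms in auto)

lemma sum3_eq_0_iff:
  fixes a b c :: "real vec"
  assumes "a \<in> carrier_vec n" "b \<in> carrier_vec n" "c \<in> carrier_vec n"
  shows "a + b + c = 0\<^sub>v n \<longleftrightarrow> a = - (b + c)"
proof
  assume z: "a + b + c = 0\<^sub>v n"
  show "a = - (b + c)"
  proof (rule eq_vecI)
    fix i assume "i < dim_vec (- (b + c))"
    then have i: "i < n" using assms by simp
    then have "(a + b + c) $ i = 0" by (simp only: z index_zero_vec)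
    then show "a $ i = (- (b + c)) $ i"
      using i assms by simp
  qed (use assms in auto)
next
  assume a: "a = - (b + c)"
  show "a + b + c = 0\<^sub>v n" unfolding a by (rule eq_vecI) (use assms in auto)
qed

lemma sum2_eq_0_iff:
  fixes a b :: "real vec"
  assumes "a \<in> carrier_vec n" "b \<in> carrier_vec n"
  shows "a + b = 0\<^sub>v n \<longleftrightarrow> - b = a"
  using minus_vec_eq_0_iff[of a n "- b"] assms by (auto simp: minus_add_uminus_vec[of _ n])

text \<open>With a zero row appended, the matrix whose columns are the n + 1 vectors
  \<open>f k\<close> is square; the last unit vector lies in the kernel of its transpose, so the
  determinant vanishes, and a kernel vector is the dependency. It is applied to Krylov
  sequences.\<close>

lemma ex_linear_dependency:
  fixes f :: "nat \<Rightarrow> nat \<Rightarrow> real"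
  shows "\<exists>c. (\<exists>k\<le>n. c k \<noteq> 0) \<and> (\<forall>i<n. (\<Sum>k\<le>n. c k * f k i) = 0)"
proof -
  define M where "M = mat (Suc n) (Suc n) (\<lambda>(i, k). if i < n then f k i else 0)"
  have M: "M \<in> carrier_mat (Suc n) (Suc n)" by (simp add: M_def)
  have "transpose_mat M *\<^sub>v unit_vec (Suc n) n = 0\<^sub>v (Suc n)"
    by (rule eq_vecI) (auto simp: M_def scalar_prod_def unit_vec_def intro!: sum.neutral)
  moreover have "unit_vec (Suc n) n \<noteq> (0\<^sub>v (Suc n) :: real vec)"
    by (metis index_unit_vec(1) index_zero_vec(1) lessI zero_neq_one)
  ultimately have "det (transpose_mat M) = 0"
    using det_0_iff_vec_prod_zero_field[of "transpose_mat M" "Suc n"] M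
    by (metis transpose_carrier_mat unit_vec_carrier)
  then have "det M = 0" by (simp add: det_transpose[OF M])
  then obtain v where v: "v \<in> carrier_vec (Suc n)" "v \<noteq> 0\<^sub>v (Suc n)" "M *\<^sub>v v = 0\<^sub>v (Suc n)"
    using det_0_iff_vec_prod_zero_field[OF M] by blast
  have "\<exists>k\<le>n. v $ k \<noteq> 0"
  proof (rule ccontr)
    assume "\<not> ?thesis"
    then have "v = 0\<^sub>v (Suc n)" using v(1) by (intro eq_vecI) auto
    with v(2) show False ..
  qed
  moreover have "(\<Sum>k\<le>n. v $ k * f k i) = 0" if "i < n" for i
  proof -
    have "(M *\<^sub>v v) $ i = 0" using v(3) that by simp
    moreover have "(M *\<^sub>v v) $ i = (\<Sum>k\<le>n. v $ k * f k i)"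
      using v(1) that
      by (auto simp: M_def scalar_prod_def atLeast0LessThan lessThan_Suc_atMost mult.commute
          intro!: sum.cong)
    ultimately show ?thesis by simp
  qed
  ultimately show ?thesis by (intro exI[of _ "\<lambda>k. v $ k"]) auto
qed

lemma pow_mat_vec_Suc:
  fixes M :: "'a::comm_semiring_1 mat"
  assumes "M \<in> carrier_mat n n" "x \<in> carrier_vec n"
  shows "M ^\<^sub>m Suc k *\<^sub>v x = M *\<^sub>v (M ^\<^sub>m k *\<^sub>v x)"
    and "M ^\<^sub>m Suc k *\<^sub>v x = M ^\<^sub>m k *\<^sub>v (M *\<^sub>v x)"
proof -
  have eq: "M ^\<^sub>m k * M = M * M ^\<^sub>m k"
    using assms(1)
    by (induction k) (auto simp: assoc_mult_mat[of _ n n _ n _ n])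
  show "M ^\<^sub>m Suc k *\<^sub>v x = M ^\<^sub>m k *\<^sub>v (M *\<^sub>v x)"
    using assms by (simp add: assoc_mult_mat_vec[of _ n n _ n])
  show "M ^\<^sub>m Suc k *\<^sub>v x = M *\<^sub>v (M ^\<^sub>m k *\<^sub>v x)"
    using assms by (simp add: eq assoc_mult_mat_vec[of _ n n _ n])
qed

lemma mult_mat_unit_vec:
  fixes M :: "'a::comm_semiring_1 mat"
  assumes "M \<in> carrier_mat m n" "j < n"
  shows "M *\<^sub>v unit_vec n j = col M j"
  by (rule eq_vecI) (use assms in auto)

lemma mult_mat_vec_sum:
  fixes M :: "'a::comm_semiring_0 mat"
  assumes "M \<in> carrier_mat nr n" "\<And>k. k \<in> I \<Longrightarrow> v k \<in> carrier_vec n"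
  shows "M *\<^sub>v vec n (\<lambda>i. \<Sum>k\<in>I. c k * v k $ i) = vec nr (\<lambda>i. \<Sum>k\<in>I. c k * (M *\<^sub>v v k) $ i)"
proof (rule eq_vecI)
  fix i assume "i < dim_vec (vec nr (\<lambda>i. \<Sum>k\<in>I. c k * (M *\<^sub>v v k) $ i))"
  then have i: "i < nr" by simp
  have "(M *\<^sub>v vec n (\<lambda>i. \<Sum>k\<in>I. c k * v k $ i)) $ i
      = (\<Sum>j = 0..<n. \<Sum>k\<in>I. M $$ (i, j) * (c k * v k $ j))"
    using assms i by (auto simp: scalar_prod_def sum_distrib_left intro!: sum.cong)
  also have "\<dots> = (\<Sum>k\<in>I. \<Sum>j = 0..<n. M $$ (i, j) * (c k * v k $ j))"
    by (rule sum.swap)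
  also have "\<dots> = (\<Sum>k\<in>I. c k * (M *\<^sub>v v k) $ i)"
  proof (rule sum.cong[OF refl])
    fix k assume "k \<in> I"
    then have "dim_vec (v k) = n" using assms(2) by auto
    then show "(\<Sum>j = 0..<n. M $$ (i, j) * (c k * v k $ j)) = c k * (M *\<^sub>v v k) $ i"
      using assms(1) i
      by (auto simp: scalar_prod_def sum_distrib_left mult.left_commute intro!: sum.cong)
  qed
  finally show "(M *\<^sub>v vec n (\<lambda>i. \<Sum>k\<in>I. c k * v k $ i)) $ i
      = vec nr (\<lambda>i. \<Sum>k\<in>I. c k * (M *\<^sub>v v k) $ i) $ i"
    using i by simp
qed (use assms in auto)

section \<open>Kernels and ranges of powers of a symmetric matrix\<close>

lemma scalar_prod_self_eq_0:
  fixes v :: "real vec"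
  assumes "v \<in> carrier_vec n" "v \<bullet> v = 0"
  shows "v = 0\<^sub>v n"
proof (rule eq_vecI)
  fix i assume "i < dim_vec (0\<^sub>v n :: real vec)"
  moreover have "(\<Sum>i = 0..<n. v $ i * v $ i) = 0"
    using assms by (simp add: scalar_prod_def)
  ultimately show "v $ i = 0\<^sub>v n $ i"
    by (subst (asm) sum_nonneg_eq_0_iff) auto
qed (use assms in auto)

text \<open>By symmetry the squared norm of S u equals the product of u with S (S u).\<close>

lemma sym_mat_kernel_square:
  assumes S: "sym_mat n S" and u: "u \<in> carrier_vec n" and "S *\<^sub>v (S *\<^sub>v u) = 0\<^sub>v n"
  shows "S *\<^sub>v u = 0\<^sub>v n"
proof -
  have c: "S \<in> carrier_mat n n" and t: "transpose_mat S = S"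
    using S by (auto simp: sym_mat_def)
  have "(S *\<^sub>v u) \<bullet> (S *\<^sub>v u) = u \<bullet> (S *\<^sub>v (S *\<^sub>v u))"
    using transpose_vec_mult_scalar[OF c u, of "S *\<^sub>v u"] c u
    by (simp add: t comm_scalar_prod[of _ n])
  also have "\<dots> = 0" using assms(3) u by simp
  finally show ?thesis using scalar_prod_self_eq_0[of "S *\<^sub>v u" n] mult_mat_vec_carrier[OF c u] by blast
qed

lemma sym_mat_kernel_pow:
  assumes S: "sym_mat n S" and u: "u \<in> carrier_vec n" and "S ^\<^sub>m k *\<^sub>v u = 0\<^sub>v n"
  shows "S *\<^sub>v u = 0\<^sub>v n"
proof -
  have c: "S \<in> carrier_mat n n" using S by (auto simp: sym_mat_def)
  have "S *\<^sub>v u = 0\<^sub>v n" if "S ^\<^sub>m Suc k *\<^sub>v u = 0\<^sub>v n" for k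
    using that
  proof (induction k)
    case 0
    then show ?case using c u by simp
  next
    case (Suc k)
    let ?w = "S ^\<^sub>m k *\<^sub>v u"
    have w: "?w \<in> carrier_vec n" by (rule mult_mat_vec_carrier[OF pow_carrier_mat[OF c] u])
    have "S *\<^sub>v (S *\<^sub>v ?w) = 0\<^sub>v n"
      using Suc.prems c u by (simp only: pow_mat_vec_Suc(1)[OF c u])
    then have "S *\<^sub>v ?w = 0\<^sub>v n" by (rule sym_mat_kernel_square[OF S w])
    then show ?case using Suc.IH c u by (simp only: pow_mat_vec_Suc(1)[OF c u])
  qed
  \<comment> \<open>One further factor \<open>S\<close> brings the exponent into the form
    \<open>Suc k\<close>, so exponent 0 needs no separate case.\<close>
  moreover have "S ^\<^sub>m Suc k *\<^sub>v u = 0\<^sub>v n"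
    using assms(3) c u by (simp only: pow_mat_vec_Suc(1)[OF c u]) auto
  ultimately show ?thesis by blast
qed

text \<open>The Krylov vectors \<open>x, S x, S\<^sup>2 x, \<dots>\<close> are dependent, so \<open>S\<^sup>m (x - S y) = 0\<close> for some \<open>m\<close> and \<open>y\<close>,
  and \<open>S\<^sup>m\<close> has the same kernel as \<open>S\<close> by symmetry.\<close>

lemma sym_mat_range_square:
  assumes S: "sym_mat n S" and x: "x \<in> carrier_vec n"
  shows "\<exists>y \<in> carrier_vec n. S *\<^sub>v x = S *\<^sub>v (S *\<^sub>v y)"
proof -
  have c: "S \<in> carrier_mat n n" using S by (auto simp: sym_mat_def)
  define w where "w k = S ^\<^sub>m k *\<^sub>v x" for k
  have w: "w k \<in> carrier_vec n" for k
    unfolding w_def by (rule mult_mat_vec_carrier[OF pow_carrier_mat[OF c] x])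
  have Sw: "S *\<^sub>v w k = w (Suc k)" for k
    unfolding w_def by (simp only: pow_mat_vec_Suc(1)[OF c x])
  have Spw: "S ^\<^sub>m m *\<^sub>v w k = w (m + k)" for m k
  proof (induction m arbitrary: k)
    case 0
    then show ?case using c w[of k] by simp
  next
    case (Suc m)
    have "S ^\<^sub>m Suc m *\<^sub>v w k = S ^\<^sub>m m *\<^sub>v w (Suc k)"
      by (simp only: pow_mat_vec_Suc(2)[OF c w] Sw)
    then show ?case using Suc.IH[of "Suc k"] by simp
  qed
  obtain a where a: "\<exists>k\<le>n. a k \<noteq> 0" "\<And>i. i < n \<Longrightarrow> (\<Sum>k\<le>n. a k * w k $ i) = 0"
    using ex_linear_dependency[of n "\<lambda>k i. w k $ i"] by auto
  \<comment> \<open>The lowest vector that occurs in the dependency. Solving for \<open>w m\<close>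
    leaves only \<open>w k\<close> with k > m, each of which is \<open>S ^ Suc m\<close> applied to
    \<open>w (k - Suc m)\<close>; collecting these preimages gives \<open>y\<close>.\<close>
  define m where "m = (LEAST k. k \<le> n \<and> a k \<noteq> 0)"
  have m: "m \<le> n" "a m \<noteq> 0" using LeastI_ex[OF a(1)] by (auto simp: m_def)
  have least: "a k = 0" if "k < m" for k
    using not_less_Least[OF that[unfolded m_def]] that m(1) by auto
  define y where "y = vec n (\<lambda>i. \<Sum>k\<in>{m<..n}. (- a k / a m) * w (k - Suc m) $ i)"
  have y: "y \<in> carrier_vec n" by (simp add: y_def)
  have "S ^\<^sub>m Suc m *\<^sub>v y = vec n (\<lambda>i. \<Sum>k\<in>{m<..n}. (- a k / a m) * (S ^\<^sub>m Suc m *\<^sub>v w (k - Suc m)) $ i)"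
    unfolding y_def by (rule mult_mat_vec_sum) (use c w in auto)
  also have "\<dots> = vec n (\<lambda>i. \<Sum>k\<in>{m<..n}. (- a k / a m) * w k $ i)"
    by (intro arg_cong[of _ _ "vec n"] ext sum.cong refl) (simp only: Spw, simp)
  also have "\<dots> = w m"
  proof (rule eq_vecI)
    fix i assume "i < dim_vec (w m)"
    then have i: "i < n" using w[of m] by simp
    have "{..n} = {..<m} \<union> {m} \<union> {m<..n}" using m(1) by auto
    then have "(\<Sum>k\<le>n. a k * w k $ i)
        = (\<Sum>k<m. a k * w k $ i) + a m * w m $ i + (\<Sum>k\<in>{m<..n}. a k * w k $ i)"
      by (simp add: sum.union_disjoint Int_Un_distrib2 disjoint_iff) 
    then have "a m * w m $ i = - (\<Sum>k\<in>{m<..n}. a k * w k $ i)"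
      using a(2)[OF i] least by simp
    then have "w m $ i = - (\<Sum>k\<in>{m<..n}. a k * w k $ i) / a m"
      using m(2) by (simp add: field_simps)
    then show "vec n (\<lambda>i. \<Sum>k\<in>{m<..n}. (- a k / a m) * w k $ i) $ i = w m $ i"
      using i by (simp add: sum_divide_distrib sum_negf)
  qed (use w[of m] in simp)
  finally have "S ^\<^sub>m m *\<^sub>v (S *\<^sub>v y) = S ^\<^sub>m m *\<^sub>v x"
    by (simp only: pow_mat_vec_Suc(2)[OF c y] w_def)
  then have "S ^\<^sub>m m *\<^sub>v (x - S *\<^sub>v y) = 0\<^sub>v n"
    using c x y mult_mat_vec_carrier[OF pow_carrier_mat[OF c] x, of m]
    by (simp add: mult_minus_distrib_mat_vec[of _ n n] minus_vec_eq_0_iff)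
  then have "S *\<^sub>v (x - S *\<^sub>v y) = 0\<^sub>v n"
    using sym_mat_kernel_pow[OF S, of "x - S *\<^sub>v y" m] c x y by simp
  moreover have "S *\<^sub>v (x - S *\<^sub>v y) = S *\<^sub>v x - S *\<^sub>v (S *\<^sub>v y)"
    using c x y by (simp add: mult_minus_distrib_mat_vec[of _ n n])
  ultimately have "S *\<^sub>v x - S *\<^sub>v (S *\<^sub>v y) = 0\<^sub>v n" by simp
  then have "S *\<^sub>v x = S *\<^sub>v (S *\<^sub>v y)"
    by (subst (asm) minus_vec_eq_0_iff) (use c x y in simp_all)
  with y show ?thesis by blast
qed

text \<open>\<open>M * X\<close> and \<open>M * Y\<close> are both the orthogonal projection onto
  the range of \<open>M\<close>, hence equal; likewise \<open>X * M\<close> and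
  \<open>Y * M\<close>. Then X = X M X can be rewritten factor by factor into Y M Y = Y.\<close>

lemma is_pinv_unique:
  assumes X: "is_pinv M X" and Y: "is_pinv M Y"
  shows "X = Y"
proof -
  define p q where "p = dim_row M" and "q = dim_col M"
  have M: "M \<in> carrier_mat p q" by (auto simp: p_def q_def)
  have Xc: "X \<in> carrier_mat q p" and X1: "M * X * M = M" and X2: "X * M * X = X"
    and X3: "transpose_mat (M * X) = M * X" and X4: "transpose_mat (X * M) = X * M"
    using X by (auto simp: is_pinv_def p_def q_def)
  have Yc: "Y \<in> carrier_mat q p" and Y1: "M * Y * M = M" and Y2: "Y * M * Y = Y"
    and Y3: "transpose_mat (M * Y) = M * Y" and Y4: "transpose_mat (Y * M) = Y * M"
    using Y by (auto simp: is_pinv_def p_def q_def)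
  have MX: "M * X = M * Y"
  proof -
    have "M * X = (M * Y * M) * X" using Y1 by simp
    also have "\<dots> = (M * Y) * (M * X)" using M Xc Yc by (simp add: mult_assoc_mat_dim)
    also have "\<dots> = transpose_mat (M * Y) * transpose_mat (M * X)" by (simp only: X3 Y3)
    also have "\<dots> = transpose_mat ((M * X) * (M * Y))" using M Xc Yc by (subst transpose_mult[of _ p p _ p]) auto
    also have "(M * X) * (M * Y) = (M * X * M) * Y" using M Xc Yc by (simp add: mult_assoc_mat_dim)
    finally show ?thesis by (simp only: X1 Y3)
  qed
  have XM: "X * M = Y * M"
  proof -
    have "X * M = X * (M * Y * M)" using Y1 by simp
    also have "\<dots> = (X * M) * (Y * M)" using M Xc Yc by (simp add: mult_assoc_mat_dim)
    also have "\<dots> = transpose_mat (X * M) * transpose_mat (Y * M)" by (simp only: X4 Y4)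
    also have "\<dots> = transpose_mat ((Y * M) * (X * M))" using M Xc Yc by (subst transpose_mult[of _ q q _ q]) auto
    also have "(Y * M) * (X * M) = Y * (M * X * M)" using M Xc Yc by (simp add: mult_assoc_mat_dim)
    finally show ?thesis by (simp only: X1 Y4)
  qed
  have "X = X * M * X" using X2 by simp
  also have "\<dots> = Y * M * X" by (simp only: XM)
  also have "\<dots> = Y * (M * X)" using M Xc Yc by (simp add: assoc_mult_mat[of _ q p _ q _ p])
  also have "\<dots> = Y * (M * Y)" by (simp only: MX)
  also have "\<dots> = Y * M * Y" using M Xc Yc by (simp add: assoc_mult_mat[of _ q p _ q _ p])
  finally show ?thesis by (simp only: Y2)
qed

text \<open>For \<open>S = M\<^sup>T M\<close> choose \<open>X\<close> with \<open>S = S\<^sup>2 X\<close>. Then \<open>P = S X\<close> is the orthogonal projection onto the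
  range of \<open>S\<close>, \<open>W = P X\<close> is the Moore-Penrose inverse of \<open>S\<close>, and \<open>W M\<^sup>T\<close> that of \<open>M\<close>.\<close>

lemma ex_is_pinv: "\<exists>Z. is_pinv M Z"
proof -
  define p q where "p = dim_row M" and "q = dim_col M"
  have M: "M \<in> carrier_mat p q" by (auto simp: p_def q_def)
  define Mt where "Mt = transpose_mat M"
  have Mt: "Mt \<in> carrier_mat q p" using M by (simp add: Mt_def)
  define S where "S = Mt * M"
  have S: "S \<in> carrier_mat q q" using M by (simp add: S_def Mt_def)
  have St: "transpose_mat S = S"
    unfolding S_def Mt_def using M by (subst transpose_mult[of _ q p _ q]) auto
  \<comment> \<open>The vector statement is used on each unit vector; the solutions become the
    columns of \<open>X\<close>.\<close>
  have "\<exists>y \<in> carrier_vec q. S *\<^sub>v unit_vec q j = S *\<^sub>v (S *\<^sub>v y)" for j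
    by (rule sym_mat_range_square) (simp_all add: sym_mat_def S St)
  then have "\<forall>j. \<exists>y. y \<in> carrier_vec q \<and> S *\<^sub>v unit_vec q j = S *\<^sub>v (S *\<^sub>v y)"
    by blast
  from choice[OF this] obtain y where y: "\<And>j. y j \<in> carrier_vec q"
      "\<And>j. S *\<^sub>v unit_vec q j = S *\<^sub>v (S *\<^sub>v y j)"
    by blast
  define X where "X = mat_of_cols q (map y [0..<q])"
  have X: "X \<in> carrier_mat q q" 
    using mat_of_cols_carrier(1)[of q "map y [0..<q]"] by (simp add: X_def)
  have colX: "col X j = y j" if "j < q" for j
    using that y(1) by (simp add: X_def)
  define Xt where "Xt = transpose_mat X"
  have Xt: "Xt \<in> carrier_mat q q" using X by (simp add: Xt_def)
  note assoc = assoc_mult_mat[of _ q q _ q _ q]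
  have SSX: "S * (S * X) = S"
  proof (rule mat_col_eqI)
    fix j assume "j < dim_col S"
    then have j: "j < q" using S by simp
    have "col (S * (S * X)) j = S *\<^sub>v (S *\<^sub>v col X j)"
      by (simp only: col_mult2[OF S _ j] col_mult2[OF S X j] mult_carrier_mat[OF S X])
    also have "\<dots> = S *\<^sub>v unit_vec q j" using y(2) colX[OF j] by simp
    also have "\<dots> = col S j" using mult_mat_unit_vec[OF S j] by simp
    finally show "col (S * (S * X)) j = col S j" .
  qed (use S X in auto)
  have XSS: "Xt * S * S = S"
  proof -
    have "transpose_mat (S * (S * X)) = (Xt * S) * S"
      using S X St by (simp add: transpose_mult[of _ q q _ q] Xt_def)
    then show ?thesis using SSX St by simp
  qed
  \<comment> \<open>Both sides equal Xt S S X, by the equation for \<open>S\<close> and by its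
    transpose. This is the symmetry of \<open>P\<close>.\<close>
  have XtS: "Xt * S = S * X"
  proof -
    have "Xt * S = Xt * (S * (S * X))" by (simp only: SSX)
    also have "\<dots> = Xt * S * S * X" using S X Xt by (simp add: assoc)
    finally show ?thesis by (simp only: XSS)
  qed
  define P where "P = S * X"
  have P: "P \<in> carrier_mat q q" using S X by (simp add: P_def)
  have Pt: "transpose_mat P = P"
    using S X St XtS by (simp add: P_def transpose_mult[of _ q q _ q] Xt_def)
  have SP: "S * P = S" using SSX by (simp add: P_def)
  have PS: "P * S = S" using XSS by (simp add: P_def XtS[symmetric])
  have PP: "P * P = P"
  proof -
    have "P * P = (P * S) * X" unfolding P_def using S X by (simp add: assoc)
    then show ?thesis by (simp only: PS) (simp only: P_def)
  qed
  define W where "W = P * X"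
  have W: "W \<in> carrier_mat q q" using P X by (simp add: W_def)
  have W': "W = Xt * S * X" by (simp add: W_def P_def XtS)
  have Wt: "transpose_mat W = W"
    unfolding W' using S X Xt St
    by (simp add: transpose_mult[of _ q q _ q] Xt_def assoc)
  have SW: "S * W = P"
  proof -
    have "S * W = (S * P) * X" unfolding W_def using S P X by (simp add: assoc)
    then show ?thesis by (simp only: SP) (simp only: P_def)
  qed
  have WS: "W * S = P"
    using arg_cong[OF SW, of transpose_mat] S W
    by (simp add: transpose_mult[of _ q q _ q] St Wt Pt)
  have PW: "P * W = W"
  proof -
    have "P * W = (P * P) * X" unfolding W_def using P X by (simp add: assoc)
    then show ?thesis by (simp only: PP) (simp only: W_def)
  qed
  \<comment> \<open>From S P = S every u = P e - e, with e a unit vector, satisfies S u = 0; since S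
    = M^T M, the squared norm of M u is then zero.\<close>
  have MP: "M * P = M"
  proof (rule mat_col_eqI)
    fix j assume "j < dim_col M"
    then have j: "j < q" using M by simp
    define u where "u = P *\<^sub>v unit_vec q j - unit_vec q j"
    have u: "u \<in> carrier_vec q" using P by (simp add: u_def)
    have "S *\<^sub>v u = S *\<^sub>v (P *\<^sub>v unit_vec q j) - S *\<^sub>v unit_vec q j"
      unfolding u_def using S P by (simp add: mult_minus_distrib_mat_vec[of _ q q])
    also have "S *\<^sub>v (P *\<^sub>v unit_vec q j) = S *\<^sub>v unit_vec q j"
      using S P by (simp add: assoc_mult_mat_vec[of _ q q _ q, symmetric] SP)
    finally have Su: "S *\<^sub>v u = 0\<^sub>v q" using S by simp
    have "(M *\<^sub>v u) \<bullet> (M *\<^sub>v u) = u \<bullet> (Mt *\<^sub>v (M *\<^sub>v u))"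
      using transpose_vec_mult_scalar[OF M u, of "M *\<^sub>v u"] M u
      by (simp add: Mt_def comm_scalar_prod[of _ q])
    also have "Mt *\<^sub>v (M *\<^sub>v u) = 0\<^sub>v q"
      using Su M Mt u by (simp add: S_def assoc_mult_mat_vec[of _ q p _ q])
    finally have "M *\<^sub>v u = 0\<^sub>v p"
      using scalar_prod_self_eq_0[of "M *\<^sub>v u" p] M u by simp
    have "col (M * P) j - col M j = M *\<^sub>v (P *\<^sub>v unit_vec q j) - M *\<^sub>v unit_vec q j"
      by (simp only: col_mult2[OF M P j] mult_mat_unit_vec[OF P j] mult_mat_unit_vec[OF M j])
    also have "\<dots> = M *\<^sub>v u"
      unfolding u_def by (rule mult_minus_distrib_mat_vec[OF M _ unit_vec_carrier, symmetric])
        (rule mult_mat_vec_carrier[OF P unit_vec_carrier])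
    also have "\<dots> = 0\<^sub>v p" by fact
    finally have eq: "col (M * P) j - col M j = 0\<^sub>v p" .
    have "col (M * P) j \<in> carrier_vec p" "col M j \<in> carrier_vec p"
      using col_dim[of "M * P" j] col_dim[of M j] unfolding index_mult_mat carrier_matD(1)[OF M] .
    from iffD1[OF minus_vec_eq_0_iff[OF this] eq] show "col (M * P) j = col M j" .
  next
    show "dim_row (M * P) = dim_row M" by simp
    show "dim_col (M * P) = dim_col M" using M P by simp
  qed
  define Z where "Z = W * Mt"
  have Z: "Z \<in> carrier_mat q p" using W Mt by (simp add: Z_def)
  have ZM: "Z * M = P"
    using W Mt M WS by (simp add: Z_def S_def assoc_mult_mat[of _ q q _ p _ q])
  have dims: "dim_row M = p" "dim_col M = q" "dim_row Mt = q" "dim_col Mt = p"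
    "dim_row W = q" "dim_col W = q" "dim_row P = q" "dim_col P = q" "dim_row Z = q" "dim_col Z = p"
    using M Mt W P Z by auto
  have "M * Z * M = M"
    by (subst mult_assoc_mat_dim) (simp_all only: dims ZM MP)
  moreover have "Z * M * Z = Z"
  proof -
    have "P * (W * Mt) = P * W * Mt"
      by (rule mult_assoc_mat_dim[symmetric]) (simp_all only: dims)
    then show ?thesis by (simp only: ZM) (simp only: Z_def PW)
  qed
  moreover have "transpose_mat (M * Z) = M * Z"
  proof -
    have "transpose_mat (M * Z) = transpose_mat (W * Mt) * Mt"
      by (simp add: transpose_mult_dim dims Z_def Mt_def[symmetric])
    also have "\<dots> = transpose_mat Mt * W * Mt"
      by (simp add: transpose_mult_dim dims Wt)
    also have "transpose_mat Mt = M" by (simp add: Mt_def)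
    also have "M * W * Mt = M * (W * Mt)"
      by (rule mult_assoc_mat_dim) (simp_all only: dims)
    finally show ?thesis by (simp only: Z_def)
  qed
  moreover have "transpose_mat (Z * M) = Z * M" by (simp only: ZM Pt)
  moreover have "Z \<in> carrier_mat (dim_col M) (dim_row M)"
    using Z by (simp only: dims)
  ultimately have "is_pinv M Z" unfolding is_pinv_def by (intro conjI)
  then show ?thesis ..
qed

lemma is_pinv_pinv: "is_pinv M (pinv M)"
proof -
  have "\<exists>!Z. is_pinv M Z" using ex_is_pinv[of M] is_pinv_unique by blast
  then show ?thesis unfolding pinv_def by (rule theI')
qed

lemma pinv_carrier:
  "M \<in> carrier_mat p q \<Longrightarrow> pinv M \<in> carrier_mat q p"
  using is_pinv_pinv[of M] by (auto simp: is_pinv_def)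

text \<open>Transposing the four Penrose conditions of a symmetric matrix gives them back for the
  transposed inverse, with the roles of \<open>M * pinv M\<close> and \<open>pinv M * M\<close>
  exchanged; uniqueness concludes. This makes \<open>P0\<close> symmetric.\<close>

lemma pinv_sym:
  assumes "sym_mat n M"
  shows "sym_mat n (pinv M)"
proof -
  have M: "M \<in> carrier_mat n n" and t: "transpose_mat M = M" using assms by (auto simp: sym_mat_def)
  have Z: "pinv M \<in> carrier_mat n n" using pinv_carrier[OF M] .
  have p: "M * pinv M * M = M" "pinv M * M * pinv M = pinv M"
    "transpose_mat (M * pinv M) = M * pinv M" "transpose_mat (pinv M * M) = pinv M * M"
    using is_pinv_pinv[of M] unfolding is_pinv_def by blast+
  have dims: "dim_row M = n" "dim_col M = n" "dim_row (pinv M) = n" "dim_col (pinv M) = n"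
    using M Z by auto
  have a: "M * transpose_mat (pinv M) = pinv M * M"
    using transpose_mult_dim[of "pinv M" M] by (simp only: dims p(4) t)
  have b: "transpose_mat (pinv M) * M = M * pinv M"
    using transpose_mult_dim[of M "pinv M"] by (simp only: dims p(3) t)
  have "M * transpose_mat (pinv M) * M = transpose_mat (M * pinv M * M)"
    by (simp only: transpose_mult_dim mult_assoc_mat_dim dims t index_mult_mat index_transpose_mat)
  then have MZM: "M * transpose_mat (pinv M) * M = M" by (simp only: p(1) t)
  have eq: "transpose_mat (pinv M) * M * transpose_mat (pinv M)
      = transpose_mat (pinv M * M * pinv M)"
    by (simp only: transpose_mult_dim mult_assoc_mat_dim dims t index_mult_mat index_transpose_mat)
  note MZM
  moreover have "transpose_mat (pinv M) * M * transpose_mat (pinv M) = transpose_mat (pinv M)"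
    by (simp only: eq p(2))
  moreover have "transpose_mat (M * transpose_mat (pinv M)) = M * transpose_mat (pinv M)"
    by (simp only: a p(4))
  moreover have "transpose_mat (transpose_mat (pinv M) * M) = transpose_mat (pinv M) * M"
    by (simp only: b p(3))
  moreover have "transpose_mat (pinv M) \<in> carrier_mat (dim_col M) (dim_row M)"
    using M Z by simp
  ultimately have "is_pinv M (transpose_mat (pinv M))"
    unfolding is_pinv_def by (intro conjI)
  then have "transpose_mat (pinv M) = pinv M"
    by (rule is_pinv_unique[OF _ is_pinv_pinv])
  then show ?thesis using Z by (simp add: sym_mat_def)
qed

text \<open>By the first Penrose condition \<open>M * pinv M\<close> is the identity on the range of
  \<open>M\<close>. Applied to \<open>As\<close>, the mere existence of a solution yields condition
  (ii).\<close>

lemma pinv_solves: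
  assumes M: "M \<in> carrier_mat p q" and z: "z \<in> carrier_vec q" and "M *\<^sub>v z = b"
  shows "(M * pinv M) *\<^sub>v b = b"
proof -
  have Z: "pinv M \<in> carrier_mat q p" by (rule pinv_carrier[OF M])
  have "(M * pinv M) *\<^sub>v (M *\<^sub>v z) = (M * pinv M * M) *\<^sub>v z"
    by (rule assoc_mult_mat_vec[OF mult_carrier_mat[OF M Z] M z, symmetric])
  also have "M * pinv M * M = M" using is_pinv_pinv[of M] by (simp only: is_pinv_def)
  finally show ?thesis by (simp only: assms(3))
qed

section \<open>Vectorization and the Lyapunov operator\<close>

lemma sum_div_mod:
  fixes f :: "nat \<Rightarrow> nat \<Rightarrow> 'a::comm_monoid_add"
  shows "(\<Sum>l = 0..<m * n. f (l div n) (l mod n)) = (\<Sum>a = 0..<m. \<Sum>b = 0..<n. f a b)"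
proof (cases "n = 0")
  case False
  show ?thesis
  proof (induction m)
    case (Suc m)
    have "(\<Sum>l = 0..<Suc m * n. f (l div n) (l mod n))
        = (\<Sum>l = 0..<m * n. f (l div n) (l mod n)) + (\<Sum>l = m * n..<Suc m * n. f (l div n) (l mod n))"
      by (rule sum.atLeastLessThan_concat[symmetric]) auto
    also have "(\<Sum>l = m * n..<Suc m * n. f (l div n) (l mod n)) = (\<Sum>b = 0..<n. f m b)"
      using sum.shift_bounds_nat_ivl[of "\<lambda>l. f (l div n) (l mod n)" 0 "m * n" n] False
      by (simp add: add.commute)
    finally show ?case using Suc.IH by simp
  qed simp
qed simp

lemma div_mod_less:
  fixes k p q :: nat
  assumes "k < p * q"
  shows "k mod p < p" "k div p < q"
proof -
  have "0 < p" using assms by (cases p) auto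
  then show "k mod p < p" by simp
  show "k div p < q" using assms by (simp add: less_mult_imp_div_less mult.commute)
qed

lemma pair_index_less:
  fixes i j p q :: nat
  assumes "i < p" "j < q"
  shows "j * p + i < p * q" "(j * p + i) mod p = i" "(j * p + i) div p = j"
proof -
  have "j * p + i < Suc j * p" using assms by simp
  also have "\<dots> \<le> q * p" using assms by (intro mult_le_mono1) simp
  finally show "j * p + i < p * q" by (simp add: mult.commute)
qed (use assms in auto)

lemma vec_stack_carrier: "X \<in> carrier_mat p q \<Longrightarrow> vec_stack X \<in> carrier_vec (p * q)"
  by (auto simp: vec_stack_def)

lemma vec_stack_index:
  "X \<in> carrier_mat p q \<Longrightarrow> k < p * q \<Longrightarrow> vec_stack X $ k = X $$ (k mod p, k div p)"
  by (auto simp: vec_stack_def)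

lemma vec_stack_index_pair:
  "X \<in> carrier_mat p q \<Longrightarrow> i < p \<Longrightarrow> j < q \<Longrightarrow> vec_stack X $ (j * p + i) = X $$ (i, j)"
  using pair_index_less[of i p j q] by (simp add: vec_stack_index)

lemma vec_stack_inject:
  assumes "X \<in> carrier_mat p q" "Y \<in> carrier_mat p q"
  shows "vec_stack X = vec_stack Y \<longleftrightarrow> X = Y"
proof
  assume eq: "vec_stack X = vec_stack Y"
  show "X = Y"
  proof (rule eq_matI)
    fix i j assume "i < dim_row Y" "j < dim_col Y"
    then have "i < p" "j < q" using assms by auto
    then show "X $$ (i, j) = Y $$ (i, j)"
      using vec_stack_index_pair[OF assms(1)] vec_stack_index_pair[OF assms(2)] eq by metis
  qed (use assms in auto)
qed simp

lemma vec_stack_minus: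
  "X \<in> carrier_mat p q \<Longrightarrow> Y \<in> carrier_mat p q \<Longrightarrow> vec_stack (X - Y) = vec_stack X - vec_stack Y"
  by (intro eq_vecI) (auto simp: vec_stack_def div_mod_less)

lemma vec_stack_uminus: "vec_stack (- X) = - vec_stack X"
  by (intro eq_vecI) (auto simp: vec_stack_def div_mod_less)

lemma vec_stack_zero: "vec_stack (0\<^sub>m p q) = 0\<^sub>v (p * q)"
  by (intro eq_vecI) (auto simp: vec_stack_def div_mod_less)

lemma kron_carrier:
  "X \<in> carrier_mat p q \<Longrightarrow> Z \<in> carrier_mat p' q' \<Longrightarrow> kron X Z \<in> carrier_mat (p * p') (q * q')"
  by (auto simp: kron_def)

lemma transpose_kron: "transpose_mat (kron X Z) = kron (transpose_mat X) (transpose_mat Z)"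
proof (rule eq_matI)
  fix i j
  assume "i < dim_row (kron (transpose_mat X) (transpose_mat Z))"
    "j < dim_col (kron (transpose_mat X) (transpose_mat Z))"
  then have "i < dim_col Z * dim_col X" "j < dim_row Z * dim_row X"
    by (simp_all add: kron_def mult.commute)
  note div_mod_less[OF this(1)] div_mod_less[OF this(2)] this
  then show "transpose_mat (kron X Z) $$ (i, j) = kron (transpose_mat X) (transpose_mat Z) $$ (i, j)"
    by (simp add: kron_def mult.commute)
qed (simp_all add: kron_def)

text \<open>In a column-stacked index \<open>l\<close> the column is \<open>l div n\<close> and the
  row \<open>l mod n\<close>; \<open>sum_div_mod\<close> thus splits the scalar product into the two
  sums of a triple matrix product.\<close>

lemma kron_mult_vec_stack:
  assumes Z: "Z \<in> carrier_mat q m" and X: "X \<in> carrier_mat p n" and Y: "Y \<in> carrier_mat n m"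
  shows "kron Z X *\<^sub>v vec_stack Y = vec_stack (X * Y * transpose_mat Z)"
proof (rule eq_vecI)
  have W: "X * Y * transpose_mat Z \<in> carrier_mat p q" using assms by auto
  show "dim_vec (kron Z X *\<^sub>v vec_stack Y) = dim_vec (vec_stack (X * Y * transpose_mat Z))"
    using assms by (simp add: kron_def vec_stack_def mult.commute)
  fix k assume "k < dim_vec (vec_stack (X * Y * transpose_mat Z))"
  then have k: "k < p * q" using vec_stack_carrier[OF W] by auto
  note k' = div_mod_less[OF k]
  let ?i = "k mod p" and ?j = "k div p"
  have "(kron Z X *\<^sub>v vec_stack Y) $ k
      = (\<Sum>l = 0..<m * n. Z $$ (?j, l div n) * X $$ (?i, l mod n) * Y $$ (l mod n, l div n))"
    using assms k by (auto simp: kron_def vec_stack_def scalar_prod_def mult.commute intro!: sum.cong)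
  also have "\<dots> = (\<Sum>a = 0..<m. \<Sum>b = 0..<n. Z $$ (?j, a) * X $$ (?i, b) * Y $$ (b, a))"
    by (rule sum_div_mod)
  also have "\<dots> = (\<Sum>a = 0..<m. (\<Sum>b = 0..<n. X $$ (?i, b) * Y $$ (b, a)) * Z $$ (?j, a))"
    by (simp add: sum_distrib_left sum_distrib_right mult_ac)
  also have "\<dots> = (\<Sum>a = 0..<m. (X * Y) $$ (?i, a) * Z $$ (?j, a))"
    using assms k' by (auto simp: scalar_prod_def intro!: sum.cong)
  also have "\<dots> = row (X * Y) ?i \<bullet> col (transpose_mat Z) ?j"
    using assms k' by (auto simp: scalar_prod_def intro!: sum.cong)
  also have "\<dots> = (X * Y * transpose_mat Z) $$ (?i, ?j)"
    using assms k' by (intro index_mult_mat(1)[symmetric]) auto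
  also have "\<dots> = vec_stack (X * Y * transpose_mat Z) $ k"
    using vec_stack_index[OF W k] by simp
  finally show "(kron Z X *\<^sub>v vec_stack Y) $ k = vec_stack (X * Y * transpose_mat Z) $ k" .
qed

text \<open>The operator on matrices that \<open>Atil^T\<close> represents after stacking; also the
  homogeneous part of the differential equation for \<open>Y\<close>.\<close>

definition lyap :: "real mat \<Rightarrow> real mat \<Rightarrow> real mat" where
  "lyap A Y = - (transpose_mat A * Y) - Y * A"

lemma lyap_carrier: "A \<in> carrier_mat n n \<Longrightarrow> Y \<in> carrier_mat n n \<Longrightarrow> lyap A Y \<in> carrier_mat n n"
  by (auto simp: lyap_def)

lemma lyap_pow_carrier:
  "A \<in> carrier_mat n n \<Longrightarrow> Y \<in> carrier_mat n n \<Longrightarrow> (lyap A ^^ k) Y \<in> carrier_mat n n"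
  by (induction k) (auto intro: lyap_carrier)

lemma Atil_carrier: "A \<in> carrier_mat n n \<Longrightarrow> Atil A \<in> carrier_mat (n * n) (n * n)"
  by (auto simp: Atil_def kron_def)

lemma Atil_mult_vec_stack:
  assumes A: "A \<in> carrier_mat n n" and Y: "Y \<in> carrier_mat n n"
  shows "transpose_mat (Atil A) *\<^sub>v vec_stack Y = vec_stack (lyap A Y)"
proof -
  let ?I = "1\<^sub>m n :: real mat" let ?At = "transpose_mat A"
  have At: "?At \<in> carrier_mat n n" using A by simp
  have K: "kron ?I ?At \<in> carrier_mat (n * n) (n * n)" "kron ?At ?I \<in> carrier_mat (n * n) (n * n)"
    using At by (auto simp: kron_def)
  have K': "kron ?I A \<in> carrier_mat (n * n) (n * n)" "kron A ?I \<in> carrier_mat (n * n) (n * n)"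
    using A by (auto simp: kron_def)
  have v: "vec_stack Y \<in> carrier_vec (n * n)" by (rule vec_stack_carrier[OF Y])
  have "transpose_mat (Atil A) = - kron ?I ?At - kron ?At ?I"
    using A K' by (simp add: Atil_def transpose_minus[of _ "n * n" "n * n"] transpose_uminus transpose_kron)
  then have "transpose_mat (Atil A) *\<^sub>v vec_stack Y
      = - (kron ?I ?At *\<^sub>v vec_stack Y) - kron ?At ?I *\<^sub>v vec_stack Y"
    using K v by (simp add: minus_mult_distrib_mat_vec[of _ "n * n" "n * n"])
  also have "kron ?I ?At *\<^sub>v vec_stack Y = vec_stack (?At * Y)"
    using kron_mult_vec_stack[of ?I n n ?At n n Y] At Y by simp
  also have "kron ?At ?I *\<^sub>v vec_stack Y = vec_stack (Y * A)"
    using kron_mult_vec_stack[of ?At n n ?I n n Y] At Y by simp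
  finally show ?thesis
    using A Y by (simp add: lyap_def vec_stack_minus[of _ n n] vec_stack_uminus)
qed

lemma BA_block_carrier:
  assumes "A \<in> carrier_mat n n" "B \<in> carrier_mat n m"
  shows "BA_block A B k \<in> carrier_mat (n * m) (n * n)"
  using assms Atil_carrier[OF assms(1)]
  by (auto simp: BA_block_def Btil_def kron_def intro!: mult_carrier_mat[of _ _ "n * n"] pow_carrier_mat)

lemma BA_block_Suc:
  assumes A: "A \<in> carrier_mat n n" and B: "B \<in> carrier_mat n m" and x: "x \<in> carrier_vec (n * n)"
  shows "BA_block A B (Suc k) *\<^sub>v x = BA_block A B k *\<^sub>v (transpose_mat (Atil A) *\<^sub>v x)"
proof -
  have a: "transpose_mat (Atil A) \<in> carrier_mat (n * n) (n * n)" using Atil_carrier[OF A] by simp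
  have b: "transpose_mat (Btil A B) \<in> carrier_mat (n * m) (n * n)"
    using A B by (auto simp: Btil_def kron_def)
  have "BA_block A B (Suc k) = BA_block A B k * transpose_mat (Atil A)"
    unfolding BA_block_def using assoc_mult_mat[OF b pow_carrier_mat[OF a] a, of k] by simp
  then show ?thesis
    using assoc_mult_mat_vec[OF BA_block_carrier[OF A B] a x] by simp
qed

text \<open>\<open>Btil^T\<close> is the Kronecker product of the identity with \<open>B^T\<close>,
  that is, multiplication by \<open>B^T\<close> from the left. The block rows of \<open>H\<close>
  thereby become matrix equations, in which powers of \<open>lyap\<close> can be
  manipulated.\<close>

lemma BA_block_mult_vec_stack:
  assumes A: "A \<in> carrier_mat n n" and B: "B \<in> carrier_mat n m" and Y: "Y \<in> carrier_mat n n"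
  shows "BA_block A B k *\<^sub>v vec_stack Y = vec_stack (transpose_mat B * (lyap A ^^ k) Y)"
  using Y
proof (induction k arbitrary: Y)
  case 0
  have "transpose_mat (Btil A B) = kron (1\<^sub>m n) (transpose_mat B)"
    using A by (simp add: Btil_def transpose_kron)
  moreover have "transpose_mat (Atil A) ^\<^sub>m 0 = 1\<^sub>m (n * n)"
    using Atil_carrier[OF A] by auto
  moreover have "kron (1\<^sub>m n) (transpose_mat B) \<in> carrier_mat (n * m) (n * n)"
    by (rule kron_carrier) (use B in auto)
  ultimately have "BA_block A B 0 = kron (1\<^sub>m n) (transpose_mat B)"
    by (simp add: BA_block_def)
  moreover have "kron (1\<^sub>m n) (transpose_mat B) *\<^sub>v vec_stack Y = vec_stack (transpose_mat B * Y)"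
    using kron_mult_vec_stack[of "1\<^sub>m n" n n "transpose_mat B" m n Y] B 0 by simp
  ultimately show ?case by simp
next
  case (Suc k)
  have "BA_block A B (Suc k) *\<^sub>v vec_stack Y = BA_block A B k *\<^sub>v vec_stack (lyap A Y)"
    by (simp only: BA_block_Suc[OF A B vec_stack_carrier[OF Suc.prems]] Atil_mult_vec_stack[OF A Suc.prems])
  also have "\<dots> = vec_stack (transpose_mat B * (lyap A ^^ k) (lyap A Y))"
    by (rule Suc.IH[OF lyap_carrier[OF A Suc.prems]])
  finally show ?case by (simp only: funpow_Suc_right o_apply)
qed

section \<open>Unstacking, symmetric coordinates and affine combinations\<close>

lemma mat_unstack_carrier: "mat_unstack n x \<in> carrier_mat n n"
  by (simp add: mat_unstack_def)

lemma vec_stack_unstack: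
  assumes "x \<in> carrier_vec (n * n)"
  shows "vec_stack (mat_unstack n x) = x"
proof (rule eq_vecI)
  fix k assume "k < dim_vec x"
  then have k: "k < n * n" using assms by simp
  then show "vec_stack (mat_unstack n x) $ k = x $ k"
    using div_mod_less[OF k] by (simp add: vec_stack_def mat_unstack_def)
qed (use assms in \<open>simp add: vec_stack_def mat_unstack_def\<close>)

lemma mat_unstack_stack:
  assumes "X \<in> carrier_mat n n"
  shows "mat_unstack n (vec_stack X) = X"
  by (rule eq_matI) (use assms in \<open>auto simp: mat_unstack_def vec_stack_index_pair\<close>)

lemma dup_mat_carrier: "dup_mat n \<in> carrier_mat (n * n) (n * (n + 1) div 2)"
  by (simp add: dup_mat_def)

lemma vech_carrier: "X \<in> carrier_mat n n \<Longrightarrow> vech X \<in> carrier_vec (n * (n + 1) div 2)"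
  using dim_vech by (metis carrier_vec_dim_vec)

text \<open>A row of \<open>dup_mat\<close> depends only on the maximum and minimum of its two
  matrix indices, so the rows of mirrored positions coincide. Hence any coefficient vector produces
  a symmetric \<open>Q\<close> or \<open>Y(T)\<close>.\<close>

lemma sym_mat_unstack_dup: "sym_mat n (mat_unstack n (dup_mat n *\<^sub>v x))"
proof -
  have "(dup_mat n *\<^sub>v x) $ (j * n + i) = (dup_mat n *\<^sub>v x) $ (i * n + j)" if "i < n" "j < n" for i j
  proof -
    have "row (dup_mat n) (j * n + i) = row (dup_mat n) (i * n + j)"
      using pair_index_less[OF that] pair_index_less[OF that(2,1)]
      by (intro eq_vecI) (simp_all add: dup_mat_def max.commute min.commute)
    then show ?thesis
      using pair_index_less[OF that] pair_index_less[OF that(2,1)] by (simp add: dup_mat_def)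
  qed
  then show ?thesis
    by (auto simp: sym_mat_def mat_unstack_def intro!: eq_matI)
qed

lemma mat_unstack_add:
  assumes "x \<in> carrier_vec (n * n)" "y \<in> carrier_vec (n * n)"
  shows "mat_unstack n (x + y) = mat_unstack n x + mat_unstack n y"
  by (rule eq_matI) (use assms in \<open>auto simp: mat_unstack_def pair_index_less(1)\<close>)

text \<open>By linearity the affine families of matrices in condition (iii) are images of affine
  families of coordinate vectors, where the system \<open>As\<close> can be applied.\<close>

lemma affine_comb_unstack:
  assumes M: "M \<in> carrier_mat (n * n) d" and q0: "q0 \<in> carrier_vec d"
    and q: "\<And>k. k \<in> {1..r} \<Longrightarrow> q k \<in> carrier_vec d"
  shows "affine_comb n r (mat_unstack n (M *\<^sub>v q0)) v (\<lambda>k. mat_unstack n (M *\<^sub>v q k))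
    = mat_unstack n (M *\<^sub>v (q0 + vec d (\<lambda>l. \<Sum>k = 1..r. v k * q k $ l)))"
proof -
  have "M *\<^sub>v (q0 + vec d (\<lambda>l. \<Sum>k = 1..r. v k * q k $ l))
      = M *\<^sub>v q0 + vec (n * n) (\<lambda>i. \<Sum>k = 1..r. v k * (M *\<^sub>v q k) $ i)"
    using M q0 mult_mat_vec_sum[of M "n * n" d "{1..r}" q v] q
    by (subst mult_add_distrib_mat_vec[of _ "n * n" d]) auto
  moreover have "mat_unstack n (vec (n * n) (\<lambda>i. \<Sum>k = 1..r. v k * (M *\<^sub>v q k) $ i))
      = mat n n (\<lambda>(i, j). \<Sum>k = 1..r. v k * mat_unstack n (M *\<^sub>v q k) $$ (i, j))"
    by (rule eq_matI) (auto simp: mat_unstack_def pair_index_less(1) intro!: sum.cong)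
  ultimately show ?thesis
    using M q0 by (simp add: affine_comb_def mat_unstack_add)
qed

lemma affine_comb_add:
  assumes "P \<in> carrier_mat n n" "M \<in> carrier_mat n n"
  shows "affine_comb n r (P + M) v F = P + affine_comb n r M v F"
  using assms unfolding affine_comb_def by (intro assoc_add_mat[of _ n n]) auto

text \<open>The image is a set, in which repetitions among the \<open>w k\<close> disappear.
  Combinations of a list keep one coefficient per index; list positions start at 0 and the family at
  1, whence the shift by \<open>Suc\<close>.\<close>

lemma in_span_image_iff:
  fixes w :: "nat \<Rightarrow> real vec"
  assumes w: "\<And>k. k \<in> {1..r} \<Longrightarrow> w k \<in> carrier_vec N"
  shows "z \<in> module.span class_ring (module_vec TYPE(real) N) (w ` {1..r})
    \<longleftrightarrow> (\<exists>v. z = vec N (\<lambda>l. \<Sum>k = 1..r. v k * w k $ l))"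
proof -
  interpret vec_space "TYPE(real)" N .
  define ws where "ws = map (\<lambda>k. w (Suc k)) [0..<r]"
  have set: "set ws = w ` {1..r}"
    unfolding image_Suc_atLeastLessThan[symmetric] atLeastLessThanSuc_atLeastAtMost[symmetric]
    by (simp add: ws_def image_image flip: image_Suc_atLeastLessThan)
  have carr: "set ws \<subseteq> carrier_vec N" using w by (auto simp: set)
  have lc: "lincomb_list c ws = vec N (\<lambda>l. \<Sum>k = 1..r. c (k - 1) * w k $ l)" for c
  proof -
    have "lincomb_list c ws = mat_of_cols N ws *\<^sub>v vec r c"
    proof -
      have "\<forall>x\<in>set ws. dim_vec x = N" using carr by auto
      from lincomb_list_as_mat_mult[OF this, of c] show ?thesis by (simp add: ws_def)
    qed
    also have "\<dots> = vec N (\<lambda>l. \<Sum>k = 1..r. c (k - 1) * w k $ l)"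
    proof (rule eq_vecI)
      fix l assume "l < dim_vec (vec N (\<lambda>l. \<Sum>k = 1..r. c (k - 1) * w k $ l))"
      then have l: "l < N" by simp
      have "(mat_of_cols N ws *\<^sub>v vec r c) $ l = (\<Sum>k = 0..<r. c k * w (Suc k) $ l)"
        using l by (auto simp: scalar_prod_def ws_def mat_of_cols_index intro!: sum.cong)
      also have "\<dots> = (\<Sum>k = 1..r. c (k - 1) * w k $ l)"
        by (rule sum.reindex_bij_witness[of _ "\<lambda>k. k - 1" Suc]) auto
      finally show "(mat_of_cols N ws *\<^sub>v vec r c) $ l
          = vec N (\<lambda>l. \<Sum>k = 1..r. c (k - 1) * w k $ l) $ l"
        using l by simp
    qed simp
    finally show ?thesis .
  qed
  have "z \<in> span (w ` {1..r}) \<longleftrightarrow> (\<exists>c. z = lincomb_list c ws)"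
    unfolding set[symmetric] span_list_as_span[OF carr, symmetric]
    by (auto simp: span_list_def)
  also have "\<dots> \<longleftrightarrow> (\<exists>v. z = vec N (\<lambda>l. \<Sum>k = 1..r. v k * w k $ l))"
  proof
    assume "\<exists>v. z = vec N (\<lambda>l. \<Sum>k = 1..r. v k * w k $ l)"
    then obtain v where v: "z = vec N (\<lambda>l. \<Sum>k = 1..r. v k * w k $ l)" ..
    have "z = lincomb_list (\<lambda>k. v (Suc k)) ws"
      unfolding lc v by (intro arg_cong[of _ _ "vec N"] ext sum.cong) auto
    then show "\<exists>c. z = lincomb_list c ws" by blast
  qed (auto simp: lc)
  finally show ?thesis .
qed

section \<open>Differentiation of matrix and vector functions\<close>

text \<open>Derivatives are quantified existentially, so closure under sums and products is an
  induction that never computes an iterated \<open>mat_deriv\<close>; \<open>mat_Ck_iff\<close>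
  transfers the result back.\<close>

primrec Ck_on :: "nat \<Rightarrow> real set \<Rightarrow> (real \<Rightarrow> real) \<Rightarrow> bool" where
  "Ck_on 0 S f \<longleftrightarrow> continuous_on S f"
| "Ck_on (Suc k) S f \<longleftrightarrow>
     (\<exists>f'. (\<forall>t\<in>S. (f has_vector_derivative f' t) (at t within S)) \<and> Ck_on k S f')"

lemma Ck_on_cong:
  assumes "\<And>t. t \<in> S \<Longrightarrow> f t = g t"
  shows "Ck_on k S f \<longleftrightarrow> Ck_on k S g"
proof (cases k)
  case (Suc k)
  have "(f has_vector_derivative d) (at t within S) \<longleftrightarrow> (g has_vector_derivative d) (at t within S)"
    if "t \<in> S" for t d
    using has_vector_derivative_transform[OF that, of f g d]
      has_vector_derivative_transform[OF that, of g f d] assms by auto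
  then show ?thesis using Suc by simp
qed (use assms in \<open>simp cong: continuous_on_cong\<close>)

lemma Ck_on_Suc_imp: "Ck_on (Suc k) S f \<Longrightarrow> Ck_on k S f"
proof (induction k arbitrary: f)
  case 0
  then show ?case
    by (auto simp: continuous_on_eq_continuous_within intro: has_vector_derivative_continuous)
qed (auto simp del: Ck_on.simps(1))

lemma Ck_on_const: "Ck_on k S (\<lambda>_. c)"
proof (induction k arbitrary: c)
  case (Suc k)
  then show ?case by (auto intro!: exI[of _ "\<lambda>_. 0"])
qed simp

lemma Ck_on_add: "Ck_on k S f \<Longrightarrow> Ck_on k S g \<Longrightarrow> Ck_on k S (\<lambda>t. f t + g t)"
proof (induction k arbitrary: f g)
  case (Suc k)
  then obtain f' g' where
    "\<forall>t\<in>S. (f has_vector_derivative f' t) (at t within S)" "Ck_on k S f'"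
    "\<forall>t\<in>S. (g has_vector_derivative g' t) (at t within S)" "Ck_on k S g'"
    by auto
  then show ?case
    by (auto intro!: exI[of _ "\<lambda>t. f' t + g' t"] has_vector_derivative_add Suc.IH)
qed (auto intro: continuous_on_add)

lemma Ck_on_mult: "Ck_on k S f \<Longrightarrow> Ck_on k S g \<Longrightarrow> Ck_on k S (\<lambda>t. f t * g t)"
proof (induction k arbitrary: f g)
  case (Suc k)
  then obtain f' g' where
    d: "\<forall>t\<in>S. (f has_vector_derivative f' t) (at t within S)" "Ck_on k S f'"
    "\<forall>t\<in>S. (g has_vector_derivative g' t) (at t within S)" "Ck_on k S g'"
    by auto
  \<comment> \<open>The product rule also leaves each factor undifferentiated, so both are needed at
    the lower order.\<close>
  have "Ck_on k S f" "Ck_on k S g" using Suc.prems by (auto intro: Ck_on_Suc_imp simp del: Ck_on.simps)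
  then have "Ck_on k S (\<lambda>t. f t * g' t + f' t * g t)"
    by (intro Ck_on_add Suc.IH d)
  then show ?case
    using d by (auto intro!: exI[of _ "\<lambda>t. f t * g' t + f' t * g t"] has_vector_derivative_mult)
qed (auto intro: continuous_on_mult)

lemma Ck_on_sum: "(\<And>i. i \<in> I \<Longrightarrow> Ck_on k S (f i)) \<Longrightarrow> Ck_on k S (\<lambda>t. \<Sum>i\<in>I. f i t)"
  by (induction I rule: infinite_finite_induct) (auto intro: Ck_on_const Ck_on_add)

lemma Ck_on_minus: "Ck_on k S f \<Longrightarrow> Ck_on k S g \<Longrightarrow> Ck_on k S (\<lambda>t. f t - g t)"
  using Ck_on_add[of k S f "\<lambda>t. (-1) * g t"] Ck_on_mult[OF Ck_on_const[of k S "-1"], of g]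
  by simp

lemma mat_deriv_dim[simp]:
  "dim_row (mat_deriv S F t) = dim_row (F t)" "dim_col (mat_deriv S F t) = dim_col (F t)"
  by (simp_all add: mat_deriv_def)

lemma mat_deriv_pow_dim[simp]:
  "dim_row ((mat_deriv S ^^ i) F t) = dim_row (F t)" "dim_col ((mat_deriv S ^^ i) F t) = dim_col (F t)"
  by (induction i) auto

text \<open>Peels off the innermost derivative, not the outermost one, which suits inductions that
  generalize over \<open>F\<close>.\<close>

lemma mat_Ck_Suc:
  "mat_Ck (Suc k) S F nr nc \<longleftrightarrow>
    (\<forall>t\<in>S. has_mat_derivative F (mat_deriv S F t) t S) \<and> mat_Ck k S (mat_deriv S F) nr nc"
  unfolding mat_Ck_def by (simp add: All_less_Suc2 funpow_Suc_right del: funpow.simps(2))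

lemma mat_Ck_carrier:
  "mat_Ck k S F nr nc \<Longrightarrow> t \<in> S \<Longrightarrow> F t \<in> carrier_mat nr nc"
  unfolding mat_Ck_def mat_continuous_def carrier_mat_def by simp

text \<open>On an interval of positive length derivatives within it are unique, endpoints included,
  so any witness in \<open>Ck_on\<close> must agree there with the entry of
  \<open>mat_deriv\<close>.\<close>

lemma mat_Ck_iff:
  assumes "a < b"
  shows "mat_Ck k {a..b} F nr nc \<longleftrightarrow> (\<forall>t\<in>{a..b}. F t \<in> carrier_mat nr nc) \<and>
    (\<forall>i<nr. \<forall>j<nc. Ck_on k {a..b} (\<lambda>t. F t $$ (i, j)))"
proof (induction k arbitrary: F)
  case 0
  then show ?case by (auto simp: mat_Ck_def mat_continuous_def)
next
  case (Suc k)
  let ?S = "{a..b}"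
  show ?case
  proof
    assume L: "mat_Ck (Suc k) ?S F nr nc"
    then have c: "F t \<in> carrier_mat nr nc" if "t \<in> ?S" for t by (rule mat_Ck_carrier[OF _ that])
    from L have d: "\<And>t. t \<in> ?S \<Longrightarrow> has_mat_derivative F (mat_deriv ?S F t) t ?S"
      and "mat_Ck k ?S (mat_deriv ?S F) nr nc" unfolding mat_Ck_Suc by blast+
    then have C: "Ck_on k ?S (\<lambda>t. mat_deriv ?S F t $$ (i, j))" if "i < nr" "j < nc" for i j
      using that unfolding Suc.IH by blast
    have D: "((\<lambda>s. F s $$ (i, j)) has_vector_derivative mat_deriv ?S F t $$ (i, j)) (at t within ?S)"
      if "i < nr" "j < nc" "t \<in> ?S" for i j t
      using d[OF that(3)] c[OF that(3)] that by (auto simp: has_mat_derivative_def)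
    have "Ck_on (Suc k) ?S (\<lambda>t. F t $$ (i, j))" if "i < nr" "j < nc" for i j
      unfolding Ck_on.simps
      by (intro exI[of _ "\<lambda>t. mat_deriv ?S F t $$ (i, j)"] conjI ballI C[OF that] D[OF that])
    then show "(\<forall>t\<in>?S. F t \<in> carrier_mat nr nc) \<and>
        (\<forall>i<nr. \<forall>j<nc. Ck_on (Suc k) ?S (\<lambda>t. F t $$ (i, j)))"
      using c by blast
  next
    assume "(\<forall>t\<in>?S. F t \<in> carrier_mat nr nc) \<and>
        (\<forall>i<nr. \<forall>j<nc. Ck_on (Suc k) ?S (\<lambda>t. F t $$ (i, j)))"
    then have c: "\<And>t. t \<in> ?S \<Longrightarrow> F t \<in> carrier_mat nr nc"
      and C: "\<And>i j. i < nr \<Longrightarrow> j < nc \<Longrightarrow> Ck_on (Suc k) ?S (\<lambda>t. F t $$ (i, j))" by blast+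
    have *: "((\<lambda>s. F s $$ (i, j)) has_vector_derivative mat_deriv ?S F t $$ (i, j)) (at t within ?S)"
      "Ck_on k ?S (\<lambda>t. mat_deriv ?S F t $$ (i, j))"
      if ij: "i < nr" "j < nc" and t: "t \<in> ?S" for i j t
    proof -
      obtain f' where "\<forall>t\<in>?S. ((\<lambda>s. F s $$ (i, j)) has_vector_derivative f' t) (at t within ?S)"
          and Ck: "Ck_on k ?S f'"
        using C[OF ij] by auto
      then have f': "((\<lambda>s. F s $$ (i, j)) has_vector_derivative f' t) (at t within ?S)"
        if "t \<in> ?S" for t
        using that by blast
      have eq: "mat_deriv ?S F t $$ (i, j) = f' t" if "t \<in> ?S" for t
        using c[OF that] ij vector_derivative_within_closed_interval[OF assms that f'[OF that]]
        by (auto simp: mat_deriv_def)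
      show "((\<lambda>s. F s $$ (i, j)) has_vector_derivative mat_deriv ?S F t $$ (i, j)) (at t within ?S)"
        using f'[OF t] eq[OF t] by simp
      show "Ck_on k ?S (\<lambda>t. mat_deriv ?S F t $$ (i, j))"
        by (rule Ck_on_cong[THEN iffD2, OF eq Ck])
    qed
    have "a \<in> ?S" using assms by simp
    have "has_mat_derivative F (mat_deriv ?S F t) t ?S" if "t \<in> ?S" for t
      using c[OF that] *(1)[OF _ _ that] by (auto simp: has_mat_derivative_def)
    moreover have "mat_Ck k ?S (mat_deriv ?S F) nr nc"
      unfolding Suc.IH
    proof (intro conjI ballI allI impI)
      fix t assume "t \<in> ?S"
      from c[OF this] show "mat_deriv ?S F t \<in> carrier_mat nr nc" by (intro carrier_matI) simp_all
    qed (rule *(2)[OF _ _ \<open>a \<in> ?S\<close>])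
    ultimately show "mat_Ck (Suc k) ?S F nr nc" by (simp add: mat_Ck_Suc)
  qed
qed

lemma mat_Ck_Suc_imp:
  "a < b \<Longrightarrow> mat_Ck (Suc k) {a..b} F nr nc \<Longrightarrow> mat_Ck k {a..b} F nr nc"
  by (auto simp: mat_Ck_iff simp del: Ck_on.simps intro: Ck_on_Suc_imp)

lemma mat_Ck_const: "a < b \<Longrightarrow> M \<in> carrier_mat nr nc \<Longrightarrow> mat_Ck k {a..b} (\<lambda>_. M) nr nc"
  by (auto simp: mat_Ck_iff intro: Ck_on_const)

lemma mat_Ck_add:
  assumes "a < b" "mat_Ck k {a..b} F nr nc" "mat_Ck k {a..b} G nr nc"
  shows "mat_Ck k {a..b} (\<lambda>t. F t + G t) nr nc"
proof -
  have c: "F t \<in> carrier_mat nr nc" "G t \<in> carrier_mat nr nc" if "t \<in> {a..b}" for t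
    using mat_Ck_carrier assms that by blast+
  have "Ck_on k {a..b} (\<lambda>t. (F t + G t) $$ (i, j))" if "i < nr" "j < nc" for i j
  proof -
    have "Ck_on k {a..b} (\<lambda>t. F t $$ (i, j) + G t $$ (i, j))"
      using assms that by (intro Ck_on_add) (auto simp: mat_Ck_iff)
    then show ?thesis
    proof (rule Ck_on_cong[THEN iffD1, rotated])
      fix t assume "t \<in> {a..b}"
      from c[OF this] that
      show "F t $$ (i, j) + G t $$ (i, j) = (F t + G t) $$ (i, j)" by simp
    qed
  qed
  then show ?thesis using assms(1) c by (auto simp: mat_Ck_iff minus_carrier_mat)
qed

lemma mat_Ck_minus:
  assumes "a < b" "mat_Ck k {a..b} F nr nc" "mat_Ck k {a..b} G nr nc"
  shows "mat_Ck k {a..b} (\<lambda>t. F t - G t) nr nc"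
proof -
  have c: "F t \<in> carrier_mat nr nc" "G t \<in> carrier_mat nr nc" if "t \<in> {a..b}" for t
    using mat_Ck_carrier assms that by blast+
  have "Ck_on k {a..b} (\<lambda>t. (F t - G t) $$ (i, j))" if "i < nr" "j < nc" for i j
  proof -
    have "Ck_on k {a..b} (\<lambda>t. F t $$ (i, j) - G t $$ (i, j))"
      using assms that by (intro Ck_on_minus) (auto simp: mat_Ck_iff)
    then show ?thesis
    proof (rule Ck_on_cong[THEN iffD1, rotated])
      fix t assume "t \<in> {a..b}"
      from c[OF this] that
      show "F t $$ (i, j) - G t $$ (i, j) = (F t - G t) $$ (i, j)" by simp
    qed
  qed
  then show ?thesis using assms(1) c by (auto simp: mat_Ck_iff minus_carrier_mat)
qed

lemma mat_Ck_mult: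
  assumes "a < b" "mat_Ck k {a..b} F nr n" "mat_Ck k {a..b} G n nc"
  shows "mat_Ck k {a..b} (\<lambda>t. F t * G t) nr nc"
proof -
  have c: "F t \<in> carrier_mat nr n" "G t \<in> carrier_mat n nc" if "t \<in> {a..b}" for t
    using mat_Ck_carrier assms that by blast+
  have "Ck_on k {a..b} (\<lambda>t. (F t * G t) $$ (i, j))" if "i < nr" "j < nc" for i j
  proof -
    have "Ck_on k {a..b} (\<lambda>t. \<Sum>l = 0..<n. F t $$ (i, l) * G t $$ (l, j))"
      using assms that by (intro Ck_on_sum Ck_on_mult) (auto simp: mat_Ck_iff)
    then show ?thesis
    proof (rule Ck_on_cong[THEN iffD1, rotated])
      fix t assume "t \<in> {a..b}"
      from c[OF this] that
      show "(\<Sum>l = 0..<n. F t $$ (i, l) * G t $$ (l, j)) = (F t * G t) $$ (i, j)"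
        by (auto simp: scalar_prod_def)
    qed
  qed
  then show ?thesis using assms(1) mult_carrier_mat[OF c] by (simp add: mat_Ck_iff)
qed

section \<open>Smoothness and symmetry of \<open>G\<close>\<close>

lemma G_of_Ck:
  assumes "a < b" and A: "A \<in> carrier_mat n n" and B: "B \<in> carrier_mat n m"
    and P: "mat_Ck (Suc k) {a..b} P n n"
  shows "mat_Ck k {a..b} (G_of {a..b} A B P) n n"
proof -
  note c = mat_Ck_const[OF assms(1)]
  have P': "mat_Ck k {a..b} P n n" by (rule mat_Ck_Suc_imp[OF assms(1) P])
  have D: "mat_Ck k {a..b} (mat_deriv {a..b} P) n n" using P by (simp add: mat_Ck_Suc)
  show ?thesis
    unfolding G_of_def[abs_def]
    by (intro mat_Ck_minus mat_Ck_add mat_Ck_mult[of _ _ _ _ n n] mat_Ck_mult[of _ _ _ _ n m]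
        assms(1) D P' c) (use A B in auto)
qed

lemma mat_deriv_sym:
  assumes "a < b" and d: "has_mat_derivative P (mat_deriv {a..b} P t) t {a..b}"
    and s: "\<And>t. t \<in> {a..b} \<Longrightarrow> sym_mat n (P t)" and t: "t \<in> {a..b}"
  shows "sym_mat n (mat_deriv {a..b} P t)"
proof -
  let ?D = "mat_deriv {a..b} P t"
  have "P t \<in> carrier_mat n n" using s[OF t] by (simp add: sym_mat_def)
  then have dims: "dim_row (P t) = n" "dim_col (P t) = n" by auto
  then have D: "?D \<in> carrier_mat n n" by (intro carrier_matI) simp_all
  have "?D $$ (i, j) = ?D $$ (j, i)" if ij: "i < n" "j < n" for i j
  proof -
    have sw: "P s $$ (i, j) = P s $$ (j, i)" if "s \<in> {a..b}" for s
    proof -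
      have "P s \<in> carrier_mat n n" "transpose_mat (P s) = P s" using s[OF that] by (auto simp: sym_mat_def)
      then have "P s $$ (i, j) = transpose_mat (P s) $$ (i, j)" by simp
      also have "\<dots> = P s $$ (j, i)" using \<open>P s \<in> carrier_mat n n\<close> ij by simp
      finally show ?thesis .
    qed
    have "((\<lambda>s. P s $$ (j, i)) has_vector_derivative ?D $$ (j, i)) (at t within {a..b})"
      using d ij unfolding has_mat_derivative_def by (simp add: dims)
    then have 1: "((\<lambda>s. P s $$ (i, j)) has_vector_derivative ?D $$ (j, i)) (at t within {a..b})"
      by (rule has_vector_derivative_transform[OF t, rotated]) (rule sw)
    have 2: "((\<lambda>s. P s $$ (i, j)) has_vector_derivative ?D $$ (i, j)) (at t within {a..b})"
      using d ij unfolding has_mat_derivative_def by (simp add: dims)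
    show ?thesis
      using vector_derivative_within_closed_interval[OF assms(1) t 1]
        vector_derivative_within_closed_interval[OF assms(1) t 2] by simp
  qed
  then show ?thesis using D by (auto simp: sym_mat_def dims intro!: eq_matI)
qed

lemma G_of_sym:
  assumes "a < b" and A: "A \<in> carrier_mat n n" and B: "B \<in> carrier_mat n m"
    and d: "has_mat_derivative P (mat_deriv {a..b} P t) t {a..b}"
    and s: "\<And>t. t \<in> {a..b} \<Longrightarrow> sym_mat n (P t)" and t: "t \<in> {a..b}"
  shows "sym_mat n (G_of {a..b} A B P t)"
proof -
  let ?D = "mat_deriv {a..b} P t" let ?P = "P t"
  have D: "?D \<in> carrier_mat n n" "transpose_mat ?D = ?D"
    using mat_deriv_sym[OF assms(1) d s t] by (auto simp: sym_mat_def)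
  have P: "?P \<in> carrier_mat n n" "transpose_mat ?P = ?P"
    using s[OF t] by (auto simp: sym_mat_def)
  have Bt: "transpose_mat B \<in> carrier_mat m n" using B by simp
  have 1: "transpose_mat (transpose_mat A * ?P) = ?P * A" "transpose_mat (?P * A) = transpose_mat A * ?P"
    using A P by (simp_all add: transpose_mult_dim)
  have "transpose_mat (?P * B * transpose_mat B * ?P) = ?P * (B * (transpose_mat B * ?P))"
    using B P by (simp add: transpose_mult_dim)
  also have "\<dots> = ?P * B * transpose_mat B * ?P"
    using B P by (simp add: mult_assoc_mat_dim)
  finally have 2: "transpose_mat (?P * B * transpose_mat B * ?P) = ?P * B * transpose_mat B * ?P" .
  have 3: "transpose_mat A * ?P \<in> carrier_mat n n" "?P * A \<in> carrier_mat n n"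
    "?P * B * transpose_mat B * ?P \<in> carrier_mat n n"
    using A B P by auto
  have 4: "?D + transpose_mat A * ?P + ?P * A = ?D + ?P * A + transpose_mat A * ?P"
    by (simp only: assoc_add_mat[OF D(1) 3(1,2)] assoc_add_mat[OF D(1) 3(2,1)] comm_add_mat[OF 3(1,2)])
  have 5: "?D + transpose_mat A * ?P \<in> carrier_mat n n" "?D + transpose_mat A * ?P + ?P * A \<in> carrier_mat n n"
    using 3 by (simp_all only: add_carrier_mat)
  have "transpose_mat (?D + transpose_mat A * ?P + ?P * A - ?P * B * transpose_mat B * ?P)
      = ?D + ?P * A + transpose_mat A * ?P - ?P * B * transpose_mat B * ?P"
    by (simp only: transpose_minus[OF 5(2) 3(3)] transpose_add[OF 5(1) 3(2)] transpose_add[OF D(1) 3(1)]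
        1 2 D(2))
  then show ?thesis
    unfolding sym_mat_def G_of_def by (simp only: 4 minus_carrier_mat[OF 3(3)] simp_thms)
qed

text \<open>The carrier condition at all times, not only at \<open>t\<close>, is built in: entries
  of a sum or of a matrix multiple can be expanded at nearby times only if the dimension is known
  there too.\<close>

definition has_vec_derivative ::
  "nat \<Rightarrow> (real \<Rightarrow> real vec) \<Rightarrow> real vec \<Rightarrow> real \<Rightarrow> real set \<Rightarrow> bool" where
  "has_vec_derivative n x x' t S \<longleftrightarrow> (\<forall>s\<in>S. x s \<in> carrier_vec n) \<and> x' \<in> carrier_vec n \<and>
     (\<forall>i<n. ((\<lambda>s. x s $ i) has_vector_derivative x' $ i) (at t within S))"

lemma has_vec_derivativeI:
  fixes x' :: "real vec" and x :: "real \<Rightarrow> real vec"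
  assumes "\<And>s. s \<in> S \<Longrightarrow> x s \<in> carrier_vec n" "x' \<in> carrier_vec n" "t \<in> S"
    and "\<And>i. i < n \<Longrightarrow> (f i has_vector_derivative x' $ i) (at t within S)"
    and "\<And>i s. i < n \<Longrightarrow> s \<in> S \<Longrightarrow> x s $ i = f i s"
  shows "has_vec_derivative n x x' t S"
  unfolding has_vec_derivative_def
  using assms(1,2) has_vector_derivative_transform[OF assms(3,5,4)] by auto

lemma has_vec_derivative_cong:
  assumes "has_vec_derivative n x x' t S" "t \<in> S" "\<And>s. s \<in> S \<Longrightarrow> y s = x s"
  shows "has_vec_derivative n y x' t S"
  by (rule has_vec_derivativeI[where f = "\<lambda>i s. x s $ i"])
     (use assms in \<open>auto simp: has_vec_derivative_def\<close>)

lemma has_vec_derivative_const: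
  "c \<in> carrier_vec n \<Longrightarrow> has_vec_derivative n (\<lambda>_. c) (0\<^sub>v n) t S"
  by (auto simp: has_vec_derivative_def)

lemma has_vec_derivative_add:
  assumes "has_vec_derivative n x x' t S" "has_vec_derivative n y y' t S" "t \<in> S"
  shows "has_vec_derivative n (\<lambda>s. x s + y s) (x' + y') t S"
  by (rule has_vec_derivativeI[where f = "\<lambda>i s. x s $ i + y s $ i"])
     (use assms in \<open>auto simp: has_vec_derivative_def intro!: has_vector_derivative_add\<close>)

lemma has_vec_derivative_uminus:
  assumes "has_vec_derivative n x x' t S" "t \<in> S"
  shows "has_vec_derivative n (\<lambda>s. - x s) (- x') t S"
  by (rule has_vec_derivativeI[where f = "\<lambda>i s. - x s $ i"])
     (use assms in \<open>auto simp: has_vec_derivative_def intro!: has_vector_derivative_minus\<close>)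

lemma has_vec_derivative_mult:
  assumes M: "M \<in> carrier_mat m n" and x: "has_vec_derivative n x x' t S" and t: "t \<in> S"
  shows "has_vec_derivative m (\<lambda>s. M *\<^sub>v x s) (M *\<^sub>v x') t S"
proof (rule has_vec_derivativeI[OF _ _ t, where f = "\<lambda>i s. \<Sum>j = 0..<n. M $$ (i, j) * x s $ j"])
  fix i assume i: "i < m"
  have "((\<lambda>s. \<Sum>j = 0..<n. M $$ (i, j) * x s $ j) has_vector_derivative
      (\<Sum>j = 0..<n. M $$ (i, j) * x' $ j)) (at t within S)"
    using x by (intro has_vector_derivative_sum has_vector_derivative_mult_right)
      (auto simp: has_vec_derivative_def)
  also have "(\<Sum>j = 0..<n. M $$ (i, j) * x' $ j) = (M *\<^sub>v x') $ i"
    using M x i by (auto simp: has_vec_derivative_def scalar_prod_def)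
  finally show "((\<lambda>s. \<Sum>j = 0..<n. M $$ (i, j) * x s $ j) has_vector_derivative (M *\<^sub>v x') $ i)
      (at t within S)" .
  fix s assume "s \<in> S"
  then have "dim_vec (x s) = n" using x by (auto simp: has_vec_derivative_def)
  then show "(M *\<^sub>v x s) $ i = (\<Sum>j = 0..<n. M $$ (i, j) * x s $ j)"
    using M i by (auto simp: scalar_prod_def)
qed (use M x in \<open>auto simp: has_vec_derivative_def\<close>)

lemma has_vec_derivative_unique:
  assumes "a < b" "t \<in> {a..b}" "has_vec_derivative n x x' t {a..b}" "has_vec_derivative n x x'' t {a..b}"
  shows "x' = x''"
proof (rule eq_vecI)
  fix i assume "i < dim_vec x''"
  then have "i < n" using assms(4) by (auto simp: has_vec_derivative_def)
  then have "((\<lambda>s. x s $ i) has_vector_derivative x' $ i) (at t within {a..b})"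
    "((\<lambda>s. x s $ i) has_vector_derivative x'' $ i) (at t within {a..b})"
    using assms by (auto simp: has_vec_derivative_def)
  from this[THEN vector_derivative_within_closed_interval[OF assms(1,2)]]
  show "x' $ i = x'' $ i" by simp
qed (use assms in \<open>auto simp: has_vec_derivative_def\<close>)

lemma vec_deriv_eqI:
  assumes "a < b" "t \<in> {a..b}" "has_vec_derivative n x x' t {a..b}"
  shows "vec_deriv {a..b} x t = x'"
proof (rule eq_vecI)
  have dims: "dim_vec (x t) = n" "dim_vec x' = n"
    using assms by (auto simp: has_vec_derivative_def)
  then show "dim_vec (vec_deriv {a..b} x t) = dim_vec x'" by (simp add: vec_deriv_def)
  fix i assume "i < dim_vec x'"
  then have i: "i < n" by (simp add: dims)
  then have "((\<lambda>s. x s $ i) has_vector_derivative x' $ i) (at t within {a..b})"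
    using assms(3) by (simp add: has_vec_derivative_def)
  from vector_derivative_within_closed_interval[OF assms(1,2) this]
  show "vec_deriv {a..b} x t $ i = x' $ i" using i by (simp add: vec_deriv_def dims)
qed

lemma has_vec_derivative_vec_stack:
  assumes F: "\<And>s. s \<in> S \<Longrightarrow> F s \<in> carrier_mat p q" and F': "F' \<in> carrier_mat p q" and t: "t \<in> S"
  shows "has_vec_derivative (p * q) (\<lambda>s. vec_stack (F s)) (vec_stack F') t S
    \<longleftrightarrow> has_mat_derivative F F' t S"
proof
  assume d: "has_mat_derivative F F' t S"
  show "has_vec_derivative (p * q) (\<lambda>s. vec_stack (F s)) (vec_stack F') t S"
  proof (rule has_vec_derivativeI[OF _ _ t, where f = "\<lambda>k s. F s $$ (k mod p, k div p)"])
    fix k assume k: "k < p * q"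
    then show "((\<lambda>s. F s $$ (k mod p, k div p)) has_vector_derivative vec_stack F' $ k) (at t within S)"
      using d F' div_mod_less[OF k] by (simp add: has_mat_derivative_def vec_stack_index)
    show "vec_stack (F s) $ k = F s $$ (k mod p, k div p)" if "s \<in> S" for s
      by (rule vec_stack_index[OF F[OF that] k])
  qed (use F F' vec_stack_carrier in auto)
next
  assume d: "has_vec_derivative (p * q) (\<lambda>s. vec_stack (F s)) (vec_stack F') t S"
  have "((\<lambda>s. F s $$ (i, j)) has_vector_derivative F' $$ (i, j)) (at t within S)"
    if ij: "i < p" "j < q" for i j
  proof -
    have "((\<lambda>s. vec_stack (F s) $ (j * p + i)) has_vector_derivative vec_stack F' $ (j * p + i))
        (at t within S)"
      using d pair_index_less(1)[OF ij] by (simp add: has_vec_derivative_def)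
    then have "((\<lambda>s. vec_stack (F s) $ (j * p + i)) has_vector_derivative F' $$ (i, j)) (at t within S)"
      using vec_stack_index_pair[OF F' ij] by simp
    then show ?thesis
      by (rule has_vector_derivative_transform[OF t, rotated])
        (rule vec_stack_index_pair[OF F ij, symmetric])
  qed
  then show "has_mat_derivative F F' t S"
    using F[OF t] F' by (auto simp: has_mat_derivative_def)
qed

lemma stack_vec_carrier: "stack_vec n h F \<in> carrier_vec (n * h)"
  by (simp add: stack_vec_def)

lemma has_vec_derivative_stack_vec:
  assumes "\<And>k. k < n \<Longrightarrow> has_vec_derivative h (F k) (F' k) t S" "t \<in> S"
  shows "has_vec_derivative (n * h) (\<lambda>s. stack_vec n h (\<lambda>k. F k s)) (stack_vec n h F') t S"
proof (rule has_vec_derivativeI[OF _ _ assms(2), where f = "\<lambda>i s. F (i div h) s $ (i mod h)"])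
  fix i assume "i < n * h"
  then have "i < h * n" by (simp add: mult.commute)
  from div_mod_less[OF this] assms(1)
  show "((\<lambda>s. F (i div h) s $ (i mod h)) has_vector_derivative stack_vec n h F' $ i) (at t within S)"
    using \<open>i < n * h\<close> by (auto simp: stack_vec_def has_vec_derivative_def)
qed (auto simp: stack_vec_def)

lemma has_vec_derivative_finsum_vec:
  assumes I: "finite I" and x: "\<And>i. i \<in> I \<Longrightarrow> has_vec_derivative n (x i) (x' i) t S" and t: "t \<in> S"
  shows "has_vec_derivative n (\<lambda>s. finsum_vec TYPE(real) n (\<lambda>i. x i s) I) (finsum_vec TYPE(real) n x' I) t S"
proof (rule has_vec_derivativeI[OF _ _ t, where f = "\<lambda>j s. \<Sum>i\<in>I. x i s $ j"])
  have x'c: "x' \<in> I \<rightarrow> carrier_vec n" using x by (auto simp: has_vec_derivative_def)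
  then show "finsum_vec TYPE(real) n x' I \<in> carrier_vec n" by (rule finsum_vec_closed)
  have xc: "(\<lambda>i. x i s) \<in> I \<rightarrow> carrier_vec n" if "s \<in> S" for s
    using x that by (auto simp: has_vec_derivative_def)
  then show "finsum_vec TYPE(real) n (\<lambda>i. x i s) I \<in> carrier_vec n" if "s \<in> S" for s
    using that by (intro finsum_vec_closed)
  fix j assume j: "j < n"
  show "((\<lambda>s. \<Sum>i\<in>I. x i s $ j) has_vector_derivative finsum_vec TYPE(real) n x' I $ j) (at t within S)"
    unfolding index_finsum_vec[OF I j x'c] using x j
    by (intro has_vector_derivative_sum) (auto simp: has_vec_derivative_def)
  show "finsum_vec TYPE(real) n (\<lambda>i. x i s) I $ j = (\<Sum>i\<in>I. x i s $ j)" if "s \<in> S" for s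
    by (rule index_finsum_vec[OF I j xc[OF that]])
qed

section \<open>Uniqueness for linear differential equations\<close>

lemma nonneg_derivative_imp_mono:
  fixes f :: "real \<Rightarrow> real"
  assumes f: "\<And>x. x \<in> {a..b} \<Longrightarrow> (f has_real_derivative f' x) (at x within {a..b})"
    and nn: "\<And>x. x \<in> {a..b} \<Longrightarrow> 0 \<le> f' x" and s: "a \<le> s" "s \<le> t" "t \<le> b"
  shows "f s \<le> f t"
proof (cases "s = t")
  case False
  then have "s < t" using s by simp
  have "(f has_derivative (\<lambda>h. f' x * h)) (at x within {s..t})" if "s \<le> x" "x \<le> t" for x
    using has_field_derivative_subset[OF f, of x "{s..t}"] that s
    by (auto simp: has_field_derivative_def)
  from mvt_simple[OF \<open>s < t\<close> this] obtain x where x: "x \<in> {s<..<t}" and "f t - f s = f' x * (t - s)"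
    by blast
  moreover have "0 \<le> f' x * (t - s)"
    using nn[of x] s x by (intro mult_nonneg_nonneg) auto
  ultimately show ?thesis by linarith
qed simp

text \<open>Gronwall's argument: with \<open>E\<close> the squared norm of \<open>z\<close> and \<open>c\<close> large,
  \<open>exp (c t) E\<close> increases and \<open>exp (- c t) E\<close> decreases.\<close>

lemma linear_ode_zero:
  assumes M: "M \<in> carrier_mat n n"
    and z: "\<And>t. t \<in> {a..b} \<Longrightarrow> has_vec_derivative n z (M *\<^sub>v z t) t {a..b}"
    and t0: "t0 \<in> {a..b}" "z t0 = 0\<^sub>v n" and t: "t \<in> {a..b}"
  shows "z t = 0\<^sub>v n"
proof -
  have zc: "z s \<in> carrier_vec n" if "s \<in> {a..b}" for s
    using z[OF that] that unfolding has_vec_derivative_def by blast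
  define E where "E s = (\<Sum>i = 0..<n. z s $ i * z s $ i)" for s
  define E' where "E' s = (\<Sum>i = 0..<n. z s $ i * (M *\<^sub>v z s) $ i + (M *\<^sub>v z s) $ i * z s $ i)" for s
  have E: "(E has_real_derivative E' s) (at s within {a..b})" if "s \<in> {a..b}" for s
    unfolding E_def[abs_def] E'_def has_real_derivative_iff_has_vector_derivative
  proof (rule has_vector_derivative_sum)
    fix i assume "i \<in> {0..<n}"
    then have "((\<lambda>s. z s $ i) has_vector_derivative (M *\<^sub>v z s) $ i) (at s within {a..b})"
      using z[OF that] unfolding has_vec_derivative_def by simp
    from has_vector_derivative_mult[OF this this]
    show "((\<lambda>s. z s $ i * z s $ i) has_vector_derivative
        z s $ i * (M *\<^sub>v z s) $ i + (M *\<^sub>v z s) $ i * z s $ i) (at s within {a..b})" .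
  qed
  have E0: "0 \<le> E s" for s unfolding E_def by (rule sum_nonneg) simp
  define c where "c = 2 * (\<Sum>i = 0..<n. \<Sum>j = 0..<n. \<bar>M $$ (i, j)\<bar>)"
  have bound: "\<bar>E' s\<bar> \<le> c * E s" if s: "s \<in> {a..b}" for s
  proof -
    have zz: "\<bar>z s $ i * z s $ j\<bar> \<le> E s" if "i < n" "j < n" for i j
    proof -
      have le: "z s $ k * z s $ k \<le> E s" if "k < n" for k
        unfolding E_def using that by (intro member_le_sum) auto
      have "\<bar>z s $ i * z s $ j\<bar> \<le> (z s $ i * z s $ i + z s $ j * z s $ j) / 2"
        using zero_le_square[of "\<bar>z s $ i\<bar> - \<bar>z s $ j\<bar>"] by (simp add: algebra_simps abs_mult)
      then show ?thesis using le[OF that(1)] le[OF that(2)] by simp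
    qed
    have "E' s = 2 * (\<Sum>i = 0..<n. \<Sum>j = 0..<n. M $$ (i, j) * (z s $ i * z s $ j))"
    proof -
      have Mz: "z s $ i * (M *\<^sub>v z s) $ i = (\<Sum>j = 0..<n. M $$ (i, j) * (z s $ i * z s $ j))"
        if "i < n" for i
      proof -
        have "(M *\<^sub>v z s) $ i = (\<Sum>j = 0..<n. M $$ (i, j) * z s $ j)"
          using M zc[OF s] that by (auto simp: scalar_prod_def)
        then show ?thesis by (simp only: sum_distrib_left mult.left_commute)
      qed
      have "E' s = (\<Sum>i = 0..<n. 2 * (z s $ i * (M *\<^sub>v z s) $ i))"
        unfolding E'_def by (rule sum.cong) auto
      also have "\<dots> = 2 * (\<Sum>i = 0..<n. z s $ i * (M *\<^sub>v z s) $ i)"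
        by (rule sum_distrib_left[symmetric])
      also have "(\<Sum>i = 0..<n. z s $ i * (M *\<^sub>v z s) $ i)
          = (\<Sum>i = 0..<n. \<Sum>j = 0..<n. M $$ (i, j) * (z s $ i * z s $ j))"
        by (rule sum.cong) (simp_all add: Mz)
      finally show ?thesis .
    qed
    also have "\<bar>\<dots>\<bar> \<le> 2 * (\<Sum>i = 0..<n. \<Sum>j = 0..<n. \<bar>M $$ (i, j) * (z s $ i * z s $ j)\<bar>)"
    proof -
      have "\<bar>\<Sum>i = 0..<n. \<Sum>j = 0..<n. M $$ (i, j) * (z s $ i * z s $ j)\<bar>
          \<le> (\<Sum>i = 0..<n. \<Sum>j = 0..<n. \<bar>M $$ (i, j) * (z s $ i * z s $ j)\<bar>)"
        by (rule order_trans[OF sum_abs sum_mono]) (rule sum_abs)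
      then show ?thesis unfolding abs_mult[of 2] by simp
    qed
    also have "\<dots> \<le> 2 * (\<Sum>i = 0..<n. \<Sum>j = 0..<n. \<bar>M $$ (i, j)\<bar> * E s)"
    proof (intro mult_left_mono sum_mono)
      fix i j assume "i \<in> {0..<n}" "j \<in> {0..<n}"
      then show "\<bar>M $$ (i, j) * (z s $ i * z s $ j)\<bar> \<le> \<bar>M $$ (i, j)\<bar> * E s"
        unfolding abs_mult[of "M $$ (i, j)"] by (intro mult_left_mono zz) auto
    qed simp
    also have "\<dots> = c * E s" by (simp only: c_def sum_distrib_right mult.assoc)
    finally show ?thesis .
  qed
  have Et0: "E t0 = 0" using t0(2) by (simp add: E_def)
  have "E t \<le> 0"
  proof (cases "t \<le> t0")
    case True
    have "exp (c * t) * E t \<le> exp (c * t0) * E t0"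
    proof (rule nonneg_derivative_imp_mono[where a = a and b = b and s = t and t = t0 and f = "\<lambda>s. exp (c * s) * E s" and f' = "\<lambda>s. exp (c * s) * (c * E s + E' s)"])
      fix s assume s: "s \<in> {a..b}"
      show "((\<lambda>s. exp (c * s) * E s) has_real_derivative exp (c * s) * (c * E s + E' s)) (at s within {a..b})"
      proof (rule DERIV_cong)
        have "((\<lambda>s. exp (c * s)) has_real_derivative c * exp (c * s)) (at s within {a..b})"
          by (auto intro!: derivative_eq_intros)
        from DERIV_mult[OF this E[OF s]]
        show "((\<lambda>s. exp (c * s) * E s) has_real_derivative
            c * exp (c * s) * E s + E' s * exp (c * s)) (at s within {a..b})" .
      qed (simp add: algebra_simps)
      show "0 \<le> exp (c * s) * (c * E s + E' s)" using bound[OF s] by simp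
    qed (use True t t0 in auto)
    then show ?thesis by (simp add: Et0 mult_le_0_iff)
  next
    case False
    have "- (exp (- c * t0) * E t0) \<le> - (exp (- c * t) * E t)"
    proof (rule nonneg_derivative_imp_mono[where a = a and b = b and s = t0 and t = t and f = "\<lambda>s. - (exp (- c * s) * E s)" and f' = "\<lambda>s. exp (- c * s) * (c * E s - E' s)"])
      fix s assume s: "s \<in> {a..b}"
      show "((\<lambda>s. - (exp (- c * s) * E s)) has_real_derivative exp (- c * s) * (c * E s - E' s)) (at s within {a..b})"
      proof (rule DERIV_cong)
        have "((\<lambda>s. exp (- c * s)) has_real_derivative - c * exp (- c * s)) (at s within {a..b})"
          by (auto intro!: derivative_eq_intros)
        from DERIV_minus[OF DERIV_mult[OF this E[OF s]]]
        show "((\<lambda>s. - (exp (- c * s) * E s)) has_real_derivative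
            - (- c * exp (- c * s) * E s + E' s * exp (- c * s))) (at s within {a..b})" .
      qed (simp add: algebra_simps)
      show "0 \<le> exp (- c * s) * (c * E s - E' s)" using bound[OF s] by simp
    qed (use False t t0 in auto)
    then show ?thesis by (simp add: Et0 mult_le_0_iff)
  qed
  then have "z t \<bullet> z t = 0" using E0[of t] zc[OF t] by (simp add: E_def scalar_prod_def)
  then show ?thesis using scalar_prod_self_eq_0[OF zc[OF t]] by simp
qed

section \<open>Invertibility of \<open>H\<close>\<close>

text \<open>If \<open>p\<close> is such that \<open>(A\<^sup>T)\<^sup>p w\<close> depends linearly on the lower powers, the functions
  \<open>w \<bullet> A\<^sup>k x(t)\<close>, \<open>k < p\<close>, satisfy a closed homogeneous linear system without control, so they
  vanish along the trajectory steering \<open>0\<close> to \<open>w\<close>, and \<open>w \<bullet> w = 0\<close>.\<close>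

lemma controllable_observable:
  assumes A: "A \<in> carrier_mat n n" and B: "B \<in> carrier_mat n m" and ctrl: "controllable n m A B"
    and w: "w \<in> carrier_vec n"
    and orth: "\<And>k. k < n \<Longrightarrow> transpose_mat B *\<^sub>v (transpose_mat A ^\<^sub>m k *\<^sub>v w) = 0\<^sub>v m"
  shows "w = 0\<^sub>v n"
proof -
  have At: "transpose_mat A \<in> carrier_mat n n" using A by simp
  define v where "v k = transpose_mat A ^\<^sub>m k *\<^sub>v w" for k
  have v: "v k \<in> carrier_vec n" for k
    unfolding v_def by (rule mult_mat_vec_carrier[OF pow_carrier_mat[OF At] w])
  have v0: "v 0 = w" using At w by (simp add: v_def)
  have vSuc: "transpose_mat A *\<^sub>v v k = v (Suc k)" for k
    unfolding v_def by (rule pow_mat_vec_Suc(1)[OF At w, symmetric])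
  obtain c where c: "\<exists>k. k \<le> n \<and> c k \<noteq> 0" "\<And>i. i < n \<Longrightarrow> (\<Sum>k\<le>n. c k * v k $ i) = 0"
    using ex_linear_dependency[of n "\<lambda>k i. v k $ i"] by auto
  define p where "p = (GREATEST k. k \<le> n \<and> c k \<noteq> 0)"
  have p: "p \<le> n" "c p \<noteq> 0"
    using GreatestI_ex_nat[OF c(1), of n] by (auto simp: p_def)
  have great: "c k = 0" if "p < k" "k \<le> n" for k
    using Greatest_le_nat[of "\<lambda>k. k \<le> n \<and> c k \<noteq> 0" k n] that by (auto simp: p_def)
  have vp: "v p $ i = (\<Sum>j = 0..<p. (- c j / c p) * v j $ i)" if "i < n" for i
  proof -
    have "(\<Sum>k\<le>n. c k * v k $ i) = (\<Sum>k\<in>{0..<p} \<union> {p}. c k * v k $ i)"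
      by (rule sum.mono_neutral_right) (use p great in \<open>auto simp: not_le not_less\<close>)
    also have "\<dots> = (\<Sum>k = 0..<p. c k * v k $ i) + c p * v p $ i"
      by (subst sum.union_disjoint) auto
    finally have "c p * v p $ i = - (\<Sum>k = 0..<p. c k * v k $ i)"
      using c(2)[OF that] by simp
    then have "v p $ i = - (\<Sum>k = 0..<p. c k * v k $ i) / c p"
      using p(2) by (simp add: field_simps)
    then show ?thesis by (simp add: sum_divide_distrib sum_negf)
  qed
  define V where "V = mat p n (\<lambda>(k, i). v k $ i)"
  have V: "V \<in> carrier_mat p n" by (simp add: V_def)
  have Vx: "(V *\<^sub>v x) $ k = v k \<bullet> x" if "k < p" "x \<in> carrier_vec n" for k x
    using that by (auto simp: V_def scalar_prod_def)
  define M where "M = mat p p (\<lambda>(k, j). if Suc k < p then (if j = Suc k then 1 else 0) else - c j / c p)"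
  have M: "M \<in> carrier_mat p p" by (simp add: M_def)
  have VM: "V *\<^sub>v (A *\<^sub>v x + B *\<^sub>v u) = M *\<^sub>v (V *\<^sub>v x)"
    if x: "x \<in> carrier_vec n" and u: "u \<in> carrier_vec m" for x u
  proof (rule eq_vecI)
    fix k assume "k < dim_vec (M *\<^sub>v (V *\<^sub>v x))"
    then have k: "k < p" using M by simp
    have Ax: "A *\<^sub>v x \<in> carrier_vec n" "B *\<^sub>v u \<in> carrier_vec n" using A B x u by auto
    have "v k \<bullet> (A *\<^sub>v x) = v (Suc k) \<bullet> x"
      using transpose_vec_mult_scalar[OF A x v[of k]] by (simp add: vSuc)
    moreover have "v k \<bullet> (B *\<^sub>v u) = 0"
      using transpose_vec_mult_scalar[OF B u v[of k]] orth[of k] k p(1) u by (simp add: v_def)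
    ultimately have "(V *\<^sub>v (A *\<^sub>v x + B *\<^sub>v u)) $ k = v (Suc k) \<bullet> x"
      using Ax k Vx[OF k add_carrier_vec[OF Ax]] by (simp add: scalar_prod_add_distrib[OF v])
    also have "\<dots> = (\<Sum>j = 0..<p. M $$ (k, j) * (v j \<bullet> x))"
    proof (cases "Suc k < p")
      case True
      then have "(\<Sum>j = 0..<p. M $$ (k, j) * (v j \<bullet> x))
          = (\<Sum>j = 0..<p. if j = Suc k then v j \<bullet> x else 0)"
        using k by (intro sum.cong) (auto simp: M_def)
      then show ?thesis using True by simp
    next
      case False
      then have Sk: "Suc k = p" using k by simp
      have "(\<Sum>j = 0..<p. M $$ (k, j) * (v j \<bullet> x))
          = (\<Sum>j = 0..<p. \<Sum>i = 0..<n. (- c j / c p) * v j $ i * x $ i)"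
      proof (rule sum.cong[OF refl])
        fix j assume "j \<in> {0..<p}"
        then have "M $$ (k, j) = - c j / c p" using k False by (simp add: M_def)
        moreover have "v j \<bullet> x = (\<Sum>i = 0..<n. v j $ i * x $ i)" using x by (simp add: scalar_prod_def)
        ultimately show "M $$ (k, j) * (v j \<bullet> x) = (\<Sum>i = 0..<n. (- c j / c p) * v j $ i * x $ i)"
          by (simp only: sum_distrib_left mult.assoc)
      qed
      also have "\<dots> = (\<Sum>i = 0..<n. (\<Sum>j = 0..<p. (- c j / c p) * v j $ i) * x $ i)"
        by (subst sum.swap) (simp only: sum_distrib_right)
      also have "\<dots> = (\<Sum>i = 0..<n. v p $ i * x $ i)"
        by (rule sum.cong) (simp_all add: vp)
      also have "\<dots> = v (Suc k) \<bullet> x" using x Sk by (simp add: scalar_prod_def)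
      finally show ?thesis by simp
    qed
    also have "\<dots> = (M *\<^sub>v (V *\<^sub>v x)) $ k"
    proof -
      have "(M *\<^sub>v (V *\<^sub>v x)) $ k = (\<Sum>j = 0..<p. M $$ (k, j) * (V *\<^sub>v x) $ j)"
        using M V k by (simp add: scalar_prod_def)
      also have "\<dots> = (\<Sum>j = 0..<p. M $$ (k, j) * (v j \<bullet> x))"
        by (rule sum.cong) (simp_all add: Vx x del: index_mult_mat_vec)
      finally show ?thesis by simp
    qed
    finally show "(V *\<^sub>v (A *\<^sub>v x + B *\<^sub>v u)) $ k = (M *\<^sub>v (V *\<^sub>v x)) $ k" .
  qed (use M V in simp)
  from bspec[OF bspec[OF ctrl[unfolded controllable_def] zero_carrier_vec] w]
  obtain \<tau> u x where \<tau>: "0 < \<tau>"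
    and ux: "\<forall>t\<in>{0..\<tau>}. u t \<in> carrier_vec m \<and> x t \<in> carrier_vec n"
    and dx: "\<forall>t\<in>{0..\<tau>}. \<forall>i<n.
      ((\<lambda>s. x s $ i) has_vector_derivative (A *\<^sub>v x t + B *\<^sub>v u t) $ i) (at t within {0..\<tau>})"
    and x0: "x 0 = 0\<^sub>v n" and x\<tau>: "x \<tau> = w"
    by (elim exE conjE) (rule that)
  have "V *\<^sub>v x \<tau> = 0\<^sub>v p"
  proof (rule linear_ode_zero[OF M, where z = "\<lambda>t. V *\<^sub>v x t" and a = 0 and b = \<tau> and ?t0.0 = 0])
    fix t assume t: "t \<in> {0..\<tau>}"
    have uxt: "u t \<in> carrier_vec m" "x t \<in> carrier_vec n" using ux t by blast+
    then have "A *\<^sub>v x t + B *\<^sub>v u t \<in> carrier_vec n"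
      by (intro add_carrier_vec mult_mat_vec_carrier[OF A] mult_mat_vec_carrier[OF B])
    with ux dx t have "has_vec_derivative n x (A *\<^sub>v x t + B *\<^sub>v u t) t {0..\<tau>}"
      unfolding has_vec_derivative_def by blast
    from has_vec_derivative_mult[OF V this t]
    show "has_vec_derivative p (\<lambda>t. V *\<^sub>v x t) (M *\<^sub>v (V *\<^sub>v x t)) t {0..\<tau>}"
      by (simp only: VM[OF uxt(2,1)])
  qed (use \<tau> x0 V in auto)
  then have z: "(V *\<^sub>v w) $ k = 0" if "k < p" for k using that by (simp only: x\<tau> index_zero_vec)
  show ?thesis
  proof (cases "p = 0")
    case True
    then show ?thesis using vp v0 w by (intro eq_vecI) auto
  next
    case False
    then have "w \<bullet> w = 0" using z[of 0] Vx[of 0 w] v0 w by simp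
    then show ?thesis by (rule scalar_prod_self_eq_0[OF w])
  qed
qed

text \<open>The hypothesis says \<open>B\<^sup>T lyap\<^sup>k Y = 0\<close> for \<open>k < n\<close>. Since \<open>A\<^sup>T X = - lyap X - X A\<close>, powers of
  \<open>lyap\<close> can be traded for powers of \<open>A\<^sup>T\<close> one at a time.\<close>

lemma BA_block_inj:
  assumes A: "A \<in> carrier_mat n n" and B: "B \<in> carrier_mat n m" and ctrl: "controllable n m A B"
    and Y: "Y \<in> carrier_mat n n"
    and zero: "\<And>k. k < n \<Longrightarrow> BA_block A B k *\<^sub>v vec_stack Y = 0\<^sub>v (n * m)"
  shows "Y = 0\<^sub>m n n"
proof -
  let ?At = "transpose_mat A"
  have At: "?At \<in> carrier_mat n n" and Bt: "transpose_mat B \<in> carrier_mat m n" using A B by auto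
  define X where "X j = (lyap A ^^ j) Y" for j
  have X: "X j \<in> carrier_mat n n" for j unfolding X_def by (rule lyap_pow_carrier[OF A Y])
  have XSuc: "X (Suc j) = - (?At * X j) - X j * A" for j by (simp add: X_def lyap_def)
  define C where "C k = transpose_mat B * ?At ^\<^sub>m k" for k
  have C: "C k \<in> carrier_mat m n" for k
    unfolding C_def by (rule mult_carrier_mat[OF Bt pow_carrier_mat[OF At]])
  have CX: "C k * X j = 0\<^sub>m m n" if "j + k < n" for k j
    using that
  proof (induction k arbitrary: j)
    case 0
    have "C 0 = transpose_mat B" using A B by (simp add: C_def)
    moreover have "vec_stack (transpose_mat B * X j) = vec_stack (0\<^sub>m m n)"
      using zero[of j] 0 unfolding BA_block_mult_vec_stack[OF A B Y] X_def
      by (simp add: vec_stack_zero mult.commute)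
    ultimately show ?case
      using vec_stack_inject[OF mult_carrier_mat[OF Bt X] zero_carrier_mat] by simp
  next
    case (Suc k)
    have "C (Suc k) * X j = C k * (?At * X j)"
    proof -
      have "C (Suc k) = C k * ?At"
        unfolding C_def using assoc_mult_mat[OF Bt pow_carrier_mat[OF At] At, of k] by simp
      then show ?thesis by (simp only: assoc_mult_mat[OF C At X])
    qed
    also have "?At * X j = - X (Suc j) - X j * A"
      by (rule eq_matI) (use At X[of j] A in \<open>auto simp: XSuc\<close>)
    also have "C k * (- X (Suc j) - X j * A) = C k * - X (Suc j) - C k * (X j * A)"
      by (rule mult_minus_distrib_mat[OF C uminus_carrier_mat[OF X] mult_carrier_mat[OF X A]])
    also have "\<dots> = - (C k * X (Suc j)) - C k * X j * A"
      using X[of "Suc j"] C[of k] by (simp add: assoc_mult_mat[OF C X A])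
    also have "\<dots> = - 0\<^sub>m m n - 0\<^sub>m m n * A"
      using Suc.IH[of "Suc j"] Suc.IH[of j] Suc.prems by simp
    also have "\<dots> = 0\<^sub>m m n" by (rule eq_matI) (use A in auto)
    finally show ?case .
  qed
  have col: "col Y i = 0\<^sub>v n" if "i < n" for i
  proof (rule controllable_observable[OF A B ctrl])
    show "col Y i \<in> carrier_vec n" using Y by (metis carrier_matD(1) col_dim)
    fix k assume "k < n"
    have "transpose_mat B *\<^sub>v (?At ^\<^sub>m k *\<^sub>v col Y i) = C k *\<^sub>v col Y i"
      unfolding C_def
      by (rule assoc_mult_mat_vec[OF Bt pow_carrier_mat[OF At], symmetric]) fact
    also have "\<dots> = col (C k * Y) i" by (rule col_mult2[OF C Y that, symmetric])
    also have "C k * Y = 0\<^sub>m m n" using CX[of 0 k] \<open>k < n\<close> by (simp add: X_def)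
    finally show "transpose_mat B *\<^sub>v (?At ^\<^sub>m k *\<^sub>v col Y i) = 0\<^sub>v m" using that by simp
  qed
  show ?thesis
  proof (rule mat_col_eqI)
    fix i assume "i < dim_col (0\<^sub>m n n :: real mat)"
    then show "col Y i = col (0\<^sub>m n n) i" using col by simp
  qed (use Y in auto)
qed

lemma stack_vec_index:
  "k < n \<Longrightarrow> l < h \<Longrightarrow> stack_vec n h F $ (k * h + l) = F k $ l"
  using pair_index_less[of l h k n] by (simp add: stack_vec_def mult.commute)

lemma stack_vec_block_eq:
  assumes eq: "stack_vec n h F = stack_vec n h F'" and k: "k < n"
    and "F k \<in> carrier_vec h" "F' k \<in> carrier_vec h"
  shows "F k = F' k"
proof (rule eq_vecI)
  fix l assume "l < dim_vec (F' k)"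
  then have "l < h" using assms(4) by simp
  then show "F k $ l = F' k $ l"
    using stack_vec_index[OF k, of l h F] stack_vec_index[OF k, of l h F'] eq by simp
qed (use assms in auto)

lemma stack_vec_cong:
  assumes "\<And>k. k < n \<Longrightarrow> F k = F' k"
  shows "stack_vec n h F = stack_vec n h F'"
  unfolding stack_vec_def
proof (rule eq_vecI)
  fix i assume "i < dim_vec (vec (n * h) (\<lambda>i. F' (i div h) $ (i mod h)))"
  then have i: "i < h * n" by (simp add: mult.commute)
  then show "vec (n * h) (\<lambda>i. F (i div h) $ (i mod h)) $ i = vec (n * h) (\<lambda>i. F' (i div h) $ (i mod h)) $ i"
    using assms[OF div_mod_less(2)[OF i]] by (simp add: mult.commute)
qed simp

lemma stack_vec_zero: "stack_vec n h (\<lambda>_. 0\<^sub>v h) = 0\<^sub>v (n * h)"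
proof (rule eq_vecI)
  fix i assume "i < dim_vec (0\<^sub>v (n * h) :: real vec)"
  then have i: "i < h * n" by (simp add: mult.commute)
  then show "stack_vec n h (\<lambda>_. 0\<^sub>v h) $ i = 0\<^sub>v (n * h) $ i"
    using div_mod_less(1)[OF i] by (simp add: stack_vec_def mult.commute)
qed (simp add: stack_vec_def)

lemma stack_vec_add:
  assumes "\<And>k. k < n \<Longrightarrow> F k \<in> carrier_vec h" "\<And>k. k < n \<Longrightarrow> F' k \<in> carrier_vec h"
  shows "stack_vec n h F + stack_vec n h F' = stack_vec n h (\<lambda>k. F k + F' k)"
proof (rule eq_vecI)
  fix i assume "i < dim_vec (stack_vec n h (\<lambda>k. F k + F' k))"
  then have i: "i < h * n" by (simp add: stack_vec_def mult.commute)
  note i' = div_mod_less[OF i]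
  show "(stack_vec n h F + stack_vec n h F') $ i = stack_vec n h (\<lambda>k. F k + F' k) $ i"
    using i i' assms[OF i'(2)] by (simp add: stack_vec_def mult.commute)
qed (simp add: stack_vec_def)

lemma stack_mat_carrier: "stack_mat n h nc F \<in> carrier_mat (n * h) nc"
  by (simp add: stack_mat_def)

lemma stack_mat_mult_vec:
  assumes F: "\<And>k. k < n \<Longrightarrow> F k \<in> carrier_mat h nc" and x: "x \<in> carrier_vec nc"
  shows "stack_mat n h nc F *\<^sub>v x = stack_vec n h (\<lambda>k. F k *\<^sub>v x)"
proof (rule eq_vecI)
  fix i assume "i < dim_vec (stack_vec n h (\<lambda>k. F k *\<^sub>v x))"
  then have i: "i < h * n" by (simp add: stack_vec_def mult.commute)
  note i' = div_mod_less[OF i]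
  have "(stack_mat n h nc F *\<^sub>v x) $ i = (\<Sum>j = 0..<nc. F (i div h) $$ (i mod h, j) * x $ j)"
    using i x by (simp add: stack_mat_def scalar_prod_def mult.commute)
  also have "\<dots> = stack_vec n h (\<lambda>k. F k *\<^sub>v x) $ i"
    using i i' F[OF i'(2)] x by (simp add: stack_vec_def scalar_prod_def mult.commute)
  finally show "(stack_mat n h nc F *\<^sub>v x) $ i = stack_vec n h (\<lambda>k. F k *\<^sub>v x) $ i" .
qed (simp add: stack_mat_def stack_vec_def)

lemma H_of_carrier:
  "A \<in> carrier_mat n n \<Longrightarrow> B \<in> carrier_mat n m \<Longrightarrow> H_of A B \<in> carrier_mat (n * (n * m)) (n * n)"
  by (auto simp: H_of_def stack_mat_carrier)

lemma N_of_carrier: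
  "A \<in> carrier_mat n n \<Longrightarrow> B \<in> carrier_mat n m \<Longrightarrow> N_of A B \<in> carrier_mat (n * (n * m)) (n * n)"
  by (auto simp: N_of_def Let_def stack_mat_carrier)

lemma H_of_mult_vec:
  assumes A: "A \<in> carrier_mat n n" and B: "B \<in> carrier_mat n m" and x: "x \<in> carrier_vec (n * n)"
  shows "H_of A B *\<^sub>v x = stack_vec n (n * m) (\<lambda>k. BA_block A B k *\<^sub>v x)"
proof -
  have "H_of A B = stack_mat n (n * m) (n * n) (BA_block A B)" using A B by (simp add: H_of_def)
  then show ?thesis using stack_mat_mult_vec[OF BA_block_carrier[OF A B] x] by simp
qed

lemma N_of_mult_vec:
  assumes A: "A \<in> carrier_mat n n" and B: "B \<in> carrier_mat n m" and x: "x \<in> carrier_vec (n * n)"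
  shows "N_of A B *\<^sub>v x
    = stack_vec n (n * m) (\<lambda>k. if k = 0 then 0\<^sub>v (n * m) else - (BA_block A B (k - 1) *\<^sub>v x))"
proof -
  define F where "F k = (if k = 0 then 0\<^sub>m (n * m) (n * n) else - BA_block A B (k - 1))" for k
  have F: "F k \<in> carrier_mat (n * m) (n * n)" for k using BA_block_carrier[OF A B] by (simp add: F_def)
  have "N_of A B = stack_mat n (n * m) (n * n) F"
    using A B by (simp add: N_of_def Let_def F_def[abs_def])
  then have "N_of A B *\<^sub>v x = stack_vec n (n * m) (\<lambda>k. F k *\<^sub>v x)"
    using stack_mat_mult_vec[OF F x] by simp
  also have "\<dots> = stack_vec n (n * m) (\<lambda>k. if k = 0 then 0\<^sub>v (n * m) else - (BA_block A B (k - 1) *\<^sub>v x))"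
  proof (rule stack_vec_cong)
    fix k
    have "dim_vec x = dim_col (BA_block A B (k - 1))"
      using x BA_block_carrier[OF A B, of "k - 1"] by simp
    moreover have "0\<^sub>m (n * m) (n * n) *\<^sub>v x = 0\<^sub>v (n * m)" using x by auto
    ultimately show "F k *\<^sub>v x = (if k = 0 then 0\<^sub>v (n * m) else - (BA_block A B (k - 1) *\<^sub>v x))"
      by (simp add: F_def)
  qed
  finally show ?thesis .
qed

lemma H_inv_inverts:
  assumes A: "A \<in> carrier_mat n n" and B: "B \<in> carrier_mat n 1" and ctrl: "controllable n 1 A B"
  shows "H_of A B * H_inv A B = 1\<^sub>m (n * n)" "H_inv A B * H_of A B = 1\<^sub>m (n * n)"
    "H_inv A B \<in> carrier_mat (n * n) (n * n)"
proof -
  have H: "H_of A B \<in> carrier_mat (n * n) (n * n)" using H_of_carrier[OF A B] by simp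
  have "det (H_of A B) \<noteq> 0"
  proof
    assume "det (H_of A B) = 0"
    then obtain y where y: "y \<in> carrier_vec (n * n)" "y \<noteq> 0\<^sub>v (n * n)"
        and Hy: "H_of A B *\<^sub>v y = 0\<^sub>v (n * n)"
      using det_0_iff_vec_prod_zero_field[OF H] by blast
    define Y where "Y = mat_unstack n y"
    have Y: "Y \<in> carrier_mat n n" by (simp add: Y_def mat_unstack_carrier)
    have vY: "vec_stack Y = y" unfolding Y_def by (rule vec_stack_unstack[OF y(1)])
    have "stack_vec n (n * 1) (\<lambda>k. BA_block A B k *\<^sub>v y) = stack_vec n (n * 1) (\<lambda>_. 0\<^sub>v (n * 1))"
      using Hy unfolding H_of_mult_vec[OF A B y(1)] stack_vec_zero by simp
    then have "BA_block A B k *\<^sub>v vec_stack Y = 0\<^sub>v (n * 1)" if "k < n" for k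
      unfolding vY using that
      by (rule stack_vec_block_eq) (simp_all only: mult_mat_vec_carrier[OF BA_block_carrier[OF A B] y(1)] zero_carrier_vec)
    then have "Y = 0\<^sub>m n n" by (rule BA_block_inj[OF A B ctrl Y])
    then have "y = 0\<^sub>v (n * n)" using vY vec_stack_zero by simp
    with y(2) show False ..
  qed
  then have "H_of A B \<in> Units (ring_mat TYPE(real) (n * n) ())"
    by (rule det_non_zero_imp_unit[OF H])
  then obtain Z where Z: "mat_inverse (H_of A B) = Some Z"
    using mat_inverse(1)[OF H, where b = "()"] by (cases "mat_inverse (H_of A B)") auto
  then show "H_of A B * H_inv A B = 1\<^sub>m (n * n)" "H_inv A B * H_of A B = 1\<^sub>m (n * n)"
    "H_inv A B \<in> carrier_mat (n * n) (n * n)"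
    using mat_inverse(2)[OF H Z] by (auto simp: H_inv_def)
qed

section \<open>The constrained Lyapunov equation\<close>

lemma uminus_finsum_vec_index:
  assumes "finite I" "\<And>i. i \<in> I \<Longrightarrow> x i \<in> carrier_vec n" "l < n"
  shows "(- finsum_vec TYPE(real) n x I) $ l = - (\<Sum>i\<in>I. x i $ l)"
proof -
  have c: "x \<in> I \<rightarrow> carrier_vec n" using assms(2) by auto
  have "finsum_vec TYPE(real) n x I \<in> carrier_vec n" by (rule finsum_vec_closed[OF c])
  then show ?thesis using index_finsum_vec[OF assms(1,3) c] assms(3) by simp
qed

locale lyapunov_constraint =
  fixes n :: nat and T :: real and A B :: "real mat" and G :: "real \<Rightarrow> real mat"
  assumes A: "A \<in> carrier_mat n n" and B: "B \<in> carrier_mat n 1"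
    and ctrl: "controllable n 1 A B" and T: "0 < T"
    and G_Ck: "mat_Ck (n - 1) {0..T} G n n"
begin

abbreviation "S \<equiv> {0..T}"
abbreviation "BA \<equiv> BA_block A B"
abbreviation "H \<equiv> H_of A B"
abbreviation "Hi \<equiv> H_inv A B"
abbreviation "N \<equiv> N_of A B"
abbreviation "AQ \<equiv> AQ_of A B"
abbreviation "At \<equiv> transpose_mat (Atil A)"
abbreviation "f \<equiv> f_of S A B G"

definition g :: "nat \<Rightarrow> real \<Rightarrow> real vec" where
  "g i t = vec_stack ((mat_deriv S ^^ i) G t)"

definition f_block :: "nat \<Rightarrow> real \<Rightarrow> real vec" where
  "f_block k t = - finsum_vec TYPE(real) n (\<lambda>i. BA (k - 1 - i) *\<^sub>v g i t) {..<k}"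

definition f_block' :: "nat \<Rightarrow> real \<Rightarrow> real vec" where
  "f_block' k t = - finsum_vec TYPE(real) n (\<lambda>i. BA (k - 1 - i) *\<^sub>v g (Suc i) t) {..<k}"

definition N_block :: "nat \<Rightarrow> real vec \<Rightarrow> real vec" where
  "N_block k q = (if k = 0 then 0\<^sub>v n else - (BA (k - 1) *\<^sub>v q))"

lemma BA: "BA k \<in> carrier_mat n (n * n)"
  using BA_block_carrier[OF A B] by simp

lemma H: "H \<in> carrier_mat (n * n) (n * n)"
  using H_of_carrier[OF A B] by simp

lemma N: "N \<in> carrier_mat (n * n) (n * n)"
  using N_of_carrier[OF A B] by simp

lemma At: "At \<in> carrier_mat (n * n) (n * n)"
  using Atil_carrier[OF A] by simp

lemmas Hi = H_inv_inverts[OF A B ctrl]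

lemma H_inj:
  assumes "x \<in> carrier_vec (n * n)" "y \<in> carrier_vec (n * n)" "H *\<^sub>v x = H *\<^sub>v y"
  shows "x = y"
proof -
  have "Hi *\<^sub>v (H *\<^sub>v z) = z" if "z \<in> carrier_vec (n * n)" for z
    using assoc_mult_mat_vec[OF Hi(3) H that] Hi(2) that by simp
  then show ?thesis using assms by metis
qed

lemma G_carrier: "t \<in> S \<Longrightarrow> G t \<in> carrier_mat n n"
  by (rule mat_Ck_carrier[OF G_Ck])

lemma g_carrier:
  assumes "t \<in> S"
  shows "g i t \<in> carrier_vec (n * n)"
  unfolding g_def using G_carrier[OF assms] by (intro vec_stack_carrier carrier_matI) auto

lemma g_0: "g 0 t = vec_stack (G t)"
  by (simp add: g_def)

lemma g_derivative:
  assumes t: "t \<in> S" and i: "Suc i < n"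
  shows "has_vec_derivative (n * n) (g i) (g (Suc i) t) t S"
proof -
  have c: "(mat_deriv S ^^ j) G s \<in> carrier_mat n n" if "s \<in> S" for s j
    using G_carrier[OF that] by (intro carrier_matI) auto
  have "has_mat_derivative ((mat_deriv S ^^ i) G) ((mat_deriv S ^^ Suc i) G t) t S"
    using G_Ck t i unfolding mat_Ck_def by auto
  from has_vec_derivative_vec_stack[THEN iffD2, OF c c[OF t] t this]
  show ?thesis unfolding g_def[abs_def] .
qed

lemma f_eq: "f t = stack_vec n n (\<lambda>k. f_block k t)"
  using A B by (simp add: f_of_def f_block_def g_def)

lemma f_carrier: "f t \<in> carrier_vec (n * n)"
  unfolding f_eq by (rule stack_vec_carrier)

lemma BA_g_carrier: "t \<in> S \<Longrightarrow> BA k *\<^sub>v g i t \<in> carrier_vec n"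
  by (rule mult_mat_vec_carrier[OF BA g_carrier])

lemma f_block_carrier: "t \<in> S \<Longrightarrow> f_block k t \<in> carrier_vec n"
  "t \<in> S \<Longrightarrow> f_block' k t \<in> carrier_vec n"
  unfolding f_block_def f_block'_def uminus_carrier_vec
  using BA_g_carrier by (auto intro!: finsum_vec_closed)

lemma N_block_carrier: "q \<in> carrier_vec (n * n) \<Longrightarrow> N_block k q \<in> carrier_vec n"
  using mult_mat_vec_carrier[OF BA] by (simp add: N_block_def)

lemma f_block_0: "f_block 0 t = 0\<^sub>v n"
  by (auto simp: f_block_def finsum_vec_empty)

lemma f_block_Suc:
  assumes t: "t \<in> S"
  shows "f_block (Suc k) t = f_block' k t - BA k *\<^sub>v g 0 t"
proof (rule eq_vecI)
  note c = BA_g_carrier[OF t]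
  fix l assume "l < dim_vec (f_block' k t - BA k *\<^sub>v g 0 t)"
  then have l: "l < n" using carrier_vecD[OF c] by simp
  have "f_block (Suc k) t $ l = - (\<Sum>i<Suc k. (BA (Suc k - 1 - i) *\<^sub>v g i t) $ l)"
    unfolding f_block_def by (rule uminus_finsum_vec_index) (use c l in auto)
  also have "\<dots> = - (BA k *\<^sub>v g 0 t) $ l - (\<Sum>i<k. (BA (k - 1 - i) *\<^sub>v g (Suc i) t) $ l)"
    by (subst sum.lessThan_Suc_shift) simp
  also have "(\<Sum>i<k. (BA (k - 1 - i) *\<^sub>v g (Suc i) t) $ l) = - (f_block' k t $ l)"
    unfolding f_block'_def by (subst uminus_finsum_vec_index) (use c l in auto)
  also have "- (BA k *\<^sub>v g 0 t) $ l - - (f_block' k t $ l) = (f_block' k t - BA k *\<^sub>v g 0 t) $ l"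
    using l carrier_vecD[OF c] by (simp del: index_mult_mat_vec)
  finally show "f_block (Suc k) t $ l = (f_block' k t - BA k *\<^sub>v g 0 t) $ l" .
qed (use carrier_vecD[OF f_block_carrier(1)[OF t]] carrier_vecD[OF BA_g_carrier[OF t]] in simp)

lemma f_block_derivative:
  assumes t: "t \<in> S" and k: "k < n"
  shows "has_vec_derivative n (f_block k) (f_block' k t) t S"
  unfolding f_block_def[abs_def] f_block'_def
proof (intro has_vec_derivative_uminus has_vec_derivative_finsum_vec t)
  fix i assume "i \<in> {..<k}"
  then have "Suc i < n" using k by simp
  from has_vec_derivative_mult[OF BA g_derivative[OF t this] t]
  show "has_vec_derivative n (\<lambda>s. BA (k - 1 - i) *\<^sub>v g i s) (BA (k - 1 - i) *\<^sub>v g (Suc i) t) t S" .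
qed simp

definition f' :: "real \<Rightarrow> real vec" where
  "f' t = stack_vec n n (\<lambda>k. f_block' k t)"

lemma f_derivative:
  assumes "t \<in> S"
  shows "has_vec_derivative (n * n) f (f' t) t S"
  unfolding f_eq[abs_def] f'_def
  by (rule has_vec_derivative_stack_vec[OF f_block_derivative[OF assms] assms])

lemma f'_carrier: "f' t \<in> carrier_vec (n * n)"
  unfolding f'_def by (rule stack_vec_carrier)

lemma BQ_eq:
  assumes "t \<in> S"
  shows "BQ_of S A B G t = - ((H * At * Hi) *\<^sub>v f t) + f' t - H *\<^sub>v g 0 t"
  unfolding BQ_of_def g_0 vec_deriv_eqI[OF T assms f_derivative[OF assms]] ..

lemma AQ_carrier: "AQ \<in> carrier_mat (n * n) (n * n)"
  unfolding AQ_of_def using H by simp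

lemma stacked_sum:
  assumes y: "y \<in> carrier_vec (n * n)" and q: "q \<in> carrier_vec (n * n)" and t: "t \<in> S"
  shows "H *\<^sub>v y + N *\<^sub>v q + f t = stack_vec n n (\<lambda>k. BA k *\<^sub>v y + N_block k q + f_block k t)"
proof -
  have "H *\<^sub>v y + N *\<^sub>v q + f t = stack_vec n n (\<lambda>k. BA k *\<^sub>v y)
      + stack_vec n n (\<lambda>k. N_block k q) + stack_vec n n (\<lambda>k. f_block k t)"
    using H_of_mult_vec[OF A B y] N_of_mult_vec[OF A B q] unfolding mult_1_right f_eq N_block_def by simp
  also have "\<dots> = stack_vec n n (\<lambda>k. BA k *\<^sub>v y + N_block k q) + stack_vec n n (\<lambda>k. f_block k t)"
    using mult_mat_vec_carrier[OF BA y] N_block_carrier[OF q] by (subst stack_vec_add) simp_all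
  also have "\<dots> = stack_vec n n (\<lambda>k. BA k *\<^sub>v y + N_block k q + f_block k t)"
    using mult_mat_vec_carrier[OF BA y] N_block_carrier[OF q] f_block_carrier(1)[OF t]
    by (subst stack_vec_add) simp_all
  finally show ?thesis .
qed

text \<open>Since \<open>Hi H = 1\<close>, the constraint \<open>H y + N q + f = 0\<close> turns \<open>H At y\<close> into
  \<open>- H At Hi (N q + f)\<close>.\<close>

lemma residual_eq:
  assumes y: "y \<in> carrier_vec (n * n)" and q: "q \<in> carrier_vec (n * n)" and t: "t \<in> S"
    and eq: "H *\<^sub>v y + N *\<^sub>v q + f t = 0\<^sub>v (n * n)"
  shows "H *\<^sub>v (At *\<^sub>v y - q - g 0 t) + f' t = BQ_of S A B G t - AQ *\<^sub>v q"
proof -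
  define P where "P = H * At * Hi"
  have P: "P \<in> carrier_mat (n * n) (n * n)" unfolding P_def using H At Hi(3) by (intro mult_carrier_mat)
  have Hy: "H *\<^sub>v y \<in> carrier_vec (n * n)" and Nq: "N *\<^sub>v q \<in> carrier_vec (n * n)"
    and Hq: "H *\<^sub>v q \<in> carrier_vec (n * n)" and Hg: "H *\<^sub>v g 0 t \<in> carrier_vec (n * n)"
    and Ay: "At *\<^sub>v y \<in> carrier_vec (n * n)"
    using mult_mat_vec_carrier H N At y q g_carrier[OF t] by blast+
  note PNq = mult_mat_vec_carrier[OF P Nq] and Pf = mult_mat_vec_carrier[OF P f_carrier[of t]]
  have "H *\<^sub>v (At *\<^sub>v y) = (H * At) *\<^sub>v (Hi *\<^sub>v (H *\<^sub>v y))"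
    using assoc_mult_mat_vec[OF Hi(3) H y] Hi(2) y assoc_mult_mat_vec[OF H At y] by simp
  also have "\<dots> = P *\<^sub>v (H *\<^sub>v y)"
    unfolding P_def by (rule assoc_mult_mat_vec[OF mult_carrier_mat[OF H At] Hi(3) Hy, symmetric])
  also have "H *\<^sub>v y = - (N *\<^sub>v q + f t)"
    using eq sum3_eq_0_iff[OF Hy Nq f_carrier] by blast
  also have "P *\<^sub>v - (N *\<^sub>v q + f t) = - (P *\<^sub>v (N *\<^sub>v q) + P *\<^sub>v f t)"
    using P Nq f_carrier[of t] mult_add_distrib_mat_vec[OF P Nq f_carrier, of t]
    by (simp add: mult_mat_vec_uminus)
  finally have HAy: "H *\<^sub>v (At *\<^sub>v y) = - (P *\<^sub>v (N *\<^sub>v q) + P *\<^sub>v f t)" .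
  have AQq: "AQ *\<^sub>v q = P *\<^sub>v (N *\<^sub>v q) + H *\<^sub>v q"
    unfolding AQ_of_def P_def[symmetric]
    using add_mult_distrib_mat_vec[OF mult_carrier_mat[OF P N] H q] assoc_mult_mat_vec[OF P N q] by simp
  have L: "H *\<^sub>v (At *\<^sub>v y - q - g 0 t) = H *\<^sub>v (At *\<^sub>v y) - H *\<^sub>v q - H *\<^sub>v g 0 t"
    using mult_minus_distrib_mat_vec[OF H minus_carrier_vec[OF Ay q] g_carrier[OF t]]
      mult_minus_distrib_mat_vec[OF H Ay q] by simp
  have arith: "- (a + b) - c - e + h = - b + h - e - (a + c)"
    if "a \<in> carrier_vec (n * n)" "b \<in> carrier_vec (n * n)" "c \<in> carrier_vec (n * n)"
      "e \<in> carrier_vec (n * n)" "h \<in> carrier_vec (n * n)" for a b c e h :: "real vec"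
    by (rule eq_vecI) (use that in auto)
  show ?thesis
    unfolding L HAy AQq BQ_eq[OF t] P_def[symmetric]
    using arith[OF PNq Pf Hq Hg f'_carrier] .
qed

lemma BQ_carrier:
  assumes "t \<in> S"
  shows "BQ_of S A B G t \<in> carrier_vec (n * n)"
  unfolding BQ_eq[OF assms]
  by (rule minus_carrier_vec[OF _ mult_mat_vec_carrier[OF H g_carrier[OF assms]]])
     (simp only: add_carrier_vec f'_carrier uminus_carrier_vec
        mult_mat_vec_carrier[OF mult_carrier_mat[OF mult_carrier_mat[OF H At] Hi(3)] f_carrier])

lemma residual_zero_iff:
  assumes y: "y \<in> carrier_vec (n * n)" and q: "q \<in> carrier_vec (n * n)" and t: "t \<in> S"
    and eq: "H *\<^sub>v y + N *\<^sub>v q + f t = 0\<^sub>v (n * n)"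
  shows "H *\<^sub>v (At *\<^sub>v y - q - g 0 t) + f' t = 0\<^sub>v (n * n) \<longleftrightarrow> AQ *\<^sub>v q = BQ_of S A B G t"
proof -
  have "AQ *\<^sub>v q \<in> carrier_vec (n * n)" by (rule mult_mat_vec_carrier[OF AQ_carrier q])
  moreover have "BQ_of S A B G t \<in> carrier_vec (n * n)" by (rule BQ_carrier[OF t])
  ultimately show ?thesis
    unfolding residual_eq[OF assms] using minus_vec_eq_0_iff[of "BQ_of S A B G t" "n * n" "AQ *\<^sub>v q"] by auto
qed

lemma constraint_derivatives:
  assumes q: "q \<in> carrier_vec (n * n)"
    and y: "\<And>t. t \<in> S \<Longrightarrow> has_vec_derivative (n * n) y (At *\<^sub>v y t - q - g 0 t) t S"
    and y0: "\<And>t. t \<in> S \<Longrightarrow> BA 0 *\<^sub>v y t = 0\<^sub>v n"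
    and t: "t \<in> S" and k: "k < n"
  shows "BA k *\<^sub>v y t + N_block k q + f_block k t = 0\<^sub>v n"
  using k t
proof (induction k arbitrary: t)
  case 0
  then show ?case using y0[of t] by (simp add: N_block_def f_block_0)
next
  case (Suc k)
  have t: "t \<in> S" and k: "k < n" using Suc.prems by auto
  have yc: "y t \<in> carrier_vec (n * n)" using y[OF t] t by (simp add: has_vec_derivative_def)
  have Ay: "At *\<^sub>v y t \<in> carrier_vec (n * n)" by (rule mult_mat_vec_carrier[OF At yc])
  let ?y' = "At *\<^sub>v y t - q - g 0 t"
  have "has_vec_derivative n (\<lambda>t. BA k *\<^sub>v y t + N_block k q + f_block k t)
      (BA k *\<^sub>v ?y' + 0\<^sub>v n + f_block' k t) t S"
    by (intro has_vec_derivative_add has_vec_derivative_mult[OF BA] y[OF t] t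
        has_vec_derivative_const N_block_carrier q f_block_derivative k)
  then have "has_vec_derivative n (\<lambda>_. 0\<^sub>v n) (BA k *\<^sub>v ?y' + 0\<^sub>v n + f_block' k t) t S"
    by (rule has_vec_derivative_cong[OF _ t]) (use Suc.IH k in auto)
  then have "BA k *\<^sub>v ?y' + 0\<^sub>v n + f_block' k t = 0\<^sub>v n"
    by (rule has_vec_derivative_unique[OF T t _ has_vec_derivative_const[OF zero_carrier_vec]])
  moreover have "BA k *\<^sub>v ?y' = BA (Suc k) *\<^sub>v y t - BA k *\<^sub>v q - BA k *\<^sub>v g 0 t"
    using mult_minus_distrib_mat_vec[OF BA minus_carrier_vec[OF Ay q] g_carrier[OF t]]
      mult_minus_distrib_mat_vec[OF BA Ay q] BA_block_Suc[OF A B yc] by simp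
  ultimately have eq: "BA (Suc k) *\<^sub>v y t - BA k *\<^sub>v q - BA k *\<^sub>v g 0 t + 0\<^sub>v n + f_block' k t = 0\<^sub>v n"
    by simp
  have c: "BA (Suc k) *\<^sub>v y t \<in> carrier_vec n" "BA k *\<^sub>v q \<in> carrier_vec n"
    "BA k *\<^sub>v g 0 t \<in> carrier_vec n" "f_block' k t \<in> carrier_vec n"
    using mult_mat_vec_carrier[OF BA yc] mult_mat_vec_carrier[OF BA q] BA_g_carrier[OF t]
      f_block_carrier(2)[OF t] by auto
  have arith: "a + - b + (h - e) = a - b - e + 0\<^sub>v n + h"
    if "a \<in> carrier_vec n" "b \<in> carrier_vec n" "e \<in> carrier_vec n" "h \<in> carrier_vec n"
    for a b e h :: "real vec"
    by (rule eq_vecI) (use that in auto)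
  have "BA (Suc k) *\<^sub>v y t + N_block (Suc k) q + f_block (Suc k) t
      = BA (Suc k) *\<^sub>v y t - BA k *\<^sub>v q - BA k *\<^sub>v g 0 t + 0\<^sub>v n + f_block' k t"
    unfolding f_block_Suc[OF t] using arith[OF c] by (simp add: N_block_def)
  then show ?case by (simp only: eq)
qed

lemma solution_imp_algebraic:
  assumes q: "q \<in> carrier_vec (n * n)"
    and y: "\<And>t. t \<in> S \<Longrightarrow> has_vec_derivative (n * n) y (At *\<^sub>v y t - q - g 0 t) t S"
    and y0: "\<And>t. t \<in> S \<Longrightarrow> BA 0 *\<^sub>v y t = 0\<^sub>v n"
    and t: "t \<in> S"
  shows "H *\<^sub>v y t + N *\<^sub>v q + f t = 0\<^sub>v (n * n)" "AQ *\<^sub>v q = BQ_of S A B G t"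
proof -
  have yc: "y t \<in> carrier_vec (n * n)" if "t \<in> S" for t
    using y[OF that] that by (simp add: has_vec_derivative_def)
  have eq: "H *\<^sub>v y t + N *\<^sub>v q + f t = 0\<^sub>v (n * n)" if "t \<in> S" for t
    unfolding stacked_sum[OF yc[OF that] q that] stack_vec_zero[symmetric]
    by (rule stack_vec_cong) (rule constraint_derivatives[OF q y y0 that])
  then show "H *\<^sub>v y t + N *\<^sub>v q + f t = 0\<^sub>v (n * n)" using t .
  have "has_vec_derivative (n * n) (\<lambda>t. H *\<^sub>v y t + N *\<^sub>v q + f t)
      (H *\<^sub>v (At *\<^sub>v y t - q - g 0 t) + 0\<^sub>v (n * n) + f' t) t S"
    by (intro has_vec_derivative_add has_vec_derivative_mult[OF H] y t has_vec_derivative_const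
        mult_mat_vec_carrier[OF N q] f_derivative)
  then have "has_vec_derivative (n * n) (\<lambda>_. 0\<^sub>v (n * n))
      (H *\<^sub>v (At *\<^sub>v y t - q - g 0 t) + 0\<^sub>v (n * n) + f' t) t S"
    by (rule has_vec_derivative_cong[OF _ t]) (use eq in auto)
  then have "H *\<^sub>v (At *\<^sub>v y t - q - g 0 t) + 0\<^sub>v (n * n) + f' t = 0\<^sub>v (n * n)"
    by (rule has_vec_derivative_unique[OF T t _ has_vec_derivative_const[OF zero_carrier_vec]])
  moreover have "H *\<^sub>v (At *\<^sub>v y t - q - g 0 t) \<in> carrier_vec (n * n)"
    by (rule mult_mat_vec_carrier[OF H])
      (intro minus_carrier_vec mult_mat_vec_carrier[OF At yc[OF t]] q g_carrier[OF t])
  ultimately have "H *\<^sub>v (At *\<^sub>v y t - q - g 0 t) + f' t = 0\<^sub>v (n * n)" by simp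
  then show "AQ *\<^sub>v q = BQ_of S A B G t"
    using residual_zero_iff[OF yc[OF t] q t eq[OF t]] by blast
qed

lemma algebraic_imp_solution:
  assumes q: "q \<in> carrier_vec (n * n)" and yT: "yT \<in> carrier_vec (n * n)"
    and AQ: "\<And>t. t \<in> S \<Longrightarrow> AQ *\<^sub>v q = BQ_of S A B G t"
    and fin: "H *\<^sub>v yT + N *\<^sub>v q + f T = 0\<^sub>v (n * n)"
  shows "\<exists>y. (\<forall>t\<in>S. has_vec_derivative (n * n) y (At *\<^sub>v y t - q - g 0 t) t S) \<and>
    (\<forall>t\<in>S. BA 0 *\<^sub>v y t = 0\<^sub>v n) \<and> y T = yT"
proof -
  define y where "y t = - (Hi *\<^sub>v (N *\<^sub>v q + f t))" for t
  have Nq: "N *\<^sub>v q \<in> carrier_vec (n * n)" by (rule mult_mat_vec_carrier[OF N q])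
  have Nqf: "N *\<^sub>v q + f t \<in> carrier_vec (n * n)" for t using Nq f_carrier by simp
  have HHi: "H *\<^sub>v (Hi *\<^sub>v z) = z" if "z \<in> carrier_vec (n * n)" for z
    using assoc_mult_mat_vec[OF H Hi(3) that] Hi(1) that by simp
  have yc: "y t \<in> carrier_vec (n * n)" for t
    unfolding y_def uminus_carrier_vec by (rule mult_mat_vec_carrier[OF Hi(3) Nqf])
  have Hneg: "H *\<^sub>v (- (Hi *\<^sub>v z)) = - z" if "z \<in> carrier_vec (n * n)" for z
    using HHi[OF that] Hi(3) H by (subst mult_mat_vec_uminus) auto
  have Hy: "H *\<^sub>v y t = - (N *\<^sub>v q + f t)" for t
    unfolding y_def by (rule Hneg[OF Nqf])
  have eq: "H *\<^sub>v y t + N *\<^sub>v q + f t = 0\<^sub>v (n * n)" for t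
    using Hy sum3_eq_0_iff[OF mult_mat_vec_carrier[OF H yc] Nq f_carrier] by blast
  have dy: "has_vec_derivative (n * n) y (At *\<^sub>v y t - q - g 0 t) t S" if t: "t \<in> S" for t
  proof -
    let ?r = "At *\<^sub>v y t - q - g 0 t"
    have rc: "?r \<in> carrier_vec (n * n)"
      by (intro minus_carrier_vec mult_mat_vec_carrier[OF At yc] q g_carrier[OF t])
    have Hr: "H *\<^sub>v ?r \<in> carrier_vec (n * n)" by (rule mult_mat_vec_carrier[OF H rc])
    have d: "has_vec_derivative (n * n) y (- (Hi *\<^sub>v (0\<^sub>v (n * n) + f' t))) t S"
      unfolding y_def[abs_def]
      by (intro has_vec_derivative_uminus has_vec_derivative_mult[OF Hi(3)] has_vec_derivative_add
          has_vec_derivative_const Nq f_derivative t)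
    have zf: "0\<^sub>v (n * n) + f' t = f' t" using f'_carrier[of t] by simp
    have "H *\<^sub>v (- (Hi *\<^sub>v f' t)) = - f' t" by (rule Hneg[OF f'_carrier])
    also have "\<dots> = H *\<^sub>v ?r"
    proof -
      have "H *\<^sub>v ?r + f' t = 0\<^sub>v (n * n)"
        using residual_zero_iff[OF yc q t eq] AQ[OF t] by blast
      then show ?thesis using sum2_eq_0_iff[OF Hr f'_carrier] by blast
    qed
    finally have "- (Hi *\<^sub>v f' t) = ?r"
      using mult_mat_vec_carrier[OF Hi(3) f'_carrier[of t]] by (intro H_inj[OF _ rc]) auto
    then show ?thesis using d by (simp only: zf)
  qed
  have y0: "BA 0 *\<^sub>v y t = 0\<^sub>v n" if t: "t \<in> S" for t
  proof -
    have c: "BA 0 *\<^sub>v y t \<in> carrier_vec n" by (rule mult_mat_vec_carrier[OF BA yc])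
    show ?thesis
    proof (cases "n = 0")
      case True
      then show ?thesis using c by (intro eq_vecI) (auto simp del: dim_mult_mat_vec)
    next
      case False
      have "stack_vec n n (\<lambda>k. BA k *\<^sub>v y t + N_block k q + f_block k t) = stack_vec n n (\<lambda>_. 0\<^sub>v n)"
        using eq[of t] unfolding stacked_sum[OF yc q t] stack_vec_zero .
      then have "BA 0 *\<^sub>v y t + N_block 0 q + f_block 0 t = 0\<^sub>v n"
        by (rule stack_vec_block_eq) (use False c in \<open>auto simp: f_block_0 N_block_def\<close>)
      then show ?thesis using c by (simp add: f_block_0 N_block_def)
    qed
  qed
  have "y T = yT"
  proof (rule H_inj[OF yc yT])
    have HyT: "H *\<^sub>v yT \<in> carrier_vec (n * n)" by (rule mult_mat_vec_carrier[OF H yT])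
    show "H *\<^sub>v y T = H *\<^sub>v yT"
      using fin Hy[of T] sum3_eq_0_iff[OF HyT Nq f_carrier] by simp
  qed
  with dy y0 show ?thesis by blast
qed

text \<open>The antisymmetric part of \<open>Y\<close> solves the homogeneous equation \<open>Z' = lyap A Z\<close>
  and vanishes at \<open>T\<close>.\<close>

lemma solution_sym:
  assumes Y: "\<And>t. t \<in> S \<Longrightarrow> Y t \<in> carrier_mat n n"
    and dY: "\<And>t. t \<in> S \<Longrightarrow> has_mat_derivative Y (lyap A (Y t) - Q - G t) t S"
    and Q: "sym_mat n Q" and G: "\<And>t. t \<in> S \<Longrightarrow> sym_mat n (G t)" and YT: "sym_mat n (Y T)"
    and t: "t \<in> S"
  shows "sym_mat n (Y t)"
proof -
  define Z where "Z t = Y t - transpose_mat (Y t)" for t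
  have Z: "Z t \<in> carrier_mat n n" if "t \<in> S" for t
    using Y[OF that] by (simp add: Z_def minus_carrier_mat)
  have swap: "X $$ (j, i) = X $$ (i, j)" if "sym_mat n X" "i < n" "j < n" for X i j
  proof -
    have c: "X \<in> carrier_mat n n" and s: "transpose_mat X = X" using that by (auto simp: sym_mat_def)
    have "X $$ (j, i) = transpose_mat X $$ (i, j)" using c that by simp
    then show ?thesis by (simp only: s)
  qed
  have dZ: "has_mat_derivative Z (lyap A (Z t)) t S" if t: "t \<in> S" for t
  proof -
    let ?D = "lyap A (Y t) - Q - G t"
    note Yt = Y[OF t]
    have D: "?D \<in> carrier_mat n n"
      using G[OF t] by (auto simp: sym_mat_def minus_carrier_mat)
    have entry: "lyap A (Z t) $$ (i, j) = ?D $$ (i, j) - ?D $$ (j, i)" if ij: "i < n" "j < n" for i j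
    proof -
      have l: "lyap A X $$ (i, j) = - (\<Sum>k = 0..<n. A $$ (k, i) * X $$ (k, j)) - (\<Sum>k = 0..<n. X $$ (i, k) * A $$ (k, j))"
        if "X \<in> carrier_mat n n" "i < n" "j < n" for X i j
        using that A by (auto simp: lyap_def scalar_prod_def)
      have "lyap A (Z t) $$ (i, j)
          = - (\<Sum>k = 0..<n. A $$ (k, i) * (Y t $$ (k, j) - Y t $$ (j, k)))
            - (\<Sum>k = 0..<n. (Y t $$ (i, k) - Y t $$ (k, i)) * A $$ (k, j))"
        unfolding l[OF Z[OF t] ij] using Yt ij by (simp add: Z_def)
      also have "\<dots> = lyap A (Y t) $$ (i, j) - lyap A (Y t) $$ (j, i)"
        unfolding l[OF Yt ij] l[OF Yt ij(2,1)]
        by (simp add: algebra_simps sum_subtractf)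
      also have "\<dots> = ?D $$ (i, j) - ?D $$ (j, i)"
        using ij swap[OF Q ij] swap[OF G[OF t] ij] Q G[OF t] lyap_carrier[OF A Yt]
        by (auto simp: sym_mat_def)
      finally show ?thesis .
    qed
    have "((\<lambda>s. Z s $$ (i, j)) has_vector_derivative lyap A (Z t) $$ (i, j)) (at t within S)"
      if ij: "i < n" "j < n" for i j
    proof -
      have "((\<lambda>s. Y s $$ (i, j) - Y s $$ (j, i)) has_vector_derivative ?D $$ (i, j) - ?D $$ (j, i)) (at t within S)"
        using dY[OF t] D ij Yt unfolding has_mat_derivative_def
        by (intro has_vector_derivative_diff) auto
      then show ?thesis
        unfolding entry[OF ij]
      proof (rule has_vector_derivative_transform[OF t, rotated])
        fix s assume "s \<in> S"
        then show "Z s $$ (i, j) = Y s $$ (i, j) - Y s $$ (j, i)"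
          using Y[of s] ij by (auto simp: Z_def)
      qed
    qed
    then show ?thesis
      using Z[OF t] lyap_carrier[OF A Z[OF t]] by (auto simp: has_mat_derivative_def)
  qed
  have "vec_stack (Z t) = 0\<^sub>v (n * n)"
  proof (rule linear_ode_zero[OF At, where z = "\<lambda>t. vec_stack (Z t)" and a = 0 and b = T and ?t0.0 = T])
    fix t assume t: "t \<in> S"
    show "has_vec_derivative (n * n) (\<lambda>t. vec_stack (Z t)) (At *\<^sub>v vec_stack (Z t)) t S"
      unfolding Atil_mult_vec_stack[OF A Z[OF t]]
      by (rule has_vec_derivative_vec_stack[THEN iffD2, OF Z lyap_carrier[OF A Z[OF t]] t dZ[OF t]])
  next
    have "Z T = 0\<^sub>m n n" using YT by (auto simp: Z_def sym_mat_def)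
    then show "vec_stack (Z T) = 0\<^sub>v (n * n)" by (simp add: vec_stack_zero)
  qed (use t T in auto)
  then have "vec_stack (Z t) = vec_stack (0\<^sub>m n n)" by (simp only: vec_stack_zero)
  then have Z0: "Z t = 0\<^sub>m n n" using vec_stack_inject[OF Z[OF t] zero_carrier_mat] by blast
  show ?thesis
    unfolding sym_mat_def
  proof (intro conjI eq_matI Y t)
    fix i j assume "i < dim_row (Y t)" "j < dim_col (Y t)"
    then have ij: "i < n" "j < n" using Y[OF t] by auto
    then have "Z t $$ (i, j) = 0" by (simp add: Z0)
    then show "transpose_mat (Y t) $$ (i, j) = Y t $$ (i, j)"
      using Y[OF t] ij by (simp add: Z_def)
  qed (use Y[OF t] in auto)
qed

lemma vec_stack_rhs:
  assumes "Y \<in> carrier_mat n n" "Q \<in> carrier_mat n n" "t \<in> S"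
  shows "vec_stack (lyap A Y - Q - G t) = At *\<^sub>v vec_stack Y - vec_stack Q - g 0 t"
  using assms G_carrier[OF assms(3)] lyap_carrier[OF A assms(1)]
  by (simp add: vec_stack_minus[of _ n n] minus_carrier_mat Atil_mult_vec_stack[OF A] g_0)

lemma BA_0_eq_0_iff:
  assumes "Y \<in> carrier_mat n n"
  shows "BA 0 *\<^sub>v vec_stack Y = 0\<^sub>v n \<longleftrightarrow> transpose_mat B * Y = 0\<^sub>m 1 n"
proof -
  have "transpose_mat B * Y \<in> carrier_mat 1 n" using B assms by simp
  then show ?thesis
    using vec_stack_inject[of "transpose_mat B * Y" 1 n "0\<^sub>m 1 n"] BA_block_mult_vec_stack[OF A B assms, of 0]
    by (simp add: vec_stack_zero)
qed

lemma As_mult_vec: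
  assumes q: "q \<in> carrier_vec (n * (n + 1) div 2)" and y: "y \<in> carrier_vec (n * (n + 1) div 2)"
  shows "As_of A B *\<^sub>v (q @\<^sub>v y) = (AQ *\<^sub>v (dup_mat n *\<^sub>v q)) @\<^sub>v
    (N *\<^sub>v (dup_mat n *\<^sub>v q) + H *\<^sub>v (dup_mat n *\<^sub>v y))"
proof -
  let ?d = "n * (n + 1) div 2" let ?D = "dup_mat n"
  note D = dup_mat_carrier[of n]
  have As: "As_of A B = four_block_mat (AQ * ?D) (0\<^sub>m (n * n) ?d) (N * ?D) (H * ?D)"
    using A AQ_carrier D by (simp add: As_of_def Let_def)
  have "As_of A B *\<^sub>v (q @\<^sub>v y) = ((AQ * ?D) *\<^sub>v q + 0\<^sub>m (n * n) ?d *\<^sub>v y) @\<^sub>v ((N * ?D) *\<^sub>v q + (H * ?D) *\<^sub>v y)"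
    unfolding As
    by (rule four_block_mat_mult_vec[OF mult_carrier_mat[OF AQ_carrier D] zero_carrier_mat
          mult_carrier_mat[OF N D] mult_carrier_mat[OF H D] q y])
  also have "0\<^sub>m (n * n) ?d *\<^sub>v y = 0\<^sub>v (n * n)" using y by auto
  also have "(AQ * ?D) *\<^sub>v q + 0\<^sub>v (n * n) = (AQ * ?D) *\<^sub>v q"
    using mult_mat_vec_carrier[OF mult_carrier_mat[OF AQ_carrier D] q] by simp
  finally show ?thesis
    by (simp only: assoc_mult_mat_vec[OF AQ_carrier D q] assoc_mult_mat_vec[OF N D q]
        assoc_mult_mat_vec[OF H D y])
qed

lemma As_carrier:
  "As_of A B \<in> carrier_mat (n * n + n * n) (n * (n + 1) div 2 + n * (n + 1) div 2)"
proof -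
  note D = dup_mat_carrier[of n]
  have "As_of A B = four_block_mat (AQ * dup_mat n) (0\<^sub>m (n * n) (n * (n + 1) div 2)) (N * dup_mat n) (H * dup_mat n)"
    using A AQ_carrier D by (simp add: As_of_def Let_def)
  then show ?thesis
    using four_block_carrier_mat[OF mult_carrier_mat[OF AQ_carrier D] mult_carrier_mat[OF H D]] by simp
qed

lemma As_eq_bs_iff:
  assumes q: "q \<in> carrier_vec (n * (n + 1) div 2)" and y: "y \<in> carrier_vec (n * (n + 1) div 2)"
    and bQ: "bQ \<in> carrier_vec (n * n)"
  shows "As_of A B *\<^sub>v (q @\<^sub>v y) = bs_of T A B G bQ \<longleftrightarrow>
    AQ *\<^sub>v (dup_mat n *\<^sub>v q) = bQ \<and>
    H *\<^sub>v (dup_mat n *\<^sub>v y) + N *\<^sub>v (dup_mat n *\<^sub>v q) + f T = 0\<^sub>v (n * n)"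
proof -
  have Dq: "dup_mat n *\<^sub>v q \<in> carrier_vec (n * n)" and Dy: "dup_mat n *\<^sub>v y \<in> carrier_vec (n * n)"
    using mult_mat_vec_carrier[OF dup_mat_carrier] q y by blast+
  define h m where "h = H *\<^sub>v (dup_mat n *\<^sub>v y)" and "m = N *\<^sub>v (dup_mat n *\<^sub>v q)"
  have h: "h \<in> carrier_vec (n * n)" and m: "m \<in> carrier_vec (n * n)"
    unfolding h_def m_def using mult_mat_vec_carrier H N Dq Dy by blast+
  have "m + h = - f T \<longleftrightarrow> h + m + f T = 0\<^sub>v (n * n)"
  proof
    assume "m + h = - f T"
    have "h + m + f T = (m + h) + f T" using h m by (simp add: comm_add_vec)
    also have "\<dots> = 0\<^sub>v (n * n)" unfolding \<open>m + h = - f T\<close> using f_carrier[of T] by (intro eq_vecI) auto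
    finally show "h + m + f T = 0\<^sub>v (n * n)" .
  next
    assume z: "h + m + f T = 0\<^sub>v (n * n)"
    show "m + h = - f T"
    proof (rule eq_vecI)
      fix i assume "i < dim_vec (- f T)"
      then have i: "i < n * n" using f_carrier[of T] by simp
      then have "(h + m + f T) $ i = 0" by (simp only: z index_zero_vec)
      then show "(m + h) $ i = (- f T) $ i" using i h m f_carrier[of T] by simp
    qed (use h f_carrier[of T] in simp)
  qed
  moreover have "AQ *\<^sub>v (dup_mat n *\<^sub>v q) \<in> carrier_vec (n * n)"
    by (rule mult_mat_vec_carrier[OF AQ_carrier Dq])
  ultimately show ?thesis
    unfolding As_mult_vec[OF q y] bs_of_def h_def[symmetric] m_def[symmetric]
    using append_vec_eq[OF _ bQ, of "AQ *\<^sub>v (dup_mat n *\<^sub>v q)" "m + h" "- f T"] by blast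
qed

end

lemma P0_of_sym:
  assumes K: "K t \<in> carrier_mat 1 n" and B: "B \<in> carrier_mat n 1" and KB: "sym_mat 1 (K t * B)"
  shows "sym_mat n (P0_of B K t)"
proof -
  let ?Z = "pinv (K t * B)"
  have Z: "?Z \<in> carrier_mat 1 1" "transpose_mat ?Z = ?Z"
    using pinv_sym[OF KB] by (auto simp: sym_mat_def)
  have "transpose_mat (transpose_mat (K t) * ?Z * K t) = transpose_mat (K t) * (?Z * K t)"
    using K Z by (simp add: transpose_mult_dim)
  also have "\<dots> = transpose_mat (K t) * ?Z * K t"
    using K Z by (intro mult_assoc_mat_dim[symmetric]) auto
  finally show ?thesis
    unfolding sym_mat_def P0_of_def using K by (auto simp: transpose_uminus)
qed

theorem theorem8:
  fixes n r :: nat and T :: real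
    and A B :: "real mat" and K P0 G :: "real \<Rightarrow> real mat"
    and d :: nat and D As :: "real mat"
    and q yT :: "nat \<Rightarrow> real vec"
  assumes A: "A \<in> carrier_mat n n"
    and B: "B \<in> carrier_mat n 1" "B \<noteq> 0\<^sub>m n 1"
    and controllable: "controllable n 1 A B"
    and T: "0 < T"
    and K: "\<And>t. t \<in> {0..T} \<Longrightarrow> K t \<in> carrier_mat 1 n"
    and KB_sym: "\<And>t. t \<in> {0..T} \<Longrightarrow> sym_mat 1 (K t * B)"
    and KB_rank: "\<And>t. t \<in> {0..T} \<Longrightarrow> vec_space.rank 1 (K t * B) = vec_space.rank 1 (K t)"
    and P0: "P0 = P0_of B K"
    and P0_smooth: "mat_Ck n {0..T} P0 n n"
    and G: "G = G_of {0..T} A B P0"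
    and d: "d = n * (n + 1) div 2"
    and D: "D = dup_mat n"
    and As: "As = As_of A B"
    and null_vecs: "\<And>i. i \<in> {1..r} \<Longrightarrow> q i \<in> carrier_vec d \<and> yT i \<in> carrier_vec d"
    and null_span: "module.span class_ring (module_vec TYPE(real) (d + d))
                      ((\<lambda>i. q i @\<^sub>v yT i) ` {1..r}) = mat_kernel As"
  shows "(\<exists>Q. inverse_problem_solution n T A B P0 G Q) \<longleftrightarrow>
    (\<exists>bQ. (\<forall>t \<in> {0..T}. BQ_of {0..T} A B G t = bQ) \<and>
      (let bs = bs_of T A B G bQ;
           z0 = pinv As *\<^sub>v bs;
           Q0 = mat_unstack n (D *\<^sub>v vec_first z0 d);
           Y0 = mat_unstack n (D *\<^sub>v vec_last z0 d);
           Qs = (\<lambda>i. mat_unstack n (D *\<^sub>v q i));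
           Ys = (\<lambda>i. mat_unstack n (D *\<^sub>v yT i))
       in (As * pinv As) *\<^sub>v bs = bs \<and>
          (\<exists>v :: nat \<Rightarrow> real.
             psd_mat n (affine_comb n r Q0 v Qs) \<and>
             psd_mat n (affine_comb n r (P0 T + Y0) v Ys))))"
proof -
  let ?S = "{0..T}"
  have "n \<noteq> 0"
  proof
    assume "n = 0"
    then have "B = 0\<^sub>m n 1" using B(1) by (intro eq_matI) auto
    with B(2) show False ..
  qed
  then have P0_Ck: "mat_Ck (Suc (n - 1)) ?S P0 n n" using P0_smooth by simp
  interpret lyapunov_constraint n T A B G
    by unfold_locales (use A B(1) controllable T G G_of_Ck[OF T A B(1) P0_Ck] in auto)
  have TS: "T \<in> ?S" using T by simp
  have P0_sym: "sym_mat n (P0 t)" if "t \<in> ?S" for t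
    unfolding P0 by (rule P0_of_sym[of K t n B, OF K[OF that] B(1) KB_sym[OF that]])
  have G_sym: "sym_mat n (G t)" if "t \<in> ?S" for t
    unfolding G
    by (rule G_of_sym[OF T A B(1) _ P0_sym that]) (use P0_Ck that in \<open>auto simp: mat_Ck_Suc\<close>)
  have P0T: "P0 T \<in> carrier_mat n n" using P0_sym[OF TS] by (simp add: sym_mat_def)
  have D': "D \<in> carrier_mat (n * n) d" unfolding D d by (rule dup_mat_carrier)
  have As': "As \<in> carrier_mat (n * n + n * n) (d + d)" unfolding As d by (rule As_carrier)
  define comb where "comb v w = vec d (\<lambda>l. \<Sum>k = 1..r. v k * w k $ l)" for v :: "nat \<Rightarrow> real" and w :: "nat \<Rightarrow> real vec"
  have comb_c: "comb v w \<in> carrier_vec d" for v w by (simp add: comb_def)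
  have comb2: "vec (d + d) (\<lambda>l. \<Sum>k = 1..r. v k * (q k @\<^sub>v yT k) $ l) = comb v q @\<^sub>v comb v yT" for v
  proof (rule eq_vecI)
    fix l assume "l < dim_vec (comb v q @\<^sub>v comb v yT)"
    then have l: "l < d + d" by (simp add: comb_def)
    have "(\<Sum>k = 1..r. v k * (q k @\<^sub>v yT k) $ l)
        = (\<Sum>k = 1..r. v k * (if l < d then q k $ l else yT k $ (l - d)))"
    proof (rule sum.cong[OF refl])
      fix k assume "k \<in> {1..r}"
      then have "dim_vec (q k) = d" "dim_vec (yT k) = d" using null_vecs[of k] by auto
      then show "v k * (q k @\<^sub>v yT k) $ l = v k * (if l < d then q k $ l else yT k $ (l - d))"
        using l by simp
    qed
    then show "vec (d + d) (\<lambda>l. \<Sum>k = 1..r. v k * (q k @\<^sub>v yT k) $ l) $ l = (comb v q @\<^sub>v comb v yT) $ l"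
      using l by (simp add: comb_def)
  qed (simp add: comb_def)
  have comb_affine: "affine_comb n r (mat_unstack n (D *\<^sub>v x)) v (\<lambda>k. mat_unstack n (D *\<^sub>v w k))
      = mat_unstack n (D *\<^sub>v (x + comb v w))"
    if "x \<in> carrier_vec d" "\<And>k. k \<in> {1..r} \<Longrightarrow> w k \<in> carrier_vec d" for x v w
    unfolding comb_def by (rule affine_comb_unstack[OF D' that])
  have w: "q k @\<^sub>v yT k \<in> carrier_vec (d + d)" if "k \<in> {1..r}" for k
    using null_vecs[OF that] by simp
  have ker: "z \<in> mat_kernel As \<longleftrightarrow> (\<exists>v. z = comb v q @\<^sub>v comb v yT)" for z
    unfolding null_span[symmetric] comb2[symmetric] by (rule in_span_image_iff[OF w])
  show ?thesis
  proof
    assume "\<exists>Q. inverse_problem_solution n T A B P0 G Q"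
    then obtain Q Y where Q: "psd_mat n Q" and Y: "\<forall>t\<in>?S. sym_mat n (Y t)"
        "\<forall>t\<in>?S. has_mat_derivative Y (- (transpose_mat A * Y t) - Y t * A - Q - G t) t ?S"
        "\<forall>t\<in>?S. transpose_mat B * Y t = 0\<^sub>m (dim_col B) n"
      and YT: "psd_mat n (Y T + P0 T)"
      unfolding inverse_problem_solution_def by blast
    note Y_sym = bspec[OF Y(1)] and dY = bspec[OF Y(2)]
    have BY: "transpose_mat B * Y t = 0\<^sub>m 1 n" if "t \<in> ?S" for t
      using bspec[OF Y(3) that] B(1) by simp
    have Qs: "sym_mat n Q" and Qc: "Q \<in> carrier_mat n n" using Q by (auto simp: psd_mat_def sym_mat_def)
    have Yc: "Y t \<in> carrier_mat n n" if "t \<in> ?S" for t using Y_sym[OF that] by (simp add: sym_mat_def)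
    define y where "y t = vec_stack (Y t)" for t
    have dy: "has_vec_derivative (n * n) y (At *\<^sub>v y t - vec_stack Q - g 0 t) t ?S" if t: "t \<in> ?S" for t
    proof -
      have "lyap A (Y t) - Q - G t \<in> carrier_mat n n"
        using G_sym[OF t] by (auto simp: sym_mat_def minus_carrier_mat)
      from has_vec_derivative_vec_stack[THEN iffD2, OF Yc this t] dY[OF t]
      show ?thesis
        unfolding y_def[abs_def] vec_stack_rhs[OF Yc[OF t] Qc t, symmetric] by (simp add: lyap_def)
    qed
    have y0: "BA 0 *\<^sub>v y t = 0\<^sub>v n" if "t \<in> ?S" for t
      unfolding y_def BA_0_eq_0_iff[OF Yc[OF that]] by (rule BY[OF that])
    have alg: "H *\<^sub>v y t + N *\<^sub>v vec_stack Q + f t = 0\<^sub>v (n * n)"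
      "AQ *\<^sub>v vec_stack Q = BQ_of S A B G t" if "t \<in> ?S" for t
      by (rule solution_imp_algebraic(1)[OF vec_stack_carrier[OF Qc] dy y0 that], assumption+)
         (rule solution_imp_algebraic(2)[OF vec_stack_carrier[OF Qc] dy y0 that], assumption+)
    define bQ where "bQ = AQ *\<^sub>v vec_stack Q"
    define bs where "bs = bs_of T A B G bQ"
    define z0 where "z0 = pinv As *\<^sub>v bs"
    have bQc: "bQ \<in> carrier_vec (n * n)"
      unfolding bQ_def by (rule mult_mat_vec_carrier[OF AQ_carrier vec_stack_carrier[OF Qc]])
    define qv yv where "qv = vech Q" and "yv = vech (Y T)"
    have qv: "qv \<in> carrier_vec d" and yv: "yv \<in> carrier_vec d"
      unfolding qv_def yv_def d using vech_carrier Qc Yc[OF TS] by blast+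
    have Dqv: "D *\<^sub>v qv = vec_stack Q" and Dyv: "D *\<^sub>v yv = vec_stack (Y T)"
      unfolding D qv_def yv_def using dup_mat_vech[OF Qs] dup_mat_vech[OF Y_sym[OF TS]] by simp_all
    have qy: "qv @\<^sub>v yv \<in> carrier_vec (d + d)" using qv yv by simp
    have Asz: "As *\<^sub>v (qv @\<^sub>v yv) = bs"
      unfolding As bs_def As_eq_bs_iff[OF qv[unfolded d] yv[unfolded d] bQc] D[symmetric] Dqv Dyv
      using alg(1)[OF TS] by (simp add: bQ_def y_def)
    have solv: "(As * pinv As) *\<^sub>v bs = bs" by (rule pinv_solves[OF As' qy Asz])
    have bsc: "bs \<in> carrier_vec (n * n + n * n)" using mult_mat_vec_carrier[OF As' qy] Asz by simp
    have z0: "z0 \<in> carrier_vec (d + d)" unfolding z0_def by (rule mult_mat_vec_carrier[OF pinv_carrier[OF As'] bsc])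
    have Asz0: "As *\<^sub>v z0 = bs"
      unfolding z0_def using assoc_mult_mat_vec[OF As' pinv_carrier[OF As'] bsc] solv by simp
    have "(qv @\<^sub>v yv) - z0 \<in> mat_kernel As"
      unfolding mat_kernel[OF As'] using qy z0 bsc
      by (simp add: mult_minus_distrib_mat_vec[OF As' qy z0] Asz Asz0)
    then obtain v where v: "(qv @\<^sub>v yv) - z0 = comb v q @\<^sub>v comb v yT" using ker by blast
    have idx: "(qv @\<^sub>v yv) $ l = z0 $ l + (comb v q @\<^sub>v comb v yT) $ l" if "l < d + d" for l
      using arg_cong[OF v, of "\<lambda>x. x $ l"] that z0 by simp
    have q_eq: "vec_first z0 d + comb v q = qv"
    proof (rule eq_vecI)
      fix l assume "l < dim_vec qv"
      then have l: "l < d" using qv by simp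
      then show "(vec_first z0 d + comb v q) $ l = qv $ l"
        using idx[of l] qv z0 by (simp add: vec_first_def comb_def)
    qed (use qv in \<open>simp add: comb_def\<close>)
    have y_eq: "vec_last z0 d + comb v yT = yv"
    proof (rule eq_vecI)
      fix l assume "l < dim_vec yv"
      then have l: "l < d" using yv by simp
      then show "(vec_last z0 d + comb v yT) $ l = yv $ l"
        using idx[of "d + l"] qv yv z0 by (simp add: vec_last_def comb_def)
    qed (use yv in \<open>simp add: comb_def\<close>)
    have "affine_comb n r (mat_unstack n (D *\<^sub>v vec_first z0 d)) v (\<lambda>i. mat_unstack n (D *\<^sub>v q i)) = Q"
      using null_vecs Qc by (subst comb_affine) (simp_all add: q_eq Dqv mat_unstack_stack)
    moreover have "affine_comb n r (P0 T + mat_unstack n (D *\<^sub>v vec_last z0 d)) v (\<lambda>i. mat_unstack n (D *\<^sub>v yT i))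
        = P0 T + Y T"
      using null_vecs Yc[OF TS]
      by (subst affine_comb_add[OF P0T mat_unstack_carrier], subst comb_affine)
         (simp_all add: y_eq Dyv mat_unstack_stack)
    moreover have "P0 T + Y T = Y T + P0 T" by (rule comm_add_mat[OF P0T Yc[OF TS]])
    ultimately have "\<exists>v. psd_mat n (affine_comb n r (mat_unstack n (D *\<^sub>v vec_first z0 d)) v (\<lambda>i. mat_unstack n (D *\<^sub>v q i))) \<and>
        psd_mat n (affine_comb n r (P0 T + mat_unstack n (D *\<^sub>v vec_last z0 d)) v (\<lambda>i. mat_unstack n (D *\<^sub>v yT i)))"
      using Q YT by (intro exI[of _ v]) simp
    moreover have "\<forall>t\<in>?S. BQ_of ?S A B G t = bQ" using alg(2) by (simp add: bQ_def)
    ultimately show "\<exists>bQ. (\<forall>t \<in> {0..T}. BQ_of {0..T} A B G t = bQ) \<and>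
      (let bs = bs_of T A B G bQ;
           z0 = pinv As *\<^sub>v bs;
           Q0 = mat_unstack n (D *\<^sub>v vec_first z0 d);
           Y0 = mat_unstack n (D *\<^sub>v vec_last z0 d);
           Qs = (\<lambda>i. mat_unstack n (D *\<^sub>v q i));
           Ys = (\<lambda>i. mat_unstack n (D *\<^sub>v yT i))
       in (As * pinv As) *\<^sub>v bs = bs \<and>
          (\<exists>v :: nat \<Rightarrow> real.
             psd_mat n (affine_comb n r Q0 v Qs) \<and>
             psd_mat n (affine_comb n r (P0 T + Y0) v Ys)))"
      unfolding Let_def using solv unfolding z0_def bs_def by blast
  next
    assume "\<exists>bQ. (\<forall>t \<in> {0..T}. BQ_of {0..T} A B G t = bQ) \<and>
      (let bs = bs_of T A B G bQ;
           z0 = pinv As *\<^sub>v bs;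
           Q0 = mat_unstack n (D *\<^sub>v vec_first z0 d);
           Y0 = mat_unstack n (D *\<^sub>v vec_last z0 d);
           Qs = (\<lambda>i. mat_unstack n (D *\<^sub>v q i));
           Ys = (\<lambda>i. mat_unstack n (D *\<^sub>v yT i))
       in (As * pinv As) *\<^sub>v bs = bs \<and>
          (\<exists>v :: nat \<Rightarrow> real.
             psd_mat n (affine_comb n r Q0 v Qs) \<and>
             psd_mat n (affine_comb n r (P0 T + Y0) v Ys)))"
    then obtain bQ bs z0 v where BQ: "\<forall>t \<in> ?S. BQ_of ?S A B G t = bQ"
      and bs: "bs = bs_of T A B G bQ" and z0_def: "z0 = pinv As *\<^sub>v bs"
      and solv: "(As * pinv As) *\<^sub>v bs = bs"
      and psd: "psd_mat n (affine_comb n r (mat_unstack n (D *\<^sub>v vec_first z0 d)) v (\<lambda>i. mat_unstack n (D *\<^sub>v q i)))"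
        "psd_mat n (affine_comb n r (P0 T + mat_unstack n (D *\<^sub>v vec_last z0 d)) v (\<lambda>i. mat_unstack n (D *\<^sub>v yT i)))"
      unfolding Let_def by blast
    have bQc: "bQ \<in> carrier_vec (n * n)"
      using bspec[OF BQ TS] BQ_carrier[OF TS] by simp
    have bsc: "bs \<in> carrier_vec (n * n + n * n)"
      using bQc f_carrier[of T] by (simp add: bs bs_of_def)
    have z0: "z0 \<in> carrier_vec (d + d)" unfolding z0_def by (rule mult_mat_vec_carrier[OF pinv_carrier[OF As'] bsc])
    have Asz0: "As *\<^sub>v z0 = bs"
      unfolding z0_def using assoc_mult_mat_vec[OF As' pinv_carrier[OF As'] bsc] solv by simp
    define qv yv where "qv = vec_first z0 d + comb v q" and "yv = vec_last z0 d + comb v yT"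
    have qv: "qv \<in> carrier_vec d" and yv: "yv \<in> carrier_vec d" by (simp_all add: qv_def yv_def comb_def)
    have cc: "comb v q @\<^sub>v comb v yT \<in> carrier_vec (d + d)" using comb_c by simp
    have qy: "qv @\<^sub>v yv = z0 + (comb v q @\<^sub>v comb v yT)"
      by (rule eq_vecI) (use z0 in \<open>auto simp: qv_def yv_def vec_first_def vec_last_def comb_def\<close>)
    have "comb v q @\<^sub>v comb v yT \<in> mat_kernel As" using ker by blast
    then have "As *\<^sub>v (comb v q @\<^sub>v comb v yT) = 0\<^sub>v (n * n + n * n)"
      unfolding mat_kernel[OF As'] by simp
    then have "As *\<^sub>v (qv @\<^sub>v yv) = bs"
      unfolding qy mult_add_distrib_mat_vec[OF As' z0 cc] Asz0 using bsc by simp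
    then have alg: "AQ *\<^sub>v (D *\<^sub>v qv) = bQ" "H *\<^sub>v (D *\<^sub>v yv) + N *\<^sub>v (D *\<^sub>v qv) + f T = 0\<^sub>v (n * n)"
      unfolding As bs As_eq_bs_iff[OF qv[unfolded d] yv[unfolded d] bQc] D[symmetric] by blast+
    have Dq: "D *\<^sub>v qv \<in> carrier_vec (n * n)" and Dy: "D *\<^sub>v yv \<in> carrier_vec (n * n)"
      using mult_mat_vec_carrier[OF D'] qv yv by blast+
    obtain y where dy: "\<And>t. t \<in> ?S \<Longrightarrow> has_vec_derivative (n * n) y (At *\<^sub>v y t - D *\<^sub>v qv - g 0 t) t ?S"
      and y0: "\<And>t. t \<in> ?S \<Longrightarrow> BA 0 *\<^sub>v y t = 0\<^sub>v n" and yT': "y T = D *\<^sub>v yv"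
    proof -
      have "\<exists>y. (\<forall>t\<in>?S. has_vec_derivative (n * n) y (At *\<^sub>v y t - D *\<^sub>v qv - g 0 t) t ?S) \<and>
          (\<forall>t\<in>?S. BA 0 *\<^sub>v y t = 0\<^sub>v n) \<and> y T = D *\<^sub>v yv"
        by (rule algebraic_imp_solution[OF Dq Dy _ alg(2)]) (simp only: alg(1) bspec[OF BQ])
      then show ?thesis using that by blast
    qed
    define Q where "Q = mat_unstack n (D *\<^sub>v qv)"
    define Y where "Y t = mat_unstack n (y t)" for t
    have Q_sym: "sym_mat n Q" unfolding Q_def D by (rule sym_mat_unstack_dup)
    have Qc: "Q \<in> carrier_mat n n" unfolding Q_def by (rule mat_unstack_carrier)
    have vQ: "vec_stack Q = D *\<^sub>v qv" unfolding Q_def by (rule vec_stack_unstack[OF Dq])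
    have Yc: "Y t \<in> carrier_mat n n" for t unfolding Y_def by (rule mat_unstack_carrier)
    have vY: "vec_stack (Y t) = y t" if "t \<in> ?S" for t
      unfolding Y_def by (rule vec_stack_unstack) (use dy[OF that] that in \<open>simp add: has_vec_derivative_def\<close>)
    have dY: "has_mat_derivative Y (lyap A (Y t) - Q - G t) t ?S" if t: "t \<in> ?S" for t
    proof -
      have c: "lyap A (Y t) - Q - G t \<in> carrier_mat n n"
        using G_sym[OF t] by (auto simp: sym_mat_def minus_carrier_mat)
      have "has_vec_derivative (n * n) (\<lambda>s. vec_stack (Y s)) (vec_stack (lyap A (Y t) - Q - G t)) t ?S"
        unfolding vec_stack_rhs[OF Yc Qc t] vQ vY[OF t]
        by (rule has_vec_derivative_cong[OF dy[OF t] t vY])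
      then show ?thesis by (rule has_vec_derivative_vec_stack[where F = Y, THEN iffD1, OF Yc c t])
    qed
    have YT: "Y T = mat_unstack n (D *\<^sub>v yv)" by (simp add: Y_def yT')
    have Y_sym: "sym_mat n (Y t)" if "t \<in> ?S" for t
      by (rule solution_sym[OF Yc dY Q_sym G_sym _ that]) (simp_all add: YT D sym_mat_unstack_dup)
    have "continuous_on ?S (\<lambda>t. Y t $$ (i, j))" if "i < n" "j < n" for i j
    proof (rule continuous_on_vector_derivative)
      fix t assume t: "t \<in> ?S"
      show "((\<lambda>t. Y t $$ (i, j)) has_vector_derivative (lyap A (Y t) - Q - G t) $$ (i, j)) (at t within ?S)"
        using dY[OF t] Yc[of t] that by (auto simp: has_mat_derivative_def)
    qed
    then have Y_cont: "mat_continuous ?S Y n n" using Yc by (simp add: mat_continuous_def)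
    have "affine_comb n r (mat_unstack n (D *\<^sub>v vec_first z0 d)) v (\<lambda>i. mat_unstack n (D *\<^sub>v q i)) = Q"
      using null_vecs by (subst comb_affine) (simp_all add: qv_def Q_def)
    then have "psd_mat n Q" using psd(1) by simp
    have "affine_comb n r (P0 T + mat_unstack n (D *\<^sub>v vec_last z0 d)) v (\<lambda>i. mat_unstack n (D *\<^sub>v yT i))
        = P0 T + Y T"
      using null_vecs
      by (subst affine_comb_add[OF P0T mat_unstack_carrier], subst comb_affine) (simp_all add: yv_def YT)
    also have "P0 T + Y T = Y T + P0 T" by (rule comm_add_mat[OF P0T Yc])
    finally have "psd_mat n (Y T + P0 T)" using psd(2) by simp
    moreover have "transpose_mat B * Y t = 0\<^sub>m (dim_col B) n" if "t \<in> ?S" for t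
      using BA_0_eq_0_iff[OF Yc, of t] y0[OF that] B(1) by (simp add: vY[OF that])
    ultimately have "inverse_problem_solution n T A B P0 G Q"
      unfolding inverse_problem_solution_def
      using \<open>psd_mat n Q\<close> Y_sym Y_cont dY[unfolded lyap_def] by blast
    then show "\<exists>Q. inverse_problem_solution n T A B P0 G Q" ..
  qed
qed

end
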